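(* Let $\nu:F\to N$ be a smooth real vector bundle over a smooth manifold $N$, let $\Phi:F\to TN$ be a morphism of vector bundles covering a diffeomorphism $\phi:N\to N$, and let $\widetilde{\Phi}:\Gamma(F)\to\Gamma(TN)$ be the induced map on smooth sections, $\widetilde{\Phi}(u)=\Phi\circ u\circ\phi^{-1}$. Suppose that $[\cdot,\cdot]_\Phi$ is a Lie bracket on the space $\Gamma(F)$ of smooth global sections of $F$ such that $$[u,f\cdot v]_\Phi=f\,[u,v]_\Phi+\widetilde{\Phi}(u)(f)\cdot v$$ for all $u,v\in\Gamma(F)$ and all $f\in C^\infty(N)$. Then $[\cdot,\cdot]_\Phi$ is a Lie algebroid bracket on $F$ with respect to the anchor map $\Psi:F\to TN$ covering the identity of $N$ given by $\Psi=(T\phi)^{-1}\circ\Phi$.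
   Context: A vector bundle morphism $\Phi:F\to TN$ covers $\phi:N\to N$ if it maps each fibre $F_y$ linearly into $T_{\phi(y)}N$. Thus the induced map on sections is $\widetilde{\Phi}(u)(x)=\Phi(u(\phi^{-1}(x)))\in T_xN$ for $x\in N$, so $\widetilde{\Phi}(u)$ is a vector field on $N$, and $\widetilde{\Phi}(u)(f)$ denotes the derivative of the function $f$ along this vector field. $T\phi:TN\to TN$ is the tangent map of $\phi$. A Lie bracket on $\Gamma(F)$ is a real Lie algebra structure on the real vector space $\Gamma(F)$. The products $f\cdot v$ are the usual pointwise products of sections by functions. A Lie algebroid on a smooth real vector bundle $A$ over $M$ consists of a real Lie algebra bracket $[\cdot,\cdot]_A$ on the vector space of smooth global sections of $A$ and a morphism of vector bundles $\rho_A:A\to TM$ covering the identity on $M$ (the anchor), such that $[X,fY]_A=f[X,Y]_A+\rho_A(X)(f)\,Y$ for all smooth sections $X,Y$ of $A$ and all $f\in C^\infty(M)$, where $\rho_A(X)$ is the vector field $\rho_A\circ X$. A bracket is called a Lie algebroid bracket with respect to a given anchor if the bracket and the anchor together form a Lie algebroid. *)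

theory Defs
  imports "HOL-Analysis.Analysis"
begin

section \<open>Smooth maps between open subsets of Euclidean vector spaces\<close>

text \<open>
  Model spaces are types of class \<^class>\<open>real_inner\<close> that satisfy the predicate
  \<open>finite_dimensional\<close> below. Unlike \<^class>\<open>euclidean_space\<close> this includes dimension 0, so that
  discrete manifolds and bundles of rank 0 are covered.
\<close>

definition finite_dimensional :: "'e::real_inner itself \<Rightarrow> bool" where
  "finite_dimensional _ \<longleftrightarrow> (\<exists>B::'e set. finite B \<and> span B = UNIV)"

text \<open>
  Used only for open \<open>S\<close> and finite-dimensional domains, where asking all directional derivatives
  \<open>x \<mapsto> Df(x) v\<close> to be of class \<open>C\<^sup>k\<close> is the same as asking \<open>Df\<close> to be of class \<open>C\<^sup>k\<close>.
\<close>

primrec Ck_on :: "nat \<Rightarrow> 'a::real_normed_vector set \<Rightarrow> ('a \<Rightarrow> 'b::real_normed_vector) \<Rightarrow> bool" where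
  "Ck_on 0 S f \<longleftrightarrow> continuous_on S f"
| "Ck_on (Suc k) S f \<longleftrightarrow>
     (\<forall>x\<in>S. f differentiable (at x)) \<and> (\<forall>v. Ck_on k S (\<lambda>x. frechet_derivative f (at x) v))"

definition smooth_on :: "'a::real_normed_vector set \<Rightarrow> ('a \<Rightarrow> 'b::real_normed_vector) \<Rightarrow> bool" where
  "smooth_on S f \<longleftrightarrow> (\<forall>k. Ck_on k S f)"

section \<open>Smooth manifolds\<close>

text \<open>
  A manifold is given by an atlas. A chart \<open>(U, \<chi>)\<close> consists of its domain and the coordinate map;
  the values of \<open>\<chi>\<close> outside \<open>U\<close> are irrelevant. The underlying set and the topology of the manifold
  are those determined by the atlas.
\<close>

type_synonym ('a, 'e) chart = "'a set \<times> ('a \<Rightarrow> 'e)"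
type_synonym ('a, 'e) atlas = "('a, 'e) chart set"

definition chart_inv :: "('a, 'e) chart \<Rightarrow> 'e \<Rightarrow> 'a" where
  "chart_inv c = inv_into (fst c) (snd c)"

definition points :: "('a, 'e) atlas \<Rightarrow> 'a set" where
  "points A = (\<Union>c\<in>A. fst c)"

definition manifold_top :: "('a, 'e::real_inner) atlas \<Rightarrow> 'a topology" where
  "manifold_top A = topology (\<lambda>W. W \<subseteq> points A \<and> (\<forall>c\<in>A. open (snd c ` (W \<inter> fst c))))"

definition smooth_manifold :: "('a, 'e::real_inner) atlas \<Rightarrow> bool" where
  "smooth_manifold A \<longleftrightarrow>
     finite_dimensional TYPE('e) \<and>
     (\<forall>c\<in>A. inj_on (snd c) (fst c) \<and> open (snd c ` fst c)) \<and>
     (\<forall>c\<in>A. \<forall>d\<in>A. open (snd c ` (fst c \<inter> fst d)) \<and>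
        smooth_on (snd c ` (fst c \<inter> fst d)) (snd d \<circ> chart_inv c)) \<and>
     Hausdorff_space (manifold_top A) \<and> second_countable (manifold_top A)"

text \<open>Injectivity of the charts makes the family of sets in \<open>manifold_top\<close> a topology.\<close>

lemma openin_manifold_top:
  assumes inj: "\<And>c. c \<in> A \<Longrightarrow> inj_on (snd c) (fst c)"
    and op: "\<And>c d. c \<in> A \<Longrightarrow> d \<in> A \<Longrightarrow> open (snd c ` (fst c \<inter> fst d))"
  shows "openin (manifold_top A) W \<longleftrightarrow>
    W \<subseteq> points A \<and> (\<forall>c\<in>A. open (snd c ` (W \<inter> fst c)))"
    and "topspace (manifold_top A) = points A"
proof -
  let ?L = "\<lambda>W. W \<subseteq> points A \<and> (\<forall>c\<in>A. open (snd c ` (W \<inter> fst c)))"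
  have "istopology ?L"
    unfolding istopology_def
  proof (intro conjI allI impI ballI)
    fix S T c assume S: "?L S" and T: "?L T" and c: "c \<in> A"
    have "snd c ` (S \<inter> T \<inter> fst c) = snd c ` (S \<inter> fst c) \<inter> snd c ` (T \<inter> fst c)"
      using inj[OF c] by (auto simp: inj_on_def)
    then show "open (snd c ` (S \<inter> T \<inter> fst c))"
      using S T c by auto
  next
    fix K c assume K: "\<forall>S\<in>K. ?L S" and c: "c \<in> A"
    have "snd c ` (\<Union>K \<inter> fst c) = (\<Union>S\<in>K. snd c ` (S \<inter> fst c))"
      by auto
    then show "open (snd c ` (\<Union>K \<inter> fst c))"
      using K c by auto
  qed auto
  then have *: "openin (manifold_top A) W \<longleftrightarrow> ?L W" for W
    unfolding manifold_top_def by (simp add: topology_inverse')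
  then show "openin (manifold_top A) W \<longleftrightarrow> ?L W" .
  have "?L (points A)"
  proof (intro conjI ballI)
    fix c assume c: "c \<in> A"
    then have "points A \<inter> fst c = fst c \<inter> fst c"
      by (auto simp: points_def)
    then show "open (snd c ` (points A \<inter> fst c))"
      using op[OF c c] by simp
  qed simp
  then show "topspace (manifold_top A) = points A"
    using * by (metis openin_subset openin_topspace subset_antisym)
qed

definition smooth_map ::
  "('a, 'e::real_inner) atlas \<Rightarrow> ('b, 'f::real_inner) atlas \<Rightarrow> ('a \<Rightarrow> 'b) \<Rightarrow> bool" where
  "smooth_map A B f \<longleftrightarrow>
     continuous_map (manifold_top A) (manifold_top B) f \<and>
     (\<forall>c\<in>A. \<forall>d\<in>B.
        smooth_on (snd c ` (fst c \<inter> f -` fst d)) (snd d \<circ> f \<circ> chart_inv c))"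

definition diffeomorphism ::
  "('a, 'e::real_inner) atlas \<Rightarrow> ('b, 'f::real_inner) atlas \<Rightarrow> ('a \<Rightarrow> 'b) \<Rightarrow> bool" where
  "diffeomorphism A B f \<longleftrightarrow>
     bij_betw f (points A) (points B) \<and>
     smooth_map A B f \<and> smooth_map B A (inv_into (points A) f)"

definition model_atlas :: "('e, 'e) atlas" where
  "model_atlas = {(UNIV, id)}"

definition smooth_functions :: "('a, 'e::real_inner) atlas \<Rightarrow> ('a \<Rightarrow> real) set" where
  "smooth_functions A = {f. smooth_map A model_atlas f}"

definition restrict_atlas :: "('a, 'e) atlas \<Rightarrow> 'a set \<Rightarrow> ('a, 'e) atlas" where
  "restrict_atlas A W = (\<lambda>c. (fst c \<inter> W, snd c)) ` A"

definition product_atlas :: "('a, 'e) atlas \<Rightarrow> ('b, 'f) atlas \<Rightarrow> ('a \<times> 'b, 'e \<times> 'f) atlas" where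
  "product_atlas A B = (\<lambda>(c, d). (fst c \<times> fst d, map_prod (snd c) (snd d))) ` (A \<times> B)"

section \<open>Smooth real vector bundles\<close>

definition real_vector_space_on ::
  "'v set \<Rightarrow> ('v \<Rightarrow> 'v \<Rightarrow> 'v) \<Rightarrow> (real \<Rightarrow> 'v \<Rightarrow> 'v) \<Rightarrow> 'v \<Rightarrow> bool" where
  "real_vector_space_on V add smul zero \<longleftrightarrow>
     zero \<in> V \<and>
     (\<forall>x\<in>V. \<forall>y\<in>V. add x y \<in> V) \<and>
     (\<forall>a. \<forall>x\<in>V. smul a x \<in> V) \<and>
     (\<forall>x\<in>V. \<forall>y\<in>V. \<forall>z\<in>V. add (add x y) z = add x (add y z)) \<and>
     (\<forall>x\<in>V. \<forall>y\<in>V. add x y = add y x) \<and>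
     (\<forall>x\<in>V. add zero x = x) \<and>
     (\<forall>x\<in>V. \<exists>y\<in>V. add x y = zero) \<and>
     (\<forall>a. \<forall>x\<in>V. \<forall>y\<in>V. smul a (add x y) = add (smul a x) (smul a y)) \<and>
     (\<forall>a b. \<forall>x\<in>V. smul (a + b) x = add (smul a x) (smul b x)) \<and>
     (\<forall>a b. \<forall>x\<in>V. smul a (smul b x) = smul (a * b) x) \<and>
     (\<forall>x\<in>V. smul 1 x = x)"

text \<open>
  The operations are only meaningful on pairs of points in the same fibre. The type \<open>'k\<close> is the model
  fibre, so \<open>'e \<times> 'k\<close> is, up to linear isomorphism, the only possible model space for the total space.
\<close>

record ('f, 'n, 'e, 'k) vbundle =
  vb_total :: "('f, 'e \<times> 'k) atlas"
  vb_base :: "('n, 'e) atlas"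
  vb_proj :: "'f \<Rightarrow> 'n"
  vb_add :: "'f \<Rightarrow> 'f \<Rightarrow> 'f"
  vb_scale :: "real \<Rightarrow> 'f \<Rightarrow> 'f"
  vb_zero :: "'n \<Rightarrow> 'f"

definition fibre :: "('f, 'n, 'e, 'k) vbundle \<Rightarrow> 'n \<Rightarrow> 'f set" where
  "fibre E x = {e \<in> points (vb_total E). vb_proj E e = x}"

definition local_trivialisation ::
  "('f, 'n, 'e::real_inner, 'k::real_inner) vbundle \<Rightarrow> 'n set \<Rightarrow> ('f \<Rightarrow> 'n \<times> 'k) \<Rightarrow> bool" where
  "local_trivialisation E U \<tau> \<longleftrightarrow>
     diffeomorphism (restrict_atlas (vb_total E) (vb_proj E -` U))
       (product_atlas (restrict_atlas (vb_base E) U) (model_atlas :: ('k, 'k) atlas)) \<tau> \<and>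
     (\<forall>x\<in>U.
        (\<forall>e\<in>fibre E x. fst (\<tau> e) = x) \<and>
        (\<forall>e\<in>fibre E x. \<forall>e'\<in>fibre E x. snd (\<tau> (vb_add E e e')) = snd (\<tau> e) + snd (\<tau> e')) \<and>
        (\<forall>a. \<forall>e\<in>fibre E x. snd (\<tau> (vb_scale E a e)) = a *\<^sub>R snd (\<tau> e)))"

definition vector_bundle ::
  "('f, 'n, 'e::real_inner, 'k::real_inner) vbundle \<Rightarrow> bool" where
  "vector_bundle E \<longleftrightarrow>
     smooth_manifold (vb_base E) \<and> smooth_manifold (vb_total E) \<and>
     smooth_map (vb_total E) (vb_base E) (vb_proj E) \<and>
     (\<forall>x\<in>points (vb_base E).
        real_vector_space_on (fibre E x) (vb_add E) (vb_scale E) (vb_zero E x)) \<and>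
     (\<forall>x\<in>points (vb_base E). \<exists>U \<tau>.
        openin (manifold_top (vb_base E)) U \<and> x \<in> U \<and> local_trivialisation E U \<tau>)"

definition bundle_morphism ::
  "('f, 'm, 'e::real_inner, 'k::real_inner) vbundle \<Rightarrow>
   ('g, 'n, 'd::real_inner, 'l::real_inner) vbundle \<Rightarrow> ('f \<Rightarrow> 'g) \<Rightarrow> ('m \<Rightarrow> 'n) \<Rightarrow> bool" where
  "bundle_morphism E G \<Phi> \<phi> \<longleftrightarrow>
     smooth_map (vb_total E) (vb_total G) \<Phi> \<and> smooth_map (vb_base E) (vb_base G) \<phi> \<and>
     (\<forall>x\<in>points (vb_base E).
        (\<forall>e\<in>fibre E x. \<Phi> e \<in> fibre G (\<phi> x)) \<and>
        (\<forall>e\<in>fibre E x. \<forall>e'\<in>fibre E x. \<Phi> (vb_add E e e') = vb_add G (\<Phi> e) (\<Phi> e')) \<and>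
        (\<forall>a. \<forall>e\<in>fibre E x. \<Phi> (vb_scale E a e) = vb_scale G a (\<Phi> e)))"

text \<open>
  Sections are taken in \<^const>\<open>extensional\<close> form, so that equality of elements of \<open>sections E\<close> is
  equality of maps defined on the base.
\<close>

definition sections :: "('f, 'n, 'e::real_inner, 'k::real_inner) vbundle \<Rightarrow> ('n \<Rightarrow> 'f) set" where
  "sections E = {u \<in> extensional (points (vb_base E)).
     smooth_map (vb_base E) (vb_total E) u \<and> (\<forall>x\<in>points (vb_base E). vb_proj E (u x) = x)}"

definition sec_add ::
  "('f, 'n, 'e, 'k) vbundle \<Rightarrow> ('n \<Rightarrow> 'f) \<Rightarrow> ('n \<Rightarrow> 'f) \<Rightarrow> 'n \<Rightarrow> 'f" where
  "sec_add E u v = (\<lambda>x\<in>points (vb_base E). vb_add E (u x) (v x))"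

definition sec_mult ::
  "('f, 'n, 'e, 'k) vbundle \<Rightarrow> ('n \<Rightarrow> real) \<Rightarrow> ('n \<Rightarrow> 'f) \<Rightarrow> 'n \<Rightarrow> 'f" where
  "sec_mult E f u = (\<lambda>x\<in>points (vb_base E). vb_scale E (f x) (u x))"

definition sec_scale ::
  "('f, 'n, 'e, 'k) vbundle \<Rightarrow> real \<Rightarrow> ('n \<Rightarrow> 'f) \<Rightarrow> 'n \<Rightarrow> 'f" where
  "sec_scale E a = sec_mult E (\<lambda>_. a)"

definition sec_zero :: "('f, 'n, 'e, 'k) vbundle \<Rightarrow> 'n \<Rightarrow> 'f" where
  "sec_zero E = (\<lambda>x\<in>points (vb_base E). vb_zero E x)"

section \<open>The tangent bundle\<close>

text \<open>
  A tangent vector at \<open>p\<close> is an equivalence class of pairs (chart \<open>c\<close> around \<open>p\<close>, vector of \<open>'e\<close>), where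
  two pairs are equivalent if the derivative of the change of charts maps one vector to the other.
  Such a class contains exactly one vector for each chart around \<open>p\<close>; it is encoded as the function
  from charts to vectors of which it is the graph, extended by 0 to all other arguments.
\<close>

definition charts_at :: "('a, 'e) atlas \<Rightarrow> 'a \<Rightarrow> ('a, 'e) chart set" where
  "charts_at A p = {c \<in> A. p \<in> fst c}"

definition tangent_space ::
  "('a, 'e::real_inner) atlas \<Rightarrow> 'a \<Rightarrow> (('a, 'e) chart \<Rightarrow> 'e) set" where
  "tangent_space A p = {v.
     (\<forall>c\<in>charts_at A p. \<forall>d\<in>charts_at A p.
        v d = frechet_derivative (snd d \<circ> chart_inv c) (at (snd c p)) (v c)) \<and>
     (\<forall>c. c \<notin> charts_at A p \<longrightarrow> v c = 0)}"

type_synonym ('a, 'e) tangent = "'a \<times> (('a, 'e) chart \<Rightarrow> 'e)"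

definition tangent_chart ::
  "('a, 'e::real_inner) atlas \<Rightarrow> ('a, 'e) chart \<Rightarrow> (('a, 'e) tangent, 'e \<times> 'e) chart" where
  "tangent_chart A c =
     (SIGMA p:fst c. tangent_space A p, \<lambda>(p, v). (snd c p, v c))"

definition tangent_bundle ::
  "('a, 'e::real_inner) atlas \<Rightarrow> (('a, 'e) tangent, 'a, 'e, 'e) vbundle" where
  "tangent_bundle A =
     \<lparr> vb_total = tangent_chart A ` A,
       vb_base = A,
       vb_proj = fst,
       vb_add = (\<lambda>(p, v) (q, w). (p, \<lambda>c. v c + w c)),
       vb_scale = (\<lambda>a (p, v). (p, \<lambda>c. a *\<^sub>R v c)),
       vb_zero = (\<lambda>p. (p, \<lambda>c. 0)) \<rparr>"

text \<open>The next two definitions do not depend on the choice of the chart around \<open>p\<close>.\<close>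

definition tangent_map ::
  "('a, 'e::real_inner) atlas \<Rightarrow> ('b, 'f::real_inner) atlas \<Rightarrow> ('a \<Rightarrow> 'b) \<Rightarrow>
   ('a, 'e) tangent \<Rightarrow> ('b, 'f) tangent" where
  "tangent_map A B \<phi> = (\<lambda>(p, v).
     let c = (SOME c. c \<in> charts_at A p) in
       (\<phi> p, \<lambda>d. if d \<in> charts_at B (\<phi> p)
          then frechet_derivative (snd d \<circ> \<phi> \<circ> chart_inv c) (at (snd c p)) (v c) else 0))"

definition tangent_derivative ::
  "('a, 'e::real_inner) atlas \<Rightarrow> ('a, 'e) tangent \<Rightarrow> ('a \<Rightarrow> real) \<Rightarrow> real" where
  "tangent_derivative A = (\<lambda>(p, v) f.
     let c = (SOME c. c \<in> charts_at A p) in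
       frechet_derivative (f \<circ> chart_inv c) (at (snd c p)) (v c))"

definition field_derivative ::
  "('a, 'e::real_inner) atlas \<Rightarrow> ('a \<Rightarrow> ('a, 'e) tangent) \<Rightarrow> ('a \<Rightarrow> real) \<Rightarrow> 'a \<Rightarrow> real" where
  "field_derivative A X f = (\<lambda>x. tangent_derivative A (X x) f)"

section \<open>Lie brackets on sections and Lie algebroids\<close>

definition lie_bracket_on ::
  "'v set \<Rightarrow> ('v \<Rightarrow> 'v \<Rightarrow> 'v) \<Rightarrow> (real \<Rightarrow> 'v \<Rightarrow> 'v) \<Rightarrow> 'v \<Rightarrow> ('v \<Rightarrow> 'v \<Rightarrow> 'v) \<Rightarrow> bool" where
  "lie_bracket_on V add smul zero br \<longleftrightarrow>
     (\<forall>x\<in>V. \<forall>y\<in>V. br x y \<in> V) \<and>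
     (\<forall>x\<in>V. \<forall>y\<in>V. \<forall>z\<in>V. br (add x y) z = add (br x z) (br y z)) \<and>
     (\<forall>x\<in>V. \<forall>y\<in>V. \<forall>z\<in>V. br x (add y z) = add (br x y) (br x z)) \<and>
     (\<forall>a. \<forall>x\<in>V. \<forall>y\<in>V. br (smul a x) y = smul a (br x y)) \<and>
     (\<forall>a. \<forall>x\<in>V. \<forall>y\<in>V. br x (smul a y) = smul a (br x y)) \<and>
     (\<forall>x\<in>V. br x x = zero) \<and>
     (\<forall>x\<in>V. \<forall>y\<in>V. \<forall>z\<in>V. add (br x (br y z)) (add (br y (br z x)) (br z (br x y))) = zero)"

definition section_lie_bracket ::
  "('f, 'n, 'e::real_inner, 'k::real_inner) vbundle \<Rightarrow>
   (('n \<Rightarrow> 'f) \<Rightarrow> ('n \<Rightarrow> 'f) \<Rightarrow> 'n \<Rightarrow> 'f) \<Rightarrow> bool" where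
  "section_lie_bracket E br \<longleftrightarrow>
     lie_bracket_on (sections E) (sec_add E) (sec_scale E) (sec_zero E) br"

definition induced_map ::
  "('f, 'n, 'e, 'k) vbundle \<Rightarrow> ('f \<Rightarrow> 'g) \<Rightarrow> ('n \<Rightarrow> 'n) \<Rightarrow> ('n \<Rightarrow> 'f) \<Rightarrow> 'n \<Rightarrow> 'g" where
  "induced_map E \<Phi> \<phi> u =
     (\<lambda>x\<in>points (vb_base E). \<Phi> (u (inv_into (points (vb_base E)) \<phi> x)))"

definition lie_algebroid ::
  "('f, 'n, 'e::real_inner, 'k::real_inner) vbundle \<Rightarrow>
   (('n \<Rightarrow> 'f) \<Rightarrow> ('n \<Rightarrow> 'f) \<Rightarrow> 'n \<Rightarrow> 'f) \<Rightarrow> ('f \<Rightarrow> ('n, 'e) tangent) \<Rightarrow> bool" where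
  "lie_algebroid E br \<rho> \<longleftrightarrow>
     vector_bundle E \<and>
     section_lie_bracket E br \<and>
     bundle_morphism E (tangent_bundle (vb_base E)) \<rho> id \<and>
     (\<forall>X\<in>sections E. \<forall>Y\<in>sections E. \<forall>f\<in>smooth_functions (vb_base E).
        br X (sec_mult E f Y) =
          sec_add E (sec_mult E f (br X Y))
            (sec_mult E (field_derivative (vb_base E) (\<rho> \<circ> X) f) Y))"

end

(*
  Let y be a point with x = phi(y) different from y, and choose a function f with f(y) = 1 that
  vanishes near x. Antisymmetry and the Leibniz rule in the second argument give [fu, s](x) = 0 for
  every section s, because every term contains f(x) or a derivative of f at x. On the other hand the
  Leibniz rule for [fu, gv] leaves f(y) (Phi(u(y)) g) v(x) at x. Choosing v(x) nonzero shows that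
  Phi vanishes on the fibre over y.

  Hence over a moved point both Phi~ and Psi are zero. Over a fixed point x, either Phi is zero on
  the fibre, or by continuity it is nonzero over a whole neighbourhood, which then consists of fixed
  points, so that the tangent map of phi at x is the identity. In all cases Psi(X) and Phi~(X) are
  the same vector field, and the assumed Leibniz rule is the one required of a Lie algebroid.
*)
theory Submission
  imports Defs
begin

section \<open>Calculus of smooth maps\<close>

text \<open>The assumed and the required Leibniz rule differ at \<open>x\<close> in two ways: one
  evaluates \<open>\<Phi>\<close> on the value of the section over the preimage of \<open>x\<close>,
  the other over \<open>x\<close> itself, and only the second applies the inverse tangent map. The
  argument exploits an asymmetry: the left argument of the bracket enters the derivative term
  through its value at \<open>y\<close>, whereas the right argument and all function values are read
  at \<open>x\<close>. Antisymmetry confronts the two roles. The bracket is never localised; it only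
  ever sees global sections. What has to be supplied is a stock of global objects with prescribed
  behaviour at one point: bump functions, functions that detect tangent vectors, and sections
  through a given element of a fibre. The Hausdorff condition enters when functions are extended by
  zero from a chart, and again to separate \<open>x\<close> from \<open>y\<close>. A bundle of rank
  0 offers no nonzero \<open>v\<close>, but there linearity alone makes \<open>\<Phi>\<close>
  vanish.\<close>

lemma Ck_on_cong:
  assumes "open S" "\<And>x. x \<in> S \<Longrightarrow> f x = g x"
  shows "Ck_on k S f \<longleftrightarrow> Ck_on k S g"
  using assms(2)
proof (induction k arbitrary: f g)
  case 0
  then show ?case by (auto cong: continuous_on_cong)
next
  case (Suc k)
  have d: "f differentiable (at x) \<longleftrightarrow> g differentiable (at x)" if "x \<in> S" for x
    using has_derivative_transform_within_open[OF _ assms(1) that, where t=UNIV] Suc.prems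
    unfolding differentiable_def by (metis (no_types, lifting))
  have e: "frechet_derivative f (at x) = frechet_derivative g (at x)"
    if "x \<in> S" "f differentiable (at x)" for x
    using frechet_derivative_transform_within_open[OF that(2) assms(1) that(1)] Suc.prems by blast
  \<comment> \<open>Derivatives are compared only when \<open>f\<close> is differentiable on all of
    \<open>S\<close>; if this fails at some point, it fails there for \<open>g\<close> too and both
    sides are false.\<close>
  show ?case
  proof (cases "\<forall>x\<in>S. f differentiable (at x)")
    case True
    then have "Ck_on k S (\<lambda>x. frechet_derivative f (at x) v) \<longleftrightarrow> Ck_on k S (\<lambda>x. frechet_derivative g (at x) v)" for v
      using e by (intro Suc.IH) auto
    then show ?thesis using d by auto
  next
    case False
    then show ?thesis using d by auto
  qed
qed

lemma Ck_on_subset: "Ck_on k S f \<Longrightarrow> T \<subseteq> S \<Longrightarrow> Ck_on k T f"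
proof (induction k arbitrary: f)
  case 0
  then show ?case by (auto intro: continuous_on_subset)
next
  case (Suc k)
  then show ?case by auto
qed

lemma Ck_on_local:
  assumes "\<And>x. x \<in> S \<Longrightarrow> \<exists>T. open T \<and> x \<in> T \<and> Ck_on k T f"
  shows "Ck_on k S f"
  using assms
proof (induction k arbitrary: f)
  case 0
  have "isCont f x" if "x \<in> S" for x
    using 0[OF that] by (auto simp: continuous_on_eq_continuous_at)
  then show ?case by (simp add: continuous_at_imp_continuous_on)
next
  case (Suc k)
  show ?case
    unfolding Ck_on.simps
  proof (intro conjI ballI allI)
    fix x assume "x \<in> S"
    from Suc.prems[OF this] show "f differentiable (at x)" by auto
  next
    fix v
    show "Ck_on k S (\<lambda>x. frechet_derivative f (at x) v)"
      by (rule Suc.IH) (use Suc.prems in fastforce)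
  qed
qed

text \<open>Lets the closure proofs work with explicit derivatives taken from the differentiation
  rules; \<open>frechet_derivative\<close> is identified with them once, here.\<close>

lemma Ck_on_SucI:
  assumes "open S" "\<And>x. x \<in> S \<Longrightarrow> (f has_derivative D x) (at x)"
    and "\<And>v. Ck_on k S (\<lambda>x. D x v)"
  shows "Ck_on (Suc k) S f"
proof -
  have "frechet_derivative f (at x) = D x" if "x \<in> S" for x
    using frechet_derivative_at[OF assms(2)[OF that]] by simp
  then have "Ck_on k S (\<lambda>x. frechet_derivative f (at x) v)" for v
    by (subst Ck_on_cong[OF assms(1), where g = "\<lambda>x. D x v"]) (simp_all add: assms(3))
  then show ?thesis
    using assms(2) by (auto simp: differentiable_def)
qed

lemma Ck_on_Suc_has_derivative:
  "Ck_on (Suc k) S f \<Longrightarrow> x \<in> S \<Longrightarrow> (f has_derivative frechet_derivative f (at x)) (at x)"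
  by (simp add: frechet_derivative_works)

lemma Ck_on_SucD: "Ck_on (Suc k) S f \<Longrightarrow> Ck_on k S f"
proof (induction k arbitrary: f)
  case 0
  then show ?case
    by (auto intro!: continuous_at_imp_continuous_on differentiable_imp_continuous_within)
next
  case (Suc k)
  then show ?case by (metis Ck_on.simps(2))
qed

lemma Ck_on_const: "Ck_on k S (\<lambda>x. c)"
  by (induction k arbitrary: c) auto

lemma Ck_on_bounded_linear_compose:
  assumes L: "bounded_linear L" and S: "open S" and "Ck_on k S f"
  shows "Ck_on k S (\<lambda>x. L (f x))"
  using assms(3)
proof (induction k arbitrary: f)
  case 0
  then show ?case
    using bounded_linear.continuous_on[OF L] by auto
next
  case (Suc k)
  show ?case
    by (rule Ck_on_SucI[OF S bounded_linear.has_derivative[OF L Ck_on_Suc_has_derivative[OF Suc.prems]]])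
      (use Suc in auto)
qed

lemma Ck_on_ident: "open S \<Longrightarrow> Ck_on k S (\<lambda>x. x)"
  by (cases k) (auto intro!: Ck_on_SucI Ck_on_const has_derivative_ident simp del: Ck_on.simps(2))

lemma Ck_on_bounded_linear: "bounded_linear L \<Longrightarrow> open S \<Longrightarrow> Ck_on k S L"
  using Ck_on_bounded_linear_compose[OF _ _ Ck_on_ident] by blast

lemma Ck_on_add:
  assumes S: "open S" and "Ck_on k S f" "Ck_on k S g"
  shows "Ck_on k S (\<lambda>x. f x + g x)"
  using assms(2,3)
proof (induction k arbitrary: f g)
  case 0
  then show ?case by (auto intro: continuous_on_add)
next
  case (Suc k)
  show ?case
    by (rule Ck_on_SucI[OF S has_derivative_add[OF Ck_on_Suc_has_derivative[OF Suc.prems(1)]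
            Ck_on_Suc_has_derivative[OF Suc.prems(2)]]])
      (use Suc in auto)
qed

lemma Ck_on_sum:
  assumes S: "open S" and "finite B" and "\<And>b. b \<in> B \<Longrightarrow> Ck_on k S (f b)"
  shows "Ck_on k S (\<lambda>x. \<Sum>b\<in>B. f b x)"
  using assms(2,3)
  by (induction B rule: finite_induct) (auto intro: Ck_on_const Ck_on_add[OF S])

text \<open>The product rule returns two products of the same kind, each with one factor
  differentiated, so the induction closes for arbitrary \<open>f\<close> and \<open>g\<close>. The
  undifferentiated factor is first lowered to level \<open>k\<close> by
  \<open>Ck_on_SucD\<close>.\<close>

lemma Ck_on_bounded_bilinear:
  assumes "bounded_bilinear P" and S: "open S" and "Ck_on k S f" "Ck_on k S g"
  shows "Ck_on k S (\<lambda>x. P (f x) (g x))"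
  using assms(3,4)
proof (induction k arbitrary: f g)
  case 0
  then show ?case using bounded_bilinear.continuous_on[OF assms(1)] by auto
next
  case (Suc k)
  have k: "Ck_on k S f" "Ck_on k S g"
    and d: "Ck_on k S (\<lambda>x. frechet_derivative f (at x) v)" "Ck_on k S (\<lambda>x. frechet_derivative g (at x) v)" for v
    using Suc.prems Ck_on_SucD by auto
  show ?case
    by (rule Ck_on_SucI[OF S bounded_bilinear.FDERIV[OF assms(1)
            Ck_on_Suc_has_derivative[OF Suc.prems(1)] Ck_on_Suc_has_derivative[OF Suc.prems(2)]]])
      (use k d in \<open>auto intro!: Ck_on_add[OF S] Suc.IH\<close>)
qed

lemma Ck_on_Pair:
  assumes S: "open S" and "Ck_on k S f" "Ck_on k S g"
  shows "Ck_on k S (\<lambda>x. (f x, g x))"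
  using assms(2,3)
proof (induction k arbitrary: f g)
  case 0
  then show ?case by (auto intro: continuous_on_Pair)
next
  case (Suc k)
  show ?case
    by (rule Ck_on_SucI[OF S has_derivative_Pair[OF Ck_on_Suc_has_derivative[OF Suc.prems(1)]
            Ck_on_Suc_has_derivative[OF Suc.prems(2)]]])
      (use Suc in auto)
qed

section \<open>Orthonormal bases and compact balls in finite-dimensional inner product
  spaces\<close>

lemma finite_dimensional_orthonormal:
  assumes "finite_dimensional TYPE('a::real_inner)"
  obtains B :: "'a::real_inner set" where "finite B" "\<And>x. (\<Sum>b\<in>B. (x \<bullet> b) *\<^sub>R b) = x" "\<And>b. b \<in> B \<Longrightarrow> norm b = 1"
proof -
  obtain B0 :: "'a set" where "finite B0" "span B0 = UNIV"
    using assms by (auto simp: finite_dimensional_def)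
  then obtain C :: "'a set" where C: "finite C" "span C = UNIV" "pairwise orthogonal C"
    using basis_orthogonal by metis
  define s :: "'a \<Rightarrow> 'a" where "s b = b /\<^sub>R norm b" for b
  \<comment> \<open>The orthogonal spanning set may contain 0, which cannot be normalised; dropping
    it leaves the span unchanged. In dimension 0 this makes \<open>B\<close> empty.\<close>
  define B where "B = s ` (C - {0})"
  have nrm: "norm b = 1" if "b \<in> B" for b
    using that by (auto simp: B_def s_def field_simps split: if_splits)
  have fin: "finite B" using C by (simp add: B_def)
  have orth: "b \<bullet> c = 0" if bc: "b \<in> B" "c \<in> B" "b \<noteq> c" for b c
  proof -
    obtain b' c' where "b' \<in> C" "c' \<in> C" "b = s b'" "c = s c'"
      using bc by (auto simp: B_def)
    moreover from this have "b' \<noteq> c'" using bc by auto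
    ultimately have "b' \<bullet> c' = 0"
      using C(3) by (auto simp: pairwise_def orthogonal_def)
    then show ?thesis using \<open>b = _\<close> \<open>c = _\<close> by (simp add: s_def)
  qed
  have "C \<subseteq> span B"
  proof
    fix c assume c: "c \<in> C"
    show "c \<in> span B"
    proof (cases "c = 0")
      case False
      then have "c = norm c *\<^sub>R s c" by (simp add: s_def)
      moreover have "s c \<in> span B"
        using c False by (auto simp: B_def intro: span_base)
      ultimately show ?thesis by (metis span_scale)
    qed (simp add: span_zero)
  qed
  then have sp: "span B = UNIV"
    using C(2) by (metis span_minimal subspace_span top.extremum_uniqueI)
  have rep: "(\<Sum>b\<in>B. (x \<bullet> b) *\<^sub>R b) = x" for x
  proof -
    have "x \<in> span B" using sp by simp
    then show ?thesis
    proof (induction rule: span_induct_alt)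
      case base
      show ?case by simp
    next
      case (step c x y)
      have "(\<Sum>b\<in>B. (x \<bullet> b) *\<^sub>R b) = (\<Sum>b\<in>B. if b = x then b else 0)"
        using orth[OF step(1)] nrm[OF step(1)] by (intro sum.cong) (auto simp: dot_square_norm)
      also have "\<dots> = x" using step(1) fin by simp
      finally have x: "(\<Sum>b\<in>B. (x \<bullet> b) *\<^sub>R b) = x" .
      have "(\<Sum>b\<in>B. ((c *\<^sub>R x + y) \<bullet> b) *\<^sub>R b) = c *\<^sub>R (\<Sum>b\<in>B. (x \<bullet> b) *\<^sub>R b) + (\<Sum>b\<in>B. (y \<bullet> b) *\<^sub>R b)"
        by (simp add: inner_add_left scaleR_add_left sum.distrib scaleR_sum_right)
      then show ?case using x step by simp
    qed
  qed
  from that[OF fin rep nrm] show thesis .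
qed

lemma finite_dimensional_prod:
  assumes "finite_dimensional TYPE('a::real_inner)" "finite_dimensional TYPE('b::real_inner)"
  shows "finite_dimensional TYPE('a \<times> 'b)"
proof -
  obtain B :: "'a set" where B: "finite B" "span B = UNIV"
    using assms(1) by (auto simp: finite_dimensional_def)
  obtain C :: "'b set" where C: "finite C" "span C = UNIV"
    using assms(2) by (auto simp: finite_dimensional_def)
  have l: "linear (\<lambda>x. (x, 0::'b))" "linear (\<lambda>y. (0::'a, y))"
    by (auto intro!: linearI)
  let ?D = "(\<lambda>x. (x, 0)) ` B \<union> (\<lambda>y. (0, y)) ` C"
  have "(x, y) \<in> span ?D" for x :: 'a and y :: 'b
  proof -
    have "(x, 0) \<in> span ?D"
      using linear_span_image[OF l(1), of B] B(2) span_mono[of "(\<lambda>x. (x, 0)) ` B" ?D] by blast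
    moreover have "(0, y) \<in> span ?D"
      using linear_span_image[OF l(2), of C] C(2) span_mono[of "(\<lambda>y. (0, y)) ` C" ?D] by blast
    ultimately have "(x, 0) + (0, y) \<in> span ?D" by (rule span_add)
    then show ?thesis by simp
  qed
  then show ?thesis
    unfolding finite_dimensional_def using B C by (intro exI[of _ ?D]) auto
qed

text \<open>A vector bundle carries its dimension assumptions through the models \<open>'e\<close>
  and \<open>'e \<times> 'k\<close> of base and total space; this recovers the assumption for the
  model fibre \<open>'k\<close> by projecting a spanning set.\<close>

lemma finite_dimensional_snd:
  assumes "finite_dimensional TYPE('a::real_inner \<times> 'b::real_inner)"
  shows "finite_dimensional TYPE('b)"
proof -
  obtain B :: "('a \<times> 'b) set" where B: "finite B" "span B = UNIV"
    using assms by (auto simp: finite_dimensional_def)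
  have "span (snd ` B) = snd ` span B"
    by (rule linear_span_image) (simp add: bounded_linear.linear bounded_linear_snd)
  then show ?thesis
    unfolding finite_dimensional_def using B by (intro exI[of _ "snd ` B"]) force
qed

lemma finite_dimensional_real: "finite_dimensional TYPE(real)"
proof -
  have "x \<in> span {1}" for x :: real
    using span_scale[OF span_base[of 1 "{1::real}"], of x] by simp
  then show ?thesis
    unfolding finite_dimensional_def by (intro exI[of _ "{1}"]) auto
qed

text \<open>By Cauchy-Schwarz the ball around 0 has coordinates in \<open>[-r, r]\<close>, so it is
  a closed part of the image of a coordinate cube, and that image is compact by adding one
  coordinate interval at a time. Compactness later makes chart balls closed in a Hausdorff
  manifold.\<close>

lemma compact_cball_finite_dimensional:
  assumes "finite_dimensional TYPE('a::real_inner)"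
  shows "compact (cball (a::'a) r)"
proof -
  obtain B :: "'a set" where B: "finite B" "\<And>x. (\<Sum>b\<in>B. (x \<bullet> b) *\<^sub>R b) = x" "\<And>b. b \<in> B \<Longrightarrow> norm b = 1"
    by (rule finite_dimensional_orthonormal[OF assms]) blast
  have cpt: "compact {\<Sum>b\<in>B. f b *\<^sub>R b | f. \<forall>b\<in>B. \<bar>f b\<bar> \<le> r}" for r
    using B(1)
  proof (induction B rule: finite_induct)
    case empty
    have "{\<Sum>b\<in>{}. f b *\<^sub>R b | f. \<forall>b\<in>{}. \<bar>f b\<bar> \<le> r} = {0::'a}" by auto
    then show ?case by (simp only: compact_sing)
  next
    case (insert c B)
    let ?K = "{\<Sum>b\<in>B. f b *\<^sub>R b | f. \<forall>b\<in>B. \<bar>f b\<bar> \<le> r}"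
    have "{\<Sum>b\<in>insert c B. f b *\<^sub>R b | f. \<forall>b\<in>insert c B. \<bar>f b\<bar> \<le> r}
      = (\<lambda>(t, x). t *\<^sub>R c + x) ` ({-r..r} \<times> ?K)" (is "?L = ?R")
    proof
      show "?L \<subseteq> ?R"
      proof
        fix x assume "x \<in> ?L"
        then obtain f where f: "x = (\<Sum>b\<in>insert c B. f b *\<^sub>R b)" "\<forall>b\<in>insert c B. \<bar>f b\<bar> \<le> r"
          by auto
        then have "x = (\<lambda>(t, x). t *\<^sub>R c + x) (f c, \<Sum>b\<in>B. f b *\<^sub>R b)"
          using insert by simp
        moreover have "(f c, \<Sum>b\<in>B. f b *\<^sub>R b) \<in> {-r..r} \<times> ?K"
          using f(2) by (auto simp: abs_le_iff)
        ultimately show "x \<in> ?R" by (rule image_eqI)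
      qed
      show "?R \<subseteq> ?L"
      proof
        fix x assume "x \<in> ?R"
        then obtain t f where f: "x = t *\<^sub>R c + (\<Sum>b\<in>B. f b *\<^sub>R b)" "\<forall>b\<in>B. \<bar>f b\<bar> \<le> r" "\<bar>t\<bar> \<le> r"
          by (auto simp: abs_le_iff)
        have "(\<Sum>b\<in>B. f b *\<^sub>R b) = (\<Sum>b\<in>B. (f(c := t)) b *\<^sub>R b)"
          using insert by (intro sum.cong) auto
        then have "x = (\<Sum>b\<in>insert c B. (f(c := t)) b *\<^sub>R b)"
          using insert f by simp
        then show "x \<in> ?L" using f by (intro CollectI exI[of _ "f(c := t)"]) auto
      qed
    qed
    moreover have "compact \<dots>"
      using insert.IH by (intro compact_continuous_image compact_Times compact_Icc)
        (auto simp: split_def intro!: continuous_intros)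
    ultimately show ?case by simp
  qed
  have "compact (cball (0::'a) r)"
  proof -
    let ?K = "{\<Sum>b\<in>B. f b *\<^sub>R b | f. \<forall>b\<in>B. \<bar>f b\<bar> \<le> r}"
    have "x \<in> ?K" if "x \<in> cball 0 r" for x
    proof (intro CollectI exI[of _ "\<lambda>b. x \<bullet> b"] conjI ballI)
      show "x = (\<Sum>b\<in>B. (x \<bullet> b) *\<^sub>R b)" using B(2) by simp
      fix b assume "b \<in> B"
      then show "\<bar>x \<bullet> b\<bar> \<le> r"
        using Cauchy_Schwarz_ineq2[of x b] B(3) that by simp
    qed
    then have "cball 0 r = ?K \<inter> cball 0 r" by auto
    moreover have "compact \<dots>" using cpt by (intro compact_Int_closed) auto
    ultimately show ?thesis by simp
  qed
  then have "compact ((+) a ` cball 0 r)" by (rule compact_translation)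
  then show ?thesis by simp
qed

lemma frechet_derivative_linear:
  assumes "f differentiable (at x)"
  shows "frechet_derivative f (at x) (v + w) = frechet_derivative f (at x) v + frechet_derivative f (at x) w"
    "frechet_derivative f (at x) (c *\<^sub>R v) = c *\<^sub>R frechet_derivative f (at x) v"
    "frechet_derivative f (at x) 0 = 0"
  using linear_frechet_derivative[OF assms] by (auto simp: linear_add linear_scale linear_0)

lemma frechet_derivative_expand:
  fixes f :: "'a::real_inner \<Rightarrow> 'b::real_normed_vector"
  assumes "f differentiable (at x)" "finite B" "\<And>x. (\<Sum>b\<in>B. (x \<bullet> b) *\<^sub>R b) = x"
  shows "frechet_derivative f (at x) v = (\<Sum>b\<in>B. (v \<bullet> b) *\<^sub>R frechet_derivative f (at x) b)"
proof -
  have "frechet_derivative f (at x) (\<Sum>b\<in>B. (v \<bullet> b) *\<^sub>R b) = (\<Sum>b\<in>B. (v \<bullet> b) *\<^sub>R frechet_derivative f (at x) b)"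
    using linear_frechet_derivative[OF assms(1)] by (simp add: linear_sum linear_scale)
  then show ?thesis using assms(3) by simp
qed

text \<open>In the chain rule \<open>g\<close> is differentiated in the direction
  \<open>frechet_derivative f (at x) v\<close>, which moves with \<open>x\<close>, while
  \<open>Ck_on\<close> controls derivatives in fixed directions. Expanding the direction in an
  orthonormal basis of the middle space leaves scalar coefficients times derivatives of
  \<open>g\<close> in the fixed directions \<open>b\<close>, to which the induction hypothesis
  applies.\<close>

lemma Ck_on_compose:
  fixes g :: "'b::real_inner \<Rightarrow> 'c::real_normed_vector"
  assumes fd: "finite_dimensional TYPE('b)" and S: "open S"
    and "Ck_on k S f" "Ck_on k T g" and fS: "f ` S \<subseteq> T"
  shows "Ck_on k S (\<lambda>x. g (f x))"
proof -
  obtain B :: "'b set" where B: "finite B" "\<And>x. (\<Sum>b\<in>B. (x \<bullet> b) *\<^sub>R b) = x"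
    by (rule finite_dimensional_orthonormal[OF fd]) blast
  show ?thesis
    using assms(3,4)
  proof (induction k arbitrary: g)
    case 0
    then show ?case using fS continuous_on_compose2 by auto
  next
    case (Suc k)
    define D where "D x v = (\<Sum>b\<in>B. (frechet_derivative f (at x) v \<bullet> b) *\<^sub>R frechet_derivative g (at (f x)) b)" for x v
    have "((\<lambda>x. g (f x)) has_derivative D x) (at x)" if x: "x \<in> S" for x
    proof -
      have gd: "g differentiable (at (f x))" using Suc.prems(2) x fS by auto
      have "((g \<circ> f) has_derivative (frechet_derivative g (at (f x)) \<circ> frechet_derivative f (at x))) (at x)"
        using x fS by (intro diff_chain_at Ck_on_Suc_has_derivative[OF Suc.prems(1)] Ck_on_Suc_has_derivative[OF Suc.prems(2)]) auto
      moreover have "frechet_derivative g (at (f x)) \<circ> frechet_derivative f (at x) = D x"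
        unfolding D_def o_def by (intro ext frechet_derivative_expand[OF gd B])
      ultimately show ?thesis by (simp add: o_def)
    qed
    moreover have "Ck_on k S (\<lambda>x. D x v)" for v
      unfolding D_def
    proof (intro Ck_on_sum[OF S B(1)] Ck_on_bounded_bilinear[OF bounded_bilinear_scaleR S])
      fix b assume "b \<in> B"
      show "Ck_on k S (\<lambda>x. frechet_derivative f (at x) v \<bullet> b)"
        using Suc.prems(1) by (intro Ck_on_bounded_linear_compose[OF bounded_linear_inner_left S]) auto
      show "Ck_on k S (\<lambda>x. frechet_derivative g (at (f x)) b)"
        by (rule Suc.IH[OF Ck_on_SucD[OF Suc.prems(1)]]) (use Suc.prems(2) in simp)
    qed
    ultimately show ?case by (rule Ck_on_SucI[OF S])
  qed
qed

section \<open>The same calculus for maps smooth to all orders\<close>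

lemma smooth_on_cong:
  "open S \<Longrightarrow> (\<And>x. x \<in> S \<Longrightarrow> f x = g x) \<Longrightarrow> smooth_on S f \<longleftrightarrow> smooth_on S g"
  unfolding smooth_on_def using Ck_on_cong by blast

lemma smooth_on_subset: "smooth_on S f \<Longrightarrow> T \<subseteq> S \<Longrightarrow> smooth_on T f"
  unfolding smooth_on_def using Ck_on_subset by blast

lemma smooth_on_local:
  assumes "\<And>x. x \<in> S \<Longrightarrow> \<exists>T. open T \<and> x \<in> T \<and> smooth_on T f"
  shows "smooth_on S f"
  unfolding smooth_on_def
proof (intro allI Ck_on_local)
  fix k x assume "x \<in> S"
  then show "\<exists>T. open T \<and> x \<in> T \<and> Ck_on k T f"
    using assms unfolding smooth_on_def by meson
qed

lemma smooth_on_continuous: "smooth_on S f \<Longrightarrow> continuous_on S f"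
  unfolding smooth_on_def using Ck_on.simps(1) by blast

lemma smooth_on_differentiable: "smooth_on S f \<Longrightarrow> x \<in> S \<Longrightarrow> f differentiable (at x)"
  unfolding smooth_on_def using Ck_on.simps(2)[of 0] by blast

lemma smooth_on_derivative: "smooth_on S f \<Longrightarrow> smooth_on S (\<lambda>x. frechet_derivative f (at x) v)"
  unfolding smooth_on_def using Ck_on.simps(2) by blast

lemma smooth_on_const: "smooth_on S (\<lambda>x. c)"
  by (simp add: smooth_on_def Ck_on_const)

lemma smooth_on_bounded_linear: "bounded_linear L \<Longrightarrow> open S \<Longrightarrow> smooth_on S L"
  by (simp add: smooth_on_def Ck_on_bounded_linear)

lemma smooth_on_bounded_linear_compose:
  "bounded_linear L \<Longrightarrow> open S \<Longrightarrow> smooth_on S f \<Longrightarrow> smooth_on S (\<lambda>x. L (f x))"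
  by (simp add: smooth_on_def Ck_on_bounded_linear_compose)

lemma smooth_on_add: "open S \<Longrightarrow> smooth_on S f \<Longrightarrow> smooth_on S g \<Longrightarrow> smooth_on S (\<lambda>x. f x + g x)"
  by (simp add: smooth_on_def Ck_on_add)

lemma smooth_on_sum:
  "open S \<Longrightarrow> finite B \<Longrightarrow> (\<And>b. b \<in> B \<Longrightarrow> smooth_on S (f b)) \<Longrightarrow> smooth_on S (\<lambda>x. \<Sum>b\<in>B. f b x)"
  by (simp add: smooth_on_def Ck_on_sum)

lemma smooth_on_bounded_bilinear:
  "bounded_bilinear P \<Longrightarrow> open S \<Longrightarrow> smooth_on S f \<Longrightarrow> smooth_on S g \<Longrightarrow> smooth_on S (\<lambda>x. P (f x) (g x))"
  by (simp add: smooth_on_def Ck_on_bounded_bilinear)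

lemmas smooth_on_scaleR = smooth_on_bounded_bilinear[OF bounded_bilinear_scaleR]
lemmas smooth_on_mult = smooth_on_bounded_bilinear[OF bounded_bilinear_mult]
lemmas smooth_on_inner = smooth_on_bounded_bilinear[OF bounded_bilinear_inner]

lemma smooth_on_Pair:
  "open S \<Longrightarrow> smooth_on S f \<Longrightarrow> smooth_on S g \<Longrightarrow> smooth_on S (\<lambda>x. (f x, g x))"
  by (simp add: smooth_on_def Ck_on_Pair)

lemma smooth_on_compose:
  fixes g :: "'b::real_inner \<Rightarrow> 'c::real_normed_vector"
  assumes "finite_dimensional TYPE('b)" "open S" "smooth_on S f" "smooth_on T g" "f ` S \<subseteq> T"
  shows "smooth_on S (\<lambda>x. g (f x))"
  using assms unfolding smooth_on_def by (blast intro: Ck_on_compose)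

text \<open>The local form of a tangent map. Joint smoothness in point and direction comes from the
  basis expansion: the direction enters through its coordinates, the point through derivatives in
  fixed directions.\<close>

lemma smooth_on_tangent:
  fixes f :: "'a::real_inner \<Rightarrow> 'b::real_normed_vector"
  assumes fd: "finite_dimensional TYPE('a)" and S: "open S" and f: "smooth_on S f"
  shows "smooth_on (S \<times> UNIV) (\<lambda>(x, w). (f x, frechet_derivative f (at x) w))"
proof -
  obtain B :: "'a set" where B: "finite B" "\<And>x. (\<Sum>b\<in>B. (x \<bullet> b) *\<^sub>R b) = x"
    by (rule finite_dimensional_orthonormal[OF fd]) blast
  have o: "open (S \<times> (UNIV::'a set))" using S by (simp add: open_Times)
  have bl: "bounded_linear (\<lambda>z::'a\<times>'a. snd z)" "bounded_linear (\<lambda>z::'a\<times>'a. fst z)"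
    by (simp_all add: bounded_linear_fst bounded_linear_snd)
  have fstc: "smooth_on (S \<times> (UNIV::'a set)) (\<lambda>z. g (fst z))" if "smooth_on S g" for g :: "'a \<Rightarrow> 'b"
    by (rule smooth_on_compose[OF fd o smooth_on_bounded_linear[OF bl(2) o] that]) auto
  have "smooth_on (S \<times> UNIV) (\<lambda>z. (f (fst z), \<Sum>b\<in>B. (snd z \<bullet> b) *\<^sub>R frechet_derivative f (at (fst z)) b))"
    by (intro smooth_on_Pair[OF o] fstc f smooth_on_sum[OF o B(1)] smooth_on_scaleR[OF o] smooth_on_inner[OF o]
        smooth_on_const smooth_on_bounded_linear[OF bl(1) o]
        fstc[OF smooth_on_derivative])
  then show ?thesis
    by (subst smooth_on_cong[OF o, where g = "\<lambda>z. (f (fst z), \<Sum>b\<in>B. (snd z \<bullet> b) *\<^sub>R frechet_derivative f (at (fst z)) b)"])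
      (use frechet_derivative_expand[OF smooth_on_differentiable[OF f] B] in auto)
qed

text \<open>Allowing a polynomial factor in \<open>1/t\<close> makes this family closed under differentiation, so that
  smoothness follows by induction from continuity at 0.\<close>

definition exp_bump :: "real poly \<Rightarrow> real \<Rightarrow> real" where
  "exp_bump p t = (if t \<le> 0 then 0 else poly p (inverse t) * exp (- inverse t))"


text \<open>On the right, \<open>s = 1/t\<close> turns the claim into decay of a polynomial times
  \<open>exp (- s)\<close> at infinity, which holds monomial by monomial; on the left the function
  is 0.\<close>

lemma exp_bump_tendsto_0: "(exp_bump p \<longlongrightarrow> 0) (at 0)"
proof -
  have "((\<lambda>s. \<Sum>i\<le>degree p. coeff p i * (s ^ i / exp s)) \<longlongrightarrow> (\<Sum>i\<le>degree p. coeff p i * 0)) at_top"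
    by (intro tendsto_sum tendsto_mult tendsto_const tendsto_power_div_exp_0)
  moreover have "(\<Sum>i\<le>degree p. coeff p i * (s ^ i / exp s)) = poly p s * exp (- s)" for s
    by (simp add: poly_altdef exp_minus sum_distrib_left divide_inverse mult_ac)
  ultimately have "((\<lambda>s. poly p s * exp (- s)) \<longlongrightarrow> 0) at_top"
    by simp
  then have "((\<lambda>t. poly p (inverse t) * exp (- inverse t)) \<longlongrightarrow> 0) (at_right 0)"
    using filterlim_inverse_at_top_right by (rule filterlim_compose)
  moreover have "\<forall>\<^sub>F t in at_right 0. poly p (inverse t) * exp (- inverse t) = exp_bump p t"
    unfolding eventually_at_filter by (auto simp: exp_bump_def)
  ultimately have 1: "(exp_bump p \<longlongrightarrow> 0) (at_right 0)"
    using tendsto_cong by fastforce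
  have "\<forall>\<^sub>F t in at_left 0. exp_bump p t = 0"
    unfolding eventually_at_filter by (auto simp: exp_bump_def)
  then have 2: "(exp_bump p \<longlongrightarrow> 0) (at_left 0)"
    by (rule tendsto_eventually)
  from 1 2 show ?thesis by (simp add: filterlim_at_split)
qed

text \<open>For \<open>t > 0\<close>, differentiating \<open>p(1/t) exp (- 1/t)\<close> replaces the
  polynomial factor by \<open>1/t^2\<close> times \<open>(p - p')(1/t)\<close>, which is the new
  polynomial evaluated at \<open>1/t\<close>.\<close>

lemma exp_bump_has_derivative:
  "(exp_bump p has_field_derivative exp_bump (monom 1 2 * (p - pderiv p)) t) (at t)"
proof -
  consider "t < 0" | "t = 0" | "t > 0" by linarith
  then show ?thesis
  proof cases
    case 1
    have "((\<lambda>_. 0) has_field_derivative 0) (at t)" by simp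
    then have "(exp_bump p has_field_derivative 0) (at t)"
      by (rule has_field_derivative_transform_within_open[where S="{..<0}"])
        (use 1 in \<open>auto simp: exp_bump_def\<close>)
    then show ?thesis using 1 by (simp add: exp_bump_def)
  next
    case 2
    \<comment> \<open>Dividing by \<open>h\<close> multiplies the polynomial by its variable: the
      difference quotient at 0 is \<open>exp_bump (pCons 0 p)\<close>, so its limit is an instance
      of \<open>exp_bump_tendsto_0\<close>.\<close>
    have "(\<lambda>h. exp_bump p h / h) \<midarrow>0\<rightarrow> 0"
    proof (rule Lim_transform_eventually[OF exp_bump_tendsto_0])
      show "\<forall>\<^sub>F h in at 0. exp_bump (pCons 0 p) h = exp_bump p h / h"
        unfolding eventually_at_filter by (auto simp: exp_bump_def divide_inverse)
    qed
    then show ?thesis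
      using 2 by (simp add: DERIV_def exp_bump_def)
  next
    case 3
    let ?D = "poly (pderiv p) (inverse t) * (- (inverse t * inverse t)) * exp (- inverse t)
      + poly p (inverse t) * (exp (- inverse t) * (inverse t * inverse t))"
    have "((\<lambda>t. poly p (inverse t) * exp (- inverse t)) has_field_derivative ?D) (at t)"
      using 3 by (auto intro!: derivative_eq_intros simp: power2_eq_square)
    then have "(exp_bump p has_field_derivative ?D) (at t)"
      by (rule has_field_derivative_transform_within_open[where S="{0<..}"])
        (use 3 in \<open>auto simp: exp_bump_def\<close>)
    moreover have "?D = exp_bump (monom 1 2 * (p - pderiv p)) t"
      using 3 by (simp add: exp_bump_def poly_monom power2_eq_square algebra_simps)
    ultimately show ?thesis by simp
  qed
qed

lemma smooth_on_exp_bump: "smooth_on UNIV (exp_bump p)"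
proof -
  have "Ck_on k UNIV (exp_bump p)" for k
  proof (induction k arbitrary: p)
    case 0
    then show ?case
      using DERIV_isCont[OF exp_bump_has_derivative] by (simp add: continuous_at_imp_continuous_on)
  next
    case (Suc k)
    show ?case
    proof (rule Ck_on_SucI)
      show "(exp_bump p has_derivative (*) (exp_bump (monom 1 2 * (p - pderiv p)) x)) (at x)" for x
        using exp_bump_has_derivative[of p x] by (simp add: has_field_derivative_def)
      show "Ck_on k UNIV (\<lambda>x. exp_bump (monom 1 2 * (p - pderiv p)) x * v)" for v
        by (intro Ck_on_bounded_linear_compose[OF bounded_linear_mult_left _ Suc.IH]) simp
    qed simp
  qed
  then show ?thesis by (simp add: smooth_on_def)
qed

lemma smooth_bump_ball:
  fixes a :: "'a::real_inner"
  assumes "r > 0"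
  obtains h :: "'a \<Rightarrow> real" where "smooth_on UNIV h" "h a = 1" "\<And>z. z \<notin> cball a r \<Longrightarrow> h z = 0"
proof -
  \<comment> \<open>The squared distance keeps the argument of \<open>exp_bump\<close> smooth at the
    centre; that argument is positive exactly inside the open ball, and the first factor normalises
    the value at \<open>a\<close> to 1.\<close>
  define h where "h z = inverse (exp_bump 1 (r\<^sup>2)) *\<^sub>R exp_bump 1 (r\<^sup>2 + - ((z + - a) \<bullet> (z + - a)))" for z
  have sub: "smooth_on UNIV (\<lambda>z. z + - a)"
    by (intro smooth_on_add smooth_on_const smooth_on_bounded_linear bounded_linear_ident open_UNIV)
  have "smooth_on UNIV (\<lambda>z. r\<^sup>2 + - ((z + - a) \<bullet> (z + - a)))"
    by (intro smooth_on_add[OF open_UNIV] smooth_on_const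
        smooth_on_bounded_linear_compose[OF bounded_linear_minus[OF bounded_linear_ident]]
        smooth_on_inner sub open_UNIV)
  then have "smooth_on UNIV (\<lambda>z. exp_bump 1 (r\<^sup>2 + - ((z + - a) \<bullet> (z + - a))))"
    by (rule smooth_on_compose[OF finite_dimensional_real open_UNIV _ smooth_on_exp_bump]) simp
  then have "smooth_on UNIV h"
    unfolding h_def by (intro smooth_on_scaleR[OF open_UNIV smooth_on_const])
  moreover have "h a = 1"
    using assms by (simp add: h_def exp_bump_def)
  moreover have "h z = 0" if "z \<notin> cball a r" for z
  proof -
    have "r\<^sup>2 \<le> (norm (z - a))\<^sup>2"
      using that assms by (intro power_mono) (auto simp: dist_norm norm_minus_commute)
    then show ?thesis by (simp add: h_def exp_bump_def dot_square_norm)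
  qed
  ultimately show thesis by (rule that)
qed

section \<open>Smoothness at a point of a manifold\<close>

text \<open>The part of \<open>smooth_manifold\<close> that passes chart by chart to restrictions,
  products and tangent bundles. Separating it means that Hausdorffness and second countability do
  not have to be proved again for those.\<close>

definition smooth_atlas :: "('a, 'e::real_inner) atlas \<Rightarrow> bool" where
  "smooth_atlas A \<longleftrightarrow>
     finite_dimensional TYPE('e) \<and>
     (\<forall>c\<in>A. inj_on (snd c) (fst c) \<and> open (snd c ` fst c)) \<and>
     (\<forall>c\<in>A. \<forall>d\<in>A. open (snd c ` (fst c \<inter> fst d)) \<and>
        smooth_on (snd c ` (fst c \<inter> fst d)) (snd d \<circ> chart_inv c))"

lemma smooth_manifold_imp_smooth_atlas: "smooth_manifold A \<Longrightarrow> smooth_atlas A"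
  by (simp add: smooth_manifold_def smooth_atlas_def)

lemma smooth_atlasD:
  assumes "smooth_atlas (A :: ('a, 'e::real_inner) atlas)"
  shows "finite_dimensional TYPE('e)"
    "c \<in> A \<Longrightarrow> inj_on (snd c) (fst c)"
    "c \<in> A \<Longrightarrow> open (snd c ` fst c)"
    "c \<in> A \<Longrightarrow> d \<in> A \<Longrightarrow> open (snd c ` (fst c \<inter> fst d))"
    "c \<in> A \<Longrightarrow> d \<in> A \<Longrightarrow> smooth_on (snd c ` (fst c \<inter> fst d)) (snd d \<circ> chart_inv c)"
  using assms by (auto simp: smooth_atlas_def)

lemma chart_inv_apply: "inj_on (snd c) (fst c) \<Longrightarrow> p \<in> fst c \<Longrightarrow> chart_inv c (snd c p) = p"
  by (simp add: chart_inv_def)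

lemma smooth_atlas_chart_inv [simp]:
  "smooth_atlas A \<Longrightarrow> c \<in> A \<Longrightarrow> p \<in> fst c \<Longrightarrow> chart_inv c (snd c p) = p"
  by (simp add: chart_inv_apply smooth_atlasD)

lemma chart_image_Int:
  "smooth_atlas A \<Longrightarrow> c \<in> A \<Longrightarrow> V \<subseteq> fst c \<Longrightarrow> W \<subseteq> fst c \<Longrightarrow> snd c ` (V \<inter> W) = snd c ` V \<inter> snd c ` W"
  using inj_on_image_Int smooth_atlasD(2) by metis

text \<open>Read in charts, the preimage of \<open>V\<close> becomes the preimage of an open
  coordinate set under the continuous representative. Injectivity of \<open>snd d\<close> lets
  equality of coordinates be read back as equality of points.\<close>

lemma open_chart_preimage:
  assumes A: "smooth_atlas A" "c \<in> A" and B: "smooth_atlas B" "d \<in> B"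
    and W: "W \<subseteq> fst c" "open (snd c ` W)" "f ` W \<subseteq> fst d"
    and cont: "continuous_on (snd c ` W) (snd d \<circ> f \<circ> chart_inv c)"
    and V: "V \<subseteq> fst d" "open (snd d ` V)"
  shows "open (snd c ` (W \<inter> f -` V))"
proof -
  have "snd c ` (W \<inter> f -` V) = snd c ` W \<inter> (snd d \<circ> f \<circ> chart_inv c) -` (snd d ` V)"
  proof (intro subset_antisym subsetI)
    fix z assume z: "z \<in> snd c ` W \<inter> (snd d \<circ> f \<circ> chart_inv c) -` (snd d ` V)"
    then obtain q v where q: "q \<in> W" "z = snd c q" "v \<in> V" "snd d (f (chart_inv c z)) = snd d v"
      by auto
    have "chart_inv c z = q" using A W(1) q by auto
    with q have "snd d (f q) = snd d v" by simp
    then have "f q = v"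
      using inj_onD[OF smooth_atlasD(2)[OF B]] q W V by blast
    then show "z \<in> snd c ` (W \<inter> f -` V)" using q by auto
  next
    fix z assume "z \<in> snd c ` (W \<inter> f -` V)"
    then obtain q where q: "q \<in> W" "f q \<in> V" "z = snd c q" by auto
    moreover have "chart_inv c z = q" using A W(1) q by auto
    ultimately show "z \<in> snd c ` W \<inter> (snd d \<circ> f \<circ> chart_inv c) -` (snd d ` V)" by auto
  qed
  then show ?thesis
    using continuous_open_preimage[OF cont W(2) V(2)] by simp
qed

text \<open>This is \<open>open_chart_preimage\<close> for the identity map read from
  \<open>d\<close> to \<open>c\<close>, whose representative is the change of charts.\<close>

lemma open_chart_change:
  assumes A: "smooth_atlas A" "c \<in> A" "d \<in> A" and W: "W \<subseteq> fst c" "W \<subseteq> fst d" "open (snd c ` W)"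
  shows "open (snd d ` W)"
proof -
  have "open (snd d ` ((fst d \<inter> fst c) \<inter> (\<lambda>x. x) -` W))"
  proof (rule open_chart_preimage[OF A(1,3) A(1,2)])
    show "open (snd d ` (fst d \<inter> fst c))" using A smooth_atlasD(4) by blast
    show "continuous_on (snd d ` (fst d \<inter> fst c)) (snd c \<circ> (\<lambda>x. x) \<circ> chart_inv d)"
      using smooth_on_continuous[OF smooth_atlasD(5)[OF A(1,3,2)]] by (simp add: o_def)
  qed (use W in auto)
  moreover have "(fst d \<inter> fst c) \<inter> (\<lambda>x. x) -` W = W" using W by auto
  ultimately show ?thesis by simp
qed

lemma openin_smooth_atlas:
  assumes "smooth_atlas A"
  shows "openin (manifold_top A) W \<longleftrightarrow> W \<subseteq> points A \<and> (\<forall>c\<in>A. open (snd c ` (W \<inter> fst c)))"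
    "topspace (manifold_top A) = points A"
  using openin_manifold_top[of A] smooth_atlasD[OF assms] by auto

lemma openin_chart:
  assumes A: "smooth_atlas A" "c \<in> A" and W: "W \<subseteq> fst c" "open (snd c ` W)"
  shows "openin (manifold_top A) W"
  unfolding openin_smooth_atlas(1)[OF A(1)]
proof (intro conjI ballI)
  show "W \<subseteq> points A" using A W by (auto simp: points_def)
  fix d assume d: "d \<in> A"
  have "W \<inter> fst d = W \<inter> (fst c \<inter> fst d)" using W by auto
  then have "snd c ` (W \<inter> fst d) = snd c ` W \<inter> snd c ` (fst c \<inter> fst d)"
    using chart_image_Int[OF A] W by auto
  then have "open (snd c ` (W \<inter> fst d))"
    using W smooth_atlasD(4)[OF A d] by auto
  then show "open (snd d ` (W \<inter> fst d))"
    using open_chart_change[OF A d] W by blast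
qed

lemma openin_chart_domain: "smooth_atlas A \<Longrightarrow> c \<in> A \<Longrightarrow> openin (manifold_top A) (fst c)"
  by (simp add: openin_chart smooth_atlasD)

lemma open_chart_Int:
  assumes A: "smooth_atlas A" "c \<in> A" and W: "W \<subseteq> fst c" "open (snd c ` W)"
    and V: "openin (manifold_top A) V"
  shows "open (snd c ` (W \<inter> V))"
proof -
  have "W \<inter> V = W \<inter> (V \<inter> fst c)" using W by auto
  then have "snd c ` (W \<inter> V) = snd c ` W \<inter> snd c ` (V \<inter> fst c)"
    using chart_image_Int[OF A] W by auto
  then show ?thesis
    using W V A by (auto simp: openin_smooth_atlas)
qed

text \<open>Asking for only one pair of charts makes smoothness easy to establish; \<open>smooth_at_chartsE\<close>
  below shows that any other pair of charts would do.\<close>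

definition smooth_at ::
  "('a, 'e::real_inner) atlas \<Rightarrow> ('b, 'f::real_inner) atlas \<Rightarrow> ('a \<Rightarrow> 'b) \<Rightarrow> 'a \<Rightarrow> bool" where
  "smooth_at A B f p \<longleftrightarrow> (\<exists>c\<in>A. \<exists>d\<in>B. \<exists>W. p \<in> W \<and> W \<subseteq> fst c \<and> open (snd c ` W) \<and> f ` W \<subseteq> fst d \<and>
     smooth_on (snd c ` W) (snd d \<circ> f \<circ> chart_inv c))"

lemma smooth_atI:
  assumes "c \<in> A" "d \<in> B" "p \<in> W" "W \<subseteq> fst c" "open (snd c ` W)" "f ` W \<subseteq> fst d"
    "smooth_on (snd c ` W) (snd d \<circ> f \<circ> chart_inv c)"
  shows "smooth_at A B f p"
  unfolding smooth_at_def using assms by blast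

lemma smooth_at_in_points: "smooth_at A B f p \<Longrightarrow> p \<in> points A" "smooth_at A B f p \<Longrightarrow> f p \<in> points B"
  by (auto simp: smooth_at_def points_def)

lemma smooth_on_chart_compose:
  assumes A: "smooth_atlas A" "c \<in> A" and B: "smooth_atlas B" "d \<in> B"
    and W: "W \<subseteq> fst c" "open (snd c ` W)" "f ` W \<subseteq> V" "V \<subseteq> fst d"
    and f: "smooth_on (snd c ` W) (snd d \<circ> f \<circ> chart_inv c)"
    and g: "smooth_on (snd d ` V) (h \<circ> chart_inv d)"
  shows "smooth_on (snd c ` W) (\<lambda>z. h (f (chart_inv c z)))"
proof -
  have inv: "chart_inv d (snd d (f q)) = f q" if "q \<in> W" for q
    using smooth_atlas_chart_inv[OF B, of "f q"] that W by blast
  have im: "(snd d \<circ> f \<circ> chart_inv c) ` (snd c ` W) \<subseteq> snd d ` V"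
    using W smooth_atlas_chart_inv[OF A] by (auto simp: subset_iff)
  have "smooth_on (snd c ` W) (\<lambda>z. (h \<circ> chart_inv d) ((snd d \<circ> f \<circ> chart_inv c) z))"
    by (rule smooth_on_compose[OF smooth_atlasD(1)[OF B(1)] W(2) f g im])
  then show ?thesis
    by (subst smooth_on_cong[OF W(2), where g = "\<lambda>z. (h \<circ> chart_inv d) ((snd d \<circ> f \<circ> chart_inv c) z)"])
      (use W A inv in auto)
qed

text \<open>Both charts can be prescribed because the representative may be composed with changes of
  charts on either side. The open set \<open>N\<close> allows later proofs to nest the
  neighbourhoods of two maps in one chart.\<close>

lemma smooth_at_chartsE:
  assumes A: "smooth_atlas A" and B: "smooth_atlas B" and f: "smooth_at A B f p"
    and c: "c \<in> A" "p \<in> fst c" and d: "d \<in> B" "f p \<in> fst d"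
    and N: "openin (manifold_top A) N" "p \<in> N"
  obtains W where "p \<in> W" "W \<subseteq> fst c" "W \<subseteq> N" "open (snd c ` W)" "f ` W \<subseteq> fst d"
    "smooth_on (snd c ` W) (snd d \<circ> f \<circ> chart_inv c)"
proof -
  obtain c0 d0 W0 where 0: "c0 \<in> A" "d0 \<in> B" "p \<in> W0" "W0 \<subseteq> fst c0" "open (snd c0 ` W0)"
      "f ` W0 \<subseteq> fst d0" "smooth_on (snd c0 ` W0) (snd d0 \<circ> f \<circ> chart_inv c0)"
    using f unfolding smooth_at_def by blast
  \<comment> \<open>\<open>W1\<close> keeps the points mapped into both the old and the new target
    chart; \<open>W\<close> is then cut down to the new source chart and to
    \<open>N\<close>.\<close>
  define W1 where "W1 = W0 \<inter> f -` (fst d0 \<inter> fst d)"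
  have o1: "open (snd c0 ` W1)"
    unfolding W1_def
    by (rule open_chart_preimage[OF A 0(1) B 0(2) 0(4,5,6) smooth_on_continuous[OF 0(7)]])
      (use smooth_atlasD(4)[OF B 0(2) d(1)] in auto)
  define W where "W = W1 \<inter> (fst c \<inter> N)"
  have "openin (manifold_top A) (fst c \<inter> N)"
    using N openin_chart_domain[OF A c(1)] by auto
  then have o2: "open (snd c0 ` W)"
    unfolding W_def using o1 0 by (intro open_chart_Int[OF A 0(1)]) (auto simp: W1_def)
  have sub: "W \<subseteq> fst c0" "W \<subseteq> fst c" "W \<subseteq> N" "p \<in> W" "W \<subseteq> W0" "f ` W \<subseteq> fst d0 \<inter> fst d"
    using 0 c d N by (auto simp: W_def W1_def)
  have o: "open (snd c ` W)"
    by (rule open_chart_change[OF A 0(1) c(1) sub(1,2) o2])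
  have s1: "smooth_on (snd c ` W) (snd c0 \<circ> (\<lambda>x. x) \<circ> chart_inv c)"
    using smooth_on_subset[OF smooth_atlasD(5)[OF A c(1) 0(1)]] sub by (simp add: o_def image_mono)
  have s2: "smooth_on (snd c0 ` W) ((\<lambda>q. snd d0 (f q)) \<circ> chart_inv c0)"
    using smooth_on_subset[OF 0(7)] sub by (simp add: o_def image_mono)
  have s3: "smooth_on (snd c ` W) (snd d0 \<circ> f \<circ> chart_inv c)"
    using smooth_on_chart_compose[OF A c(1) A 0(1) sub(2) o _ sub(1) s1 s2] by (auto simp: o_def)
  have "smooth_on (snd c ` W) (\<lambda>z. snd d (f (chart_inv c z)))"
    by (rule smooth_on_chart_compose[OF A c(1) B 0(2) sub(2) o sub(6) _ s3 smooth_atlasD(5)[OF B 0(2) d(1)]])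
      auto
  then show thesis
    using that sub o by (auto simp: o_def)
qed

lemma smooth_map_iff_smooth_at:
  assumes A: "smooth_atlas A" and B: "smooth_atlas B"
  shows "smooth_map A B f \<longleftrightarrow> (\<forall>p\<in>points A. smooth_at A B f p)"
proof
  assume f: "smooth_map A B f"
  then have cm: "continuous_map (manifold_top A) (manifold_top B) f"
    by (simp add: smooth_map_def)
  show "\<forall>p\<in>points A. smooth_at A B f p"
  proof
    fix p assume p: "p \<in> points A"
    then obtain c where c: "c \<in> A" "p \<in> fst c" by (auto simp: points_def)
    have "f p \<in> points B"
      using continuous_map_image_subset_topspace[OF cm] p by (auto simp: openin_smooth_atlas(2) A B)
    then obtain d where d: "d \<in> B" "f p \<in> fst d" by (auto simp: points_def)
    have "openin (manifold_top A) {q \<in> topspace (manifold_top A). f q \<in> fst d}"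
      using openin_continuous_map_preimage[OF cm openin_chart_domain[OF B d(1)]] .
    then have "open (snd c ` (fst c \<inter> {q \<in> points A. f q \<in> fst d}))"
      using open_chart_Int[OF A c(1) subset_refl smooth_atlasD(3)[OF A c(1)]]
      by (simp add: openin_smooth_atlas(2)[OF A])
    moreover have "fst c \<inter> {q \<in> points A. f q \<in> fst d} = fst c \<inter> f -` fst d"
      using c by (auto simp: points_def)
    ultimately show "smooth_at A B f p"
      using f c d by (intro smooth_atI[OF c(1) d(1), where W="fst c \<inter> f -` fst d"])
        (auto simp: smooth_map_def)
  qed
next
  assume f: "\<forall>p\<in>points A. smooth_at A B f p"
  \<comment> \<open>One local statement serves both halves of \<open>smooth_map\<close>: a general
    open \<open>V\<close> gives continuity, and \<open>V = fst d\<close> gives smoothness of the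
    representatives.\<close>
  have loc: "\<exists>T. open T \<and> snd c p \<in> T \<and> T \<subseteq> snd c ` (fst c \<inter> f -` V)
       \<and> smooth_on T (snd d \<circ> f \<circ> chart_inv c)"
    if c: "c \<in> A" "p \<in> fst c" and d: "d \<in> B" "f p \<in> fst d" and V: "openin (manifold_top B) V" "f p \<in> V" for c d p V
  proof -
    have p: "smooth_at A B f p" using f c by (auto simp: points_def)
    obtain W where W: "p \<in> W" "W \<subseteq> fst c" "open (snd c ` W)" "f ` W \<subseteq> fst d"
      "smooth_on (snd c ` W) (snd d \<circ> f \<circ> chart_inv c)"
      using smooth_at_chartsE[OF A B p c d openin_chart_domain[OF A c(1)] c(2)] by metis
    have "open (snd c ` (W \<inter> f -` (fst d \<inter> V)))"
      by (rule open_chart_preimage[OF A c(1) B d(1) W(2,3,4) smooth_on_continuous[OF W(5)]])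
        (use open_chart_Int[OF B d(1) subset_refl smooth_atlasD(3)[OF B d(1)] V(1)] in auto)
    moreover have "smooth_on (snd c ` (W \<inter> f -` (fst d \<inter> V))) (snd d \<circ> f \<circ> chart_inv c)"
      by (rule smooth_on_subset[OF W(5)]) auto
    ultimately show ?thesis
      using W d V by (intro exI[of _ "snd c ` (W \<inter> f -` (fst d \<inter> V))"]) auto
  qed
  show "smooth_map A B f"
    unfolding smooth_map_def
  proof (intro conjI ballI)
    show "continuous_map (manifold_top A) (manifold_top B) f"
      unfolding continuous_map_def openin_smooth_atlas(2)[OF A] openin_smooth_atlas(2)[OF B]
    proof (intro conjI allI impI)
      show "f \<in> points A \<rightarrow> points B" using f smooth_at_in_points(2)[of A B f] by auto
      fix V assume V: "openin (manifold_top B) V"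
      show "openin (manifold_top A) {x \<in> points A. f x \<in> V}"
        unfolding openin_smooth_atlas(1)[OF A]
      proof (intro conjI ballI)
        fix c assume c: "c \<in> A"
        show "open (snd c ` ({x \<in> points A. f x \<in> V} \<inter> fst c))"
        proof (rule openI)
          fix z assume "z \<in> snd c ` ({x \<in> points A. f x \<in> V} \<inter> fst c)"
          then obtain p where p: "p \<in> fst c" "f p \<in> V" "z = snd c p" by auto
          have "f p \<in> points B" using p openin_subset[OF V] by (auto simp: openin_smooth_atlas(2)[OF B])
          then obtain d where d: "d \<in> B" "f p \<in> fst d" by (auto simp: points_def)
          from loc[OF c p(1) d V p(2)] obtain T where T: "open T" "z \<in> T" "T \<subseteq> snd c ` (fst c \<inter> f -` V)"
            using p by auto
          have "snd c ` (fst c \<inter> f -` V) \<subseteq> snd c ` ({x \<in> points A. f x \<in> V} \<inter> fst c)"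
            using c by (auto simp: points_def)
          with T obtain e where "e > 0" "ball z e \<subseteq> snd c ` ({x \<in> points A. f x \<in> V} \<inter> fst c)"
            by (meson open_contains_ball subset_trans)
          then show "\<exists>e>0. ball z e \<subseteq> snd c ` ({x \<in> points A. f x \<in> V} \<inter> fst c)" by blast
        qed
      qed auto
    qed
    fix c d assume c: "c \<in> A" and d: "d \<in> B"
    show "smooth_on (snd c ` (fst c \<inter> f -` fst d)) (snd d \<circ> f \<circ> chart_inv c)"
    proof (rule smooth_on_local)
      fix z assume "z \<in> snd c ` (fst c \<inter> f -` fst d)"
      then obtain p where "p \<in> fst c" "f p \<in> fst d" "z = snd c p" by auto
      with loc[OF c _ d _ openin_chart_domain[OF B d]]
      show "\<exists>T. open T \<and> z \<in> T \<and> smooth_on T (snd d \<circ> f \<circ> chart_inv c)" by blast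
    qed
  qed
qed

lemma smooth_at_open_preimage:
  assumes A: "smooth_atlas A" and B: "smooth_atlas B" and f: "smooth_at A B f p"
    and V: "openin (manifold_top B) V" "f p \<in> V"
  obtains N where "openin (manifold_top A) N" "p \<in> N" "f ` N \<subseteq> V"
proof -
  obtain c d W where 0: "c \<in> A" "d \<in> B" "p \<in> W" "W \<subseteq> fst c" "open (snd c ` W)"
      "f ` W \<subseteq> fst d" "smooth_on (snd c ` W) (snd d \<circ> f \<circ> chart_inv c)"
    using f unfolding smooth_at_def by blast
  have "open (snd c ` (W \<inter> f -` (fst d \<inter> V)))"
    by (rule open_chart_preimage[OF A 0(1) B 0(2) 0(4,5,6) smooth_on_continuous[OF 0(7)]])
      (use open_chart_Int[OF B 0(2) subset_refl smooth_atlasD(3)[OF B 0(2)] V(1)] in auto)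
  then have "openin (manifold_top A) (W \<inter> f -` (fst d \<inter> V))"
    using 0 by (intro openin_chart[OF A 0(1)]) auto
  then show thesis using that[of "W \<inter> f -` (fst d \<inter> V)"] 0 V by auto
qed

lemma smooth_at_compose:
  assumes A: "smooth_atlas A" and B: "smooth_atlas B" and C: "smooth_atlas C"
    and f: "smooth_at A B f p" and g: "smooth_at B C g (f p)"
  shows "smooth_at A C (\<lambda>x. g (f x)) p"
proof -
  obtain d e V where 0: "d \<in> B" "e \<in> C" "f p \<in> V" "V \<subseteq> fst d" "open (snd d ` V)"
      "g ` V \<subseteq> fst e" "smooth_on (snd d ` V) (snd e \<circ> g \<circ> chart_inv d)"
    using g unfolding smooth_at_def by blast
  obtain c where c: "c \<in> A" "p \<in> fst c"
    using f unfolding smooth_at_def by blast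
  obtain N where N: "openin (manifold_top A) N" "p \<in> N" "f ` N \<subseteq> V"
    using smooth_at_open_preimage[OF A B f openin_chart[OF B 0(1,4,5)] 0(3)] by metis
  obtain W where W: "p \<in> W" "W \<subseteq> fst c" "W \<subseteq> N" "open (snd c ` W)" "f ` W \<subseteq> fst d"
      "smooth_on (snd c ` W) (snd d \<circ> f \<circ> chart_inv c)"
    using smooth_at_chartsE[OF A B f c 0(1) subsetD[OF 0(4,3)] N(1,2)] by metis
  have WV: "f ` W \<subseteq> V" using W N by blast
  then have "smooth_on (snd c ` W) (\<lambda>z. (\<lambda>q. snd e (g q)) (f (chart_inv c z)))"
    by (rule smooth_on_chart_compose[OF A c(1) B 0(1) W(2,4) _ 0(4) W(6)])
      (use 0 in \<open>auto simp: o_def\<close>)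
  then show ?thesis
    using WV 0(6) by (intro smooth_atI[OF c(1) 0(2) W(1,2,4)]) (auto simp: o_def)
qed

lemma smooth_at_cong:
  assumes A: "smooth_atlas A" and B: "smooth_atlas B" and f: "smooth_at A B f p"
    and N: "openin (manifold_top A) N" "p \<in> N" "\<And>q. q \<in> N \<Longrightarrow> f q = g q"
  shows "smooth_at A B g p"
proof -
  obtain c d where c: "c \<in> A" "p \<in> fst c" and d: "d \<in> B" "f p \<in> fst d"
    using f unfolding smooth_at_def by blast
  obtain W where W: "p \<in> W" "W \<subseteq> fst c" "W \<subseteq> N" "open (snd c ` W)" "f ` W \<subseteq> fst d"
      "smooth_on (snd c ` W) (snd d \<circ> f \<circ> chart_inv c)"
    using smooth_at_chartsE[OF A B f c d N(1,2)] by metis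
  have "smooth_on (snd c ` W) (snd d \<circ> g \<circ> chart_inv c)"
    by (subst smooth_on_cong[OF W(4), where g="snd d \<circ> f \<circ> chart_inv c"])
      (use W N A c in \<open>auto simp: subset_iff\<close>)
  then show ?thesis
    using W N by (intro smooth_atI[OF c(1) d(1) W(1,2,4)]) (auto simp: subset_iff)
qed

section \<open>Maps into model spaces\<close>

lemma smooth_atlas_model:
  "finite_dimensional TYPE('e::real_inner) \<Longrightarrow> smooth_atlas (model_atlas :: ('e, 'e) atlas)"
  unfolding smooth_atlas_def model_atlas_def
  by (auto simp: chart_inv_def o_def intro: smooth_on_bounded_linear bounded_linear_ident)

lemma smooth_at_modelI:
  assumes "c \<in> A" "p \<in> W" "W \<subseteq> fst c" "open (snd c ` W)" "smooth_on (snd c ` W) (f \<circ> chart_inv c)"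
  shows "smooth_at A model_atlas f p"
  by (rule smooth_atI[where d="(UNIV, id)" and W=W and c=c]) (use assms in \<open>auto simp: model_atlas_def\<close>)

lemma smooth_at_modelE:
  fixes f :: "'a \<Rightarrow> 'k::real_inner"
  assumes A: "smooth_atlas A" and k: "finite_dimensional TYPE('k)" and f: "smooth_at A model_atlas f p"
    and c: "c \<in> A" "p \<in> fst c"
    and N: "openin (manifold_top A) N" "p \<in> N"
  obtains W where "p \<in> W" "W \<subseteq> fst c" "W \<subseteq> N" "open (snd c ` W)"
    "smooth_on (snd c ` W) (f \<circ> chart_inv c)"
proof -
  have d: "(UNIV, id) \<in> model_atlas" "f p \<in> fst (UNIV :: 'k set, id :: 'k \<Rightarrow> 'k)"
    by (simp_all add: model_atlas_def)
  show thesis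
    by (rule smooth_at_chartsE[OF A smooth_atlas_model[OF k] f c d N]) (rule that, auto simp: o_def)
qed

lemma smooth_at_const_model: "smooth_atlas A \<Longrightarrow> p \<in> points A \<Longrightarrow> smooth_at A model_atlas (\<lambda>_. k) p"
proof -
  assume A: "smooth_atlas A" and "p \<in> points A"
  then obtain c where "c \<in> A" "p \<in> fst c" by (auto simp: points_def)
  then show ?thesis
    using smooth_atlasD(3)[OF A]
    by (intro smooth_at_modelI[where W="fst c" and c=c]) (simp_all add: o_def smooth_on_const)
qed

text \<open>The operation \<open>P\<close> is kept abstract so that sums and scalar multiples of
  sections share one proof.\<close>

lemma smooth_at_model_combine:
  fixes A :: "('a, 'e::real_inner) atlas" and f :: "'a \<Rightarrow> 'k::real_inner" and g :: "'a \<Rightarrow> 'l::real_inner"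
  assumes A: "smooth_atlas A" and k: "finite_dimensional TYPE('k)" "finite_dimensional TYPE('l)"
    and f: "smooth_at A model_atlas f p" and g: "smooth_at A model_atlas g p"
    and P: "\<And>(S :: 'e set) u v. open S \<Longrightarrow> smooth_on S u \<Longrightarrow> smooth_on S v \<Longrightarrow> smooth_on S (\<lambda>x. P (u x) (v x))"
  shows "smooth_at A model_atlas (\<lambda>x. P (f x) (g x)) p"
proof -
  obtain c where c: "c \<in> A" "p \<in> fst c"
    using f unfolding smooth_at_def by blast
  obtain W where W: "p \<in> W" "W \<subseteq> fst c" "open (snd c ` W)" "smooth_on (snd c ` W) (f \<circ> chart_inv c)"
    using smooth_at_modelE[OF A k(1) f c openin_chart_domain[OF A c(1)] c(2)] by metis
  obtain V where V: "p \<in> V" "V \<subseteq> fst c" "V \<subseteq> W" "open (snd c ` V)" "smooth_on (snd c ` V) (g \<circ> chart_inv c)"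
    using smooth_at_modelE[OF A k(2) g c openin_chart[OF A c(1) W(2,3)] W(1)] by metis
  have "smooth_on (snd c ` V) (\<lambda>x. P ((f \<circ> chart_inv c) x) ((g \<circ> chart_inv c) x))"
    by (rule P[OF V(4) smooth_on_subset[OF W(4) image_mono[OF V(3)]] V(5)])
  then show ?thesis
    by (intro smooth_at_modelI[OF c(1) V(1,2,4)]) (simp add: o_def)
qed

section \<open>Restricted and product atlases\<close>

lemma points_restrict_atlas: "points (restrict_atlas A W) = points A \<inter> W"
  by (auto simp: points_def restrict_atlas_def)

text \<open>\<open>chart_inv\<close> is built from the domain of the chart, so shrinking the domain
  may yield a different function; the two are compared only where the smaller chart takes its
  values.\<close>

lemma chart_inv_restrict:
  assumes "smooth_atlas A" "c \<in> A" "z \<in> snd c ` (fst c \<inter> W)"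
  shows "chart_inv (fst c \<inter> W, snd c) z = chart_inv c z"
proof -
  have "inj_on (snd c) (fst c \<inter> W)"
    using smooth_atlasD(2)[OF assms(1,2)] by (rule inj_on_subset) auto
  then show ?thesis
    using assms chart_inv_apply[of "(fst c \<inter> W, snd c)"] by auto
qed

lemma smooth_atlas_restrict:
  assumes A: "smooth_atlas A" and W: "openin (manifold_top A) (points A \<inter> W)"
  shows "smooth_atlas (restrict_atlas A W)"
proof -
  have oW: "open (snd c ` (V \<inter> W))" if "c \<in> A" "V \<subseteq> fst c" "open (snd c ` V)" for c V
  proof -
    have "V \<inter> W = V \<inter> (points A \<inter> W)" using that by (auto simp: points_def)
    then show ?thesis using open_chart_Int[OF A that W] by simp
  qed
  show ?thesis
    unfolding smooth_atlas_def restrict_atlas_def ball_simps fst_conv snd_conv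
  proof (intro conjI ballI)
    fix c assume c: "c \<in> A"
    show "inj_on (snd c) (fst c \<inter> W)"
      using smooth_atlasD(2)[OF A c] by (rule inj_on_subset) auto
    show "open (snd c ` (fst c \<inter> W))" using c smooth_atlasD[OF A] by (intro oW) auto
    fix d assume d: "d \<in> A"
    have e: "fst c \<inter> W \<inter> (fst d \<inter> W) = fst c \<inter> fst d \<inter> W" by auto
    show o: "open (snd c ` (fst c \<inter> W \<inter> (fst d \<inter> W)))"
      unfolding e using c d smooth_atlasD[OF A] by (intro oW) auto
    have "smooth_on (snd c ` (fst c \<inter> W \<inter> (fst d \<inter> W))) (snd d \<circ> chart_inv c)"
      by (rule smooth_on_subset[OF smooth_atlasD(5)[OF A c d]]) auto
    then show "smooth_on (snd c ` (fst c \<inter> W \<inter> (fst d \<inter> W))) (snd d \<circ> chart_inv (fst c \<inter> W, snd c))"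
      by (subst smooth_on_cong[OF o, where g="snd d \<circ> chart_inv c"])
        (use chart_inv_restrict[OF A c] in auto)
  qed (rule smooth_atlasD(1)[OF A])
qed

text \<open>Local trivialisations are maps between restricted atlases; composing with these two
  inclusions transfers their smoothness to the whole base and total space.\<close>

lemma smooth_at_restrict:
  assumes A: "smooth_atlas A" and W: "openin (manifold_top A) (points A \<inter> W)" and p: "p \<in> points A" "p \<in> W"
  shows "smooth_at A (restrict_atlas A W) (\<lambda>x. x) p" "smooth_at (restrict_atlas A W) A (\<lambda>x. x) p"
proof -
  obtain c where c: "c \<in> A" "p \<in> fst c" using p by (auto simp: points_def)
  have r: "(fst c \<inter> W, snd c) \<in> restrict_atlas A W" using c by (auto simp: restrict_atlas_def)
  have o: "open (snd c ` (fst c \<inter> W))"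
    using smooth_atlasD(3)[OF smooth_atlas_restrict[OF A W] r] by simp
  have "smooth_on (snd c ` (fst c \<inter> W)) (snd c \<circ> (\<lambda>x. x) \<circ> chart_inv c)"
    by (subst smooth_on_cong[OF o, where g="\<lambda>x. x"])
      (use A c in \<open>auto intro: smooth_on_bounded_linear[OF bounded_linear_ident o]\<close>)
  then show "smooth_at A (restrict_atlas A W) (\<lambda>x. x) p"
    using c p o by (intro smooth_atI[OF c(1) r, where W="fst c \<inter> W"]) auto
  have "smooth_on (snd c ` (fst c \<inter> W)) (snd c \<circ> (\<lambda>x. x) \<circ> chart_inv (fst c \<inter> W, snd c))"
    by (subst smooth_on_cong[OF o, where g="\<lambda>x. x"])
      (use A c chart_inv_restrict[OF A c(1), of _ W] in \<open>auto intro: smooth_on_bounded_linear[OF bounded_linear_ident o]\<close>)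
  then show "smooth_at (restrict_atlas A W) A (\<lambda>x. x) p"
    using c p o by (intro smooth_atI[OF r c(1), where W="fst c \<inter> W"]) auto
qed

lemma points_product_atlas: "points (product_atlas A B) = points A \<times> points B"
  unfolding points_def product_atlas_def by fastforce

lemma points_model_atlas: "points model_atlas = UNIV"
  by (simp add: points_def model_atlas_def)

lemma chart_inv_product:
  assumes "inj_on (snd c) (fst c)" "inj_on (snd d) (fst d)" "x \<in> snd c ` fst c" "y \<in> snd d ` fst d"
  shows "chart_inv (fst c \<times> fst d, map_prod (snd c) (snd d)) (x, y) = (chart_inv c x, chart_inv d y)"
proof -
  obtain p q where "p \<in> fst c" "q \<in> fst d" "x = snd c p" "y = snd d q" using assms by auto
  moreover have "inj_on (map_prod (snd c) (snd d)) (fst c \<times> fst d)"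
    using assms by (intro map_prod_inj_on)
  moreover have "chart_inv c (snd c p) = p" "chart_inv d (snd d q) = q"
    using calculation assms by (simp_all add: chart_inv_apply)
  ultimately show ?thesis
    using chart_inv_apply[of "(fst c \<times> fst d, map_prod (snd c) (snd d))" "(p, q)"]
    by simp
qed

lemma smooth_atlas_product:
  fixes A :: "('a, 'e::real_inner) atlas" and B :: "('b, 'f::real_inner) atlas"
  assumes A: "smooth_atlas A" and B: "smooth_atlas B"
  shows "smooth_atlas (product_atlas A B)"
  unfolding smooth_atlas_def product_atlas_def ball_simps
proof (intro conjI ballI, goal_cases)
  case 1
  show ?case by (rule finite_dimensional_prod[OF smooth_atlasD(1)[OF A] smooth_atlasD(1)[OF B]])
next
  case (2 z)
  then obtain c d where "z = (c, d)" "c \<in> A" "d \<in> B" by auto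
  then show ?case
    using map_prod_inj_on[OF smooth_atlasD(2)[OF A] smooth_atlasD(2)[OF B]] by simp
next
  case (3 z)
  then obtain c d where "z = (c, d)" "c \<in> A" "d \<in> B" by auto
  then show ?case using smooth_atlasD(3)[OF A] smooth_atlasD(3)[OF B]
    by (simp add: map_prod_surj_on[OF refl refl] open_Times)
next
  case (4 z w)
  then obtain c d c' d' where z: "z = (c, d)" "c \<in> A" "d \<in> B" and w: "w = (c', d')" "c' \<in> A" "d' \<in> B"
    by auto
  have "open (snd c ` (fst c \<inter> fst c'))" "open (snd d ` (fst d \<inter> fst d'))"
    by (rule smooth_atlasD(4)[OF A z(2) w(2)], rule smooth_atlasD(4)[OF B z(3) w(3)])
  then show ?case
    by (simp add: z w Times_Int_Times map_prod_surj_on[OF refl refl] open_Times)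
next
  case (5 z w)
  obtain c d where z: "z = (c, d)" "c \<in> A" "d \<in> B" using 5(1) by auto
  obtain c' d' where w: "w = (c', d')" "c' \<in> A" "d' \<in> B" using 5(2) by auto
  let ?S = "snd c ` (fst c \<inter> fst c')" and ?T = "snd d ` (fst d \<inter> fst d')"
  have o: "open ?S" "open ?T" 
    by (rule smooth_atlasD(4)[OF A z(2) w(2)], rule smooth_atlasD(4)[OF B z(3) w(3)])
  have S: "smooth_on ?S (snd c' \<circ> chart_inv c)" "smooth_on ?T (snd d' \<circ> chart_inv d)"
    by (rule smooth_atlasD(5)[OF A z(2) w(2)], rule smooth_atlasD(5)[OF B z(3) w(3)])
  have oo: "open (?S \<times> ?T)" using o by (rule open_Times)
  have "smooth_on (?S \<times> ?T) (\<lambda>x. ((snd c' \<circ> chart_inv c) (fst x), (snd d' \<circ> chart_inv d) (snd x)))"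
    by (intro smooth_on_Pair[OF oo]
        smooth_on_compose[OF smooth_atlasD(1)[OF A] oo smooth_on_bounded_linear[OF bounded_linear_fst oo] S(1)]
        smooth_on_compose[OF smooth_atlasD(1)[OF B] oo smooth_on_bounded_linear[OF bounded_linear_snd oo] S(2)]) auto
  moreover have "(snd (fst c' \<times> fst d', map_prod (snd c') (snd d')) \<circ> chart_inv (fst c \<times> fst d, map_prod (snd c) (snd d))) x
     = ((snd c' \<circ> chart_inv c) (fst x), (snd d' \<circ> chart_inv d) (snd x))" if "x \<in> ?S \<times> ?T" for x
    using that chart_inv_product[of c d "fst x" "snd x"] smooth_atlasD(2)[OF A z(2)] smooth_atlasD(2)[OF B z(3)]
    by auto
  ultimately have "smooth_on (?S \<times> ?T) (snd (fst c' \<times> fst d', map_prod (snd c') (snd d')) \<circ> chart_inv (fst c \<times> fst d, map_prod (snd c) (snd d)))"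
    using smooth_on_cong[OF oo] by (metis (no_types, lifting))
  then show ?case
    by (simp add: z w Times_Int_Times map_prod_surj_on[OF refl refl])
qed

lemma smooth_at_Pair:
  assumes A: "smooth_atlas A" and B: "smooth_atlas B" and C: "smooth_atlas C"
    and f: "smooth_at A B f p" and g: "smooth_at A C g p"
  shows "smooth_at A (product_atlas B C) (\<lambda>x. (f x, g x)) p"
proof -
  obtain c d where c: "c \<in> A" "p \<in> fst c" and d: "d \<in> B" "f p \<in> fst d"
    using f unfolding smooth_at_def by blast
  obtain e where e: "e \<in> C" "g p \<in> fst e"
    using g unfolding smooth_at_def by blast
  obtain W where W: "p \<in> W" "W \<subseteq> fst c" "open (snd c ` W)" "f ` W \<subseteq> fst d"
      "smooth_on (snd c ` W) (snd d \<circ> f \<circ> chart_inv c)"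
    using smooth_at_chartsE[OF A B f c d openin_chart_domain[OF A c(1)] c(2)] by metis
  obtain V where V: "p \<in> V" "V \<subseteq> fst c" "V \<subseteq> W" "open (snd c ` V)" "g ` V \<subseteq> fst e"
      "smooth_on (snd c ` V) (snd e \<circ> g \<circ> chart_inv c)"
    using smooth_at_chartsE[OF A C g c e openin_chart[OF A c(1) W(2,3)] W(1)] by metis
  have "smooth_on (snd c ` V) (\<lambda>x. ((snd d \<circ> f \<circ> chart_inv c) x, (snd e \<circ> g \<circ> chart_inv c) x))"
    by (rule smooth_on_Pair[OF V(4) smooth_on_subset[OF W(5) image_mono[OF V(3)]] V(6)])
  moreover have "f ` V \<subseteq> fst d" using V W by blast
  ultimately show ?thesis
    using V(5) d e
    by (intro smooth_atI[OF c(1) _ V(1,2,4), where d="(fst d \<times> fst e, map_prod (snd d) (snd e))"])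
      (auto simp: o_def product_atlas_def)
qed

lemma smooth_at_snd:
  assumes A: "smooth_atlas A" and B: "smooth_atlas B" and p: "p \<in> points A \<times> points B"
  shows "smooth_at (product_atlas A B) B snd p"
proof -
  obtain c d where c: "c \<in> A" "fst p \<in> fst c" and d: "d \<in> B" "snd p \<in> fst d"
    using p by (auto simp: points_def)
  let ?c = "(fst c \<times> fst d, map_prod (snd c) (snd d))"
  have r: "?c \<in> product_atlas A B" using c d by (auto simp: product_atlas_def)
  have o: "open (snd ?c ` fst ?c)" by (rule smooth_atlasD(3)[OF smooth_atlas_product[OF A B] r])
  have "(snd d \<circ> snd \<circ> chart_inv ?c) x = snd x" if "x \<in> snd ?c ` fst ?c" for x
    using that smooth_atlas_chart_inv[OF smooth_atlas_product[OF A B] r] by auto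
  then have "smooth_on (snd ?c ` fst ?c) (snd d \<circ> snd \<circ> chart_inv ?c)"
    using smooth_on_cong[OF o, of "snd d \<circ> snd \<circ> chart_inv ?c" snd]
      smooth_on_bounded_linear[OF bounded_linear_snd o] by blast
  then show ?thesis
    using o c d by (intro smooth_atI[OF r d(1), where W="fst ?c"]) (auto simp: mem_Times_iff)
qed

section \<open>Tangent maps and bump functions\<close>

lemma smooth_at_id:
  assumes A: "smooth_atlas A" and p: "p \<in> points A"
  shows "smooth_at A A id p"
proof -
  obtain c where c: "c \<in> A" "p \<in> fst c" using p by (auto simp: points_def)
  have "(snd c \<circ> id \<circ> chart_inv c) x = x" if "x \<in> snd c ` fst c" for x
    using that A c by auto
  then have "smooth_on (snd c ` fst c) (snd c \<circ> id \<circ> chart_inv c)"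
    using smooth_on_cong[OF smooth_atlasD(3)[OF A c(1)], of "snd c \<circ> id \<circ> chart_inv c" "\<lambda>x. x"]
      smooth_on_bounded_linear[OF bounded_linear_ident smooth_atlasD(3)[OF A c(1)]] by blast
  then show ?thesis
    using c smooth_atlasD(3)[OF A c(1)] by (intro smooth_atI[OF c(1) c(1), where W="fst c"]) auto
qed

text \<open>Changes of charts are local representatives of \<^term>\<open>id\<close>, so one chain rule covers
  both tangent vectors and tangent maps.\<close>

definition local_deriv ::
  "('a, 'e::real_inner) chart \<Rightarrow> ('b, 'f::real_inner) chart \<Rightarrow> ('a \<Rightarrow> 'b) \<Rightarrow> 'a \<Rightarrow> 'e \<Rightarrow> 'f" where
  "local_deriv c d f p = frechet_derivative (snd d \<circ> f \<circ> chart_inv c) (at (snd c p))"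

lemma charts_atD: "c \<in> charts_at A p \<Longrightarrow> c \<in> A" "c \<in> charts_at A p \<Longrightarrow> p \<in> fst c"
  by (auto simp: charts_at_def)

lemma charts_at_nonempty: "p \<in> points A \<Longrightarrow> \<exists>c. c \<in> charts_at A p"
  by (auto simp: charts_at_def points_def)

lemma charts_at_some: "p \<in> points A \<Longrightarrow> (SOME c. c \<in> charts_at A p) \<in> charts_at A p"
  using charts_at_nonempty by (rule someI_ex)

lemma smooth_at_differentiable:
  assumes A: "smooth_atlas A" and B: "smooth_atlas B" and f: "smooth_at A B f p"
    and c: "c \<in> charts_at A p" and d: "d \<in> charts_at B (f p)"
  shows "(snd d \<circ> f \<circ> chart_inv c) differentiable (at (snd c p))"
proof -
  obtain W where W: "p \<in> W" "smooth_on (snd c ` W) (snd d \<circ> f \<circ> chart_inv c)"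
    using smooth_at_chartsE[OF A B f charts_atD[OF c] charts_atD[OF d] openin_chart_domain[OF A charts_atD(1)[OF c]] charts_atD(2)[OF c]]
    by metis
  then show ?thesis using smooth_on_differentiable by blast
qed

lemma local_deriv_cong:
  assumes A: "smooth_atlas A" and B: "smooth_atlas B" and f: "smooth_at A B f p"
    and c: "c \<in> charts_at A p" and d: "d \<in> charts_at B (f p)"
    and N: "openin (manifold_top A) N" "p \<in> N" "\<And>q. q \<in> N \<Longrightarrow> f q = g q"
  shows "local_deriv c d f p = local_deriv c d g p"
proof -
  have o: "open (snd c ` (fst c \<inter> N))"
    using open_chart_Int[OF A charts_atD(1)[OF c] subset_refl smooth_atlasD(3)[OF A charts_atD(1)[OF c]] N(1)] .
  show ?thesis
    unfolding local_deriv_def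
    by (rule frechet_derivative_transform_within_open[OF smooth_at_differentiable[OF A B f c d] o])
      (use charts_atD[OF c] A N in auto)
qed

text \<open>The representative of \<open>g \<circ> f\<close> is compared with the composite of the
  two representatives only near \<open>snd c p\<close>, where \<open>f\<close> stays inside the
  domain of \<open>d\<close>. This is enough for the derivative.\<close>

lemma local_deriv_chain:
  assumes A: "smooth_atlas A" and B: "smooth_atlas B" and C: "smooth_atlas C"
    and f: "smooth_at A B f p" and g: "smooth_at B C g (f p)"
    and c: "c \<in> charts_at A p" and d: "d \<in> charts_at B (f p)" and e: "e \<in> charts_at C (g (f p))"
  shows "local_deriv c e (g \<circ> f) p v = local_deriv d e g (f p) (local_deriv c d f p v)"
proof -
  obtain W where W: "p \<in> W" "W \<subseteq> fst c" "open (snd c ` W)" "f ` W \<subseteq> fst d"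
    "smooth_on (snd c ` W) (snd d \<circ> f \<circ> chart_inv c)"
    using smooth_at_chartsE[OF A B f charts_atD[OF c] charts_atD[OF d] openin_chart_domain[OF A charts_atD(1)[OF c]] charts_atD(2)[OF c]]
    by metis
  let ?F = "snd d \<circ> f \<circ> chart_inv c" and ?G = "snd e \<circ> g \<circ> chart_inv d"
  have p: "?F (snd c p) = snd d (f p)"
    using A charts_atD[OF c] by simp
  have dF: "?F differentiable (at (snd c p))" by (rule smooth_at_differentiable[OF A B f c d])
  have dG: "?G differentiable (at (?F (snd c p)))"
    unfolding p by (rule smooth_at_differentiable[OF B C g d e])
  have gf: "smooth_at A C (g \<circ> f) p"
    using smooth_at_compose[OF A B C f g] by (simp add: o_def)
  have "frechet_derivative (snd e \<circ> (g \<circ> f) \<circ> chart_inv c) (at (snd c p)) = frechet_derivative (?G \<circ> ?F) (at (snd c p))"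
  proof (rule frechet_derivative_transform_within_open[OF smooth_at_differentiable[OF A C gf c] W(3)])
    show "e \<in> charts_at C ((g \<circ> f) p)" using e by simp
    show "snd c p \<in> snd c ` W" using W by auto
    fix x assume "x \<in> snd c ` W"
    then obtain q where q: "q \<in> W" "x = snd c q" by auto
    then have "chart_inv c x = q" "chart_inv d (snd d (f q)) = f q"
      using W smooth_atlas_chart_inv[OF A charts_atD(1)[OF c], of q] smooth_atlas_chart_inv[OF B charts_atD(1)[OF d], of "f q"]
      by blast+
    then show "(snd e \<circ> (g \<circ> f) \<circ> chart_inv c) x = (?G \<circ> ?F) x" by simp
  qed
  also have "\<dots> = frechet_derivative ?G (at (?F (snd c p))) \<circ> frechet_derivative ?F (at (snd c p))"
    by (rule frechet_derivative_compose[OF dF dG])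
  finally show ?thesis
    unfolding local_deriv_def p by simp
qed

lemma local_deriv_linear:
  assumes A: "smooth_atlas A" and B: "smooth_atlas B" and f: "smooth_at A B f p"
    and c: "c \<in> charts_at A p" and d: "d \<in> charts_at B (f p)"
  shows "local_deriv c d f p (v + w) = local_deriv c d f p v + local_deriv c d f p w"
    "local_deriv c d f p (a *\<^sub>R v) = a *\<^sub>R local_deriv c d f p v"
    "local_deriv c d f p 0 = 0"
  unfolding local_deriv_def
  by (rule frechet_derivative_linear[OF smooth_at_differentiable[OF A B f c d]])+

lemma local_deriv_id:
  assumes A: "smooth_atlas A" and c: "c \<in> charts_at A p"
  shows "local_deriv c c id p v = v"
proof -
  note c' = charts_atD[OF c]
  have p: "p \<in> points A" using c' by (auto simp: points_def)
  have "local_deriv c c id p = frechet_derivative (\<lambda>x. x) (at (snd c p))"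
    unfolding local_deriv_def
    by (rule frechet_derivative_transform_within_open[OF smooth_at_differentiable[OF A A smooth_at_id[OF A p] c] smooth_atlasD(3)[OF A c'(1)]])
      (use A c c' in auto)
  then show ?thesis by simp
qed

lemma tangent_space_iff:
  "v \<in> tangent_space A p \<longleftrightarrow>
    (\<forall>c\<in>charts_at A p. \<forall>d\<in>charts_at A p. v d = local_deriv c d id p (v c)) \<and> (\<forall>c. c \<notin> charts_at A p \<longrightarrow> v c = 0)"
  by (simp add: tangent_space_def local_deriv_def)

lemma tangent_spaceD:
  assumes "v \<in> tangent_space A p"
  shows "c \<in> charts_at A p \<Longrightarrow> d \<in> charts_at A p \<Longrightarrow> local_deriv c d id p (v c) = v d"
    "d \<notin> charts_at A p \<Longrightarrow> v d = 0"
  using assms unfolding tangent_space_iff by metis+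

lemma tangent_spaceI:
  assumes "\<And>c d. c \<in> charts_at A p \<Longrightarrow> d \<in> charts_at A p \<Longrightarrow> v d = local_deriv c d id p (v c)"
    and "\<And>c. c \<notin> charts_at A p \<Longrightarrow> v c = 0"
  shows "v \<in> tangent_space A p"
  unfolding tangent_space_iff using assms by blast

lemma tangent_space_eqI:
  assumes "v \<in> tangent_space A p" "w \<in> tangent_space A p" "c \<in> charts_at A p" "v c = w c"
  shows "v = w"
proof
  fix d
  show "v d = w d"
  proof (cases "d \<in> charts_at A p")
    case True
    then show ?thesis
      using tangent_spaceD(1)[OF assms(1,3)] tangent_spaceD(1)[OF assms(2,3)] assms(4) by metis
  next
    case False
    then show ?thesis using tangent_spaceD(2)[OF assms(1)] tangent_spaceD(2)[OF assms(2)] by simp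
  qed
qed

text \<open>\<open>tangent_map\<close> evaluates in a chart picked by \<open>SOME\<close>. Any other
  chart gives the same answer: the chain rule for \<open>f \<circ> id\<close>, with
  \<open>id\<close> read as the change of charts, absorbs the transformation rule of
  \<open>v\<close>.\<close>

lemma tangent_map_apply:
  assumes A: "smooth_atlas A" and B: "smooth_atlas B" and f: "smooth_at A B f p"
    and v: "v \<in> tangent_space A p" and c: "c \<in> charts_at A p"
  shows "tangent_map A B f (p, v) =
    (f p, \<lambda>d. if d \<in> charts_at B (f p) then local_deriv c d f p (v c) else 0)"
proof -
  define c0 where "c0 = (SOME c. c \<in> charts_at A p)"
  have p: "p \<in> points A" using charts_atD[OF c] by (auto simp: points_def)
  have c0: "c0 \<in> charts_at A p" unfolding c0_def by (rule charts_at_some[OF p])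
  have "local_deriv c0 d f p (v c0) = local_deriv c d f p (v c)" if "d \<in> charts_at B (f p)" for d
  proof -
    have "local_deriv c0 d (f \<circ> id) p (v c0) = local_deriv c d f p (local_deriv c0 c id p (v c0))"
      using local_deriv_chain[OF A A B smooth_at_id[OF A p], of f c0 c d "v c0"] f c0 c that by simp
    moreover have "local_deriv c0 c id p (v c0) = v c"
      using tangent_spaceD(1)[OF v c0 c] .
    ultimately show ?thesis by simp
  qed
  moreover have "tangent_map A B f (p, v) =
      (f p, \<lambda>d. if d \<in> charts_at B (f p) then local_deriv c0 d f p (v c0) else 0)"
    unfolding tangent_map_def Let_def c0_def local_deriv_def by simp
  ultimately show ?thesis by (simp add: fun_eq_iff)
qed

text \<open>Prescribe the vector in one chart and transport it to the others; compatibility between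
  two target charts is the chain rule for \<open>id \<circ> id\<close>.\<close>

lemma tangent_vector_exists:
  assumes A: "smooth_atlas A" and c: "c \<in> charts_at A p"
  obtains v where "v \<in> tangent_space A p" "v c = w"
proof
  let ?v = "\<lambda>d. if d \<in> charts_at A p then local_deriv c d id p w else 0"
  have p: "p \<in> points A" using charts_atD[OF c] by (auto simp: points_def)
  show "?v \<in> tangent_space A p"
  proof (rule tangent_spaceI)
    fix d e assume "d \<in> charts_at A p" "e \<in> charts_at A p"
    then show "?v e = local_deriv d e id p (?v d)"
      using local_deriv_chain[OF A A A smooth_at_id[OF A p], of id c d e w] smooth_at_id[OF A p] c by simp
  qed simp
  show "?v c = w" using c local_deriv_id[OF A c] by simp
qed

lemma tangent_map_in_tangent_space:
  assumes A: "smooth_atlas A" and B: "smooth_atlas B" and f: "smooth_at A B f p"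
    and v: "v \<in> tangent_space A p"
  shows "snd (tangent_map A B f (p, v)) \<in> tangent_space B (f p)"
proof -
  note p = smooth_at_in_points[OF f]
  obtain c where c: "c \<in> charts_at A p" using charts_at_nonempty[OF p(1)] by blast
  let ?w = "\<lambda>d. if d \<in> charts_at B (f p) then local_deriv c d f p (v c) else 0"
  have "?w \<in> tangent_space B (f p)"
  proof (rule tangent_spaceI)
    fix d e assume "d \<in> charts_at B (f p)" "e \<in> charts_at B (f p)"
    then show "?w e = local_deriv d e id (f p) (?w d)"
      using local_deriv_chain[OF A B B f, of id c d e "v c"] smooth_at_id[OF B p(2)] c by simp
  qed simp
  then show ?thesis unfolding tangent_map_apply[OF A B f v c] by simp
qed

lemma tangent_map_comp:
  assumes A: "smooth_atlas A" and B: "smooth_atlas B" and C: "smooth_atlas C"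
    and f: "smooth_at A B f p" and g: "smooth_at B C g (f p)" and v: "v \<in> tangent_space A p"
  shows "tangent_map B C g (tangent_map A B f (p, v)) = tangent_map A C (g \<circ> f) (p, v)"
proof -
  obtain c where c: "c \<in> charts_at A p" using charts_at_nonempty[OF smooth_at_in_points(1)[OF f]] by blast
  obtain d where d: "d \<in> charts_at B (f p)" using charts_at_nonempty[OF smooth_at_in_points(2)[OF f]] by blast
  define w where "w = snd (tangent_map A B f (p, v))"
  have w: "tangent_map A B f (p, v) = (f p, w)" "w d = local_deriv c d f p (v c)"
    unfolding w_def tangent_map_apply[OF A B f v c] using d by auto
  have wt: "w \<in> tangent_space B (f p)"
    unfolding w_def by (rule tangent_map_in_tangent_space[OF A B f v])
  have gf: "smooth_at A C (g \<circ> f) p"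
    using smooth_at_compose[OF A B C f g] by (simp add: o_def)
  show ?thesis
    unfolding w(1) tangent_map_apply[OF B C g wt d] tangent_map_apply[OF A C gf v c] w(2)
    using local_deriv_chain[OF A B C f g c d] by (auto simp: fun_eq_iff)
qed

text \<open>Applied to three kinds of \<open>f\<close>: the identity, for chart changes of the
  tangent bundle; a composite of \<open>\<phi>\<close> and its inverse; and the inverse of
  \<open>\<phi>\<close> around a point with a neighbourhood of fixed points. A single fixed point
  would not suffice, since the derivative depends on \<open>f\<close> nearby.\<close>

lemma tangent_map_eq_self:
  assumes A: "smooth_atlas A" and v: "v \<in> tangent_space A p"
    and f: "smooth_at A A f p"
    and N: "openin (manifold_top A) N" "p \<in> N" "\<And>q. q \<in> N \<Longrightarrow> f q = q"
  shows "tangent_map A A f (p, v) = (p, v)"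
proof -
  note p = smooth_at_in_points(1)[OF f]
  have fp: "f p = p" using N by auto
  obtain c where c: "c \<in> charts_at A p" using charts_at_nonempty[OF p] by blast
  have "local_deriv c d f p = local_deriv c d id p" if "d \<in> charts_at A p" for d
    using local_deriv_cong[OF A A f c _ N(1,2), of d id] that fp N(3) by simp
  then show ?thesis
    unfolding tangent_map_apply[OF A A f v c] fp using tangent_spaceD[OF v] c by (simp add: fun_eq_iff)
qed

section \<open>The atlas of the tangent bundle\<close>

lemma points_tangent_bundle:
  "points (vb_total (tangent_bundle A)) = (SIGMA p:points A. tangent_space A p)"
  by (auto simp: tangent_bundle_def tangent_chart_def points_def)

text \<open>Every vector occurs as a chart value, by \<open>tangent_vector_exists\<close>, so the
  image is a full cylinder; this is why tangent charts have open images.\<close>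

lemma tangent_chart_image:
  assumes A: "smooth_atlas A" and c: "c \<in> A" and W: "W \<subseteq> fst c"
  shows "snd (tangent_chart A c) ` (SIGMA p:W. tangent_space A p) = snd c ` W \<times> UNIV"
proof -
  have "(snd c p, w) \<in> snd (tangent_chart A c) ` (SIGMA p:W. tangent_space A p)" if p: "p \<in> W" for p w
  proof -
    have "c \<in> charts_at A p" using c p W by (auto simp: charts_at_def)
    then obtain v where "v \<in> tangent_space A p" "v c = w" using tangent_vector_exists[OF A] by metis
    then show ?thesis using p by (auto simp: tangent_chart_def intro!: image_eqI[of _ _ "(p, v)"])
  qed
  then show ?thesis by (auto simp: tangent_chart_def)
qed

lemma tangent_chart_inj:
  assumes A: "smooth_atlas A" and c: "c \<in> A"
  shows "inj_on (snd (tangent_chart A c)) (fst (tangent_chart A c))"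
proof (rule inj_onI)
  fix x y assume xy: "x \<in> fst (tangent_chart A c)" "y \<in> fst (tangent_chart A c)"
    "snd (tangent_chart A c) x = snd (tangent_chart A c) y"
  obtain p v q w where x: "x = (p, v)" "p \<in> fst c" "v \<in> tangent_space A p"
    and y: "y = (q, w)" "q \<in> fst c" "w \<in> tangent_space A q"
    using xy by (auto simp: tangent_chart_def)
  have e: "snd c p = snd c q" "v c = w c" using xy x y by (auto simp: tangent_chart_def)
  have "p = q" using e inj_onD[OF smooth_atlasD(2)[OF A c]] x y by blast
  moreover have "c \<in> charts_at A p" using c x by (auto simp: charts_at_def)
  ultimately show "x = y" using tangent_space_eqI x y e by metis
qed

text \<open>In tangent charts \<open>tangent_map\<close> sends \<open>(x, w)\<close> to the value at
  \<open>x\<close> and the derivative along \<open>w\<close> of the representative of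
  \<open>f\<close>, which is the map treated in \<open>smooth_on_tangent\<close>.\<close>

lemma smooth_on_tangent_charts:
  fixes A :: "('a, 'e::real_inner) atlas" and B :: "('b, 'f::real_inner) atlas"
  assumes A: "smooth_atlas A" and B: "smooth_atlas B" and c: "c \<in> A" and d: "d \<in> B"
    and W: "W \<subseteq> fst c" "open (snd c ` W)" "f ` W \<subseteq> fst d"
    and f: "smooth_on (snd c ` W) (snd d \<circ> f \<circ> chart_inv c)"
  shows "smooth_on (snd (tangent_chart A c) ` (SIGMA p:W. tangent_space A p))
    (snd (tangent_chart B d) \<circ> tangent_map A B f \<circ> chart_inv (tangent_chart A c))"
proof -
  let ?h = "snd d \<circ> f \<circ> chart_inv c"
  let ?S = "snd c ` W \<times> (UNIV :: 'e set)"
  note im = tangent_chart_image[OF A c W(1)]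
  have o: "open ?S" using W(2) by (simp add: open_Times)
  have "smooth_on ?S (\<lambda>(x, w). (?h x, frechet_derivative ?h (at x) w))"
    by (rule smooth_on_tangent[OF smooth_atlasD(1)[OF A] W(2) f])
  moreover have "(snd (tangent_chart B d) \<circ> tangent_map A B f \<circ> chart_inv (tangent_chart A c)) z
      = (case z of (x, w) \<Rightarrow> (?h x, frechet_derivative ?h (at x) w))" if z: "z \<in> ?S" for z
  proof -
    obtain p v where pv: "p \<in> W" "v \<in> tangent_space A p" "z = (snd c p, v c)"
      using z unfolding im[symmetric] by (auto simp: tangent_chart_def)
    have cp: "c \<in> charts_at A p" and dp: "d \<in> charts_at B (f p)"
      using c d pv W by (auto simp: charts_at_def)
    have sf: "smooth_at A B f p"
      by (rule smooth_atI[OF c d pv(1) W f])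
    have "chart_inv (tangent_chart A c) (snd (tangent_chart A c) (p, v)) = (p, v)"
      using pv W by (intro chart_inv_apply tangent_chart_inj[OF A c]) (auto simp: tangent_chart_def)
    then have inv: "chart_inv (tangent_chart A c) z = (p, v)"
      using pv by (simp add: tangent_chart_def)
    have "chart_inv c (snd c p) = p" using A c pv W by auto
    then show ?thesis
      using inv dp tangent_map_apply[OF A B sf pv(2) cp]
      by (simp add: pv(3) tangent_chart_def local_deriv_def)
  qed
  ultimately show ?thesis
    unfolding im using smooth_on_cong[OF o] by blast
qed

lemma fst_tangent_chart: "fst (tangent_chart A c) = (SIGMA p:fst c. tangent_space A p)"
  by (simp add: tangent_chart_def)

lemma vb_total_tangent_bundle: "vb_total (tangent_bundle A) = tangent_chart A ` A"
  by (simp add: tangent_bundle_def)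

lemma smooth_atlas_tangent_bundle:
  fixes A :: "('a, 'e::real_inner) atlas"
  assumes A: "smooth_atlas A"
  shows "smooth_atlas (vb_total (tangent_bundle A))"
  unfolding smooth_atlas_def vb_total_tangent_bundle ball_simps
proof (intro conjI ballI)
  show "finite_dimensional TYPE('e \<times> 'e)"
    by (rule finite_dimensional_prod[OF smooth_atlasD(1)[OF A] smooth_atlasD(1)[OF A]])
  fix c assume c: "c \<in> A"
  show "inj_on (snd (tangent_chart A c)) (fst (tangent_chart A c))" by (rule tangent_chart_inj[OF A c])
  show "open (snd (tangent_chart A c) ` fst (tangent_chart A c))"
    unfolding fst_tangent_chart tangent_chart_image[OF A c subset_refl]
    by (intro open_Times smooth_atlasD(3)[OF A c] open_UNIV)
  fix d assume d: "d \<in> A"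
  have e: "fst (tangent_chart A c) \<inter> fst (tangent_chart A d) = (SIGMA p:fst c \<inter> fst d. tangent_space A p)"
    by (auto simp: fst_tangent_chart)
  have im: "snd (tangent_chart A c) ` (SIGMA p:fst c \<inter> fst d. tangent_space A p) = snd c ` (fst c \<inter> fst d) \<times> UNIV"
    by (rule tangent_chart_image[OF A c]) auto
  show o: "open (snd (tangent_chart A c) ` (fst (tangent_chart A c) \<inter> fst (tangent_chart A d)))"
    unfolding e im by (intro open_Times smooth_atlasD(4)[OF A c d] open_UNIV)
  \<comment> \<open>A change of tangent charts is the representative of the tangent map of
    \<open>id\<close>, since that map fixes every tangent vector; the general result therefore
    covers it.\<close>
  have s: "smooth_on (snd (tangent_chart A c) ` (SIGMA p:fst c \<inter> fst d. tangent_space A p))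
    (snd (tangent_chart A d) \<circ> tangent_map A A id \<circ> chart_inv (tangent_chart A c))"
    by (rule smooth_on_tangent_charts[OF A A c d]) (use smooth_atlasD(4,5)[OF A c d] in auto)
  have "(snd (tangent_chart A d) \<circ> tangent_map A A id \<circ> chart_inv (tangent_chart A c)) z =
      (snd (tangent_chart A d) \<circ> chart_inv (tangent_chart A c)) z"
    if zin: "z \<in> snd (tangent_chart A c) ` (SIGMA p:fst c \<inter> fst d. tangent_space A p)" for z
  proof -
    obtain x where x: "z = snd (tangent_chart A c) x" "x \<in> (SIGMA p:fst c \<inter> fst d. tangent_space A p)"
      by (rule imageE[OF zin])
    obtain p v where pv: "p \<in> fst c" "v \<in> tangent_space A p" "z = snd (tangent_chart A c) (p, v)"
      using x by (cases x) auto
    have p: "p \<in> points A" using pv c by (auto simp: points_def)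
    have "chart_inv (tangent_chart A c) z = (p, v)"
      using pv chart_inv_apply[OF tangent_chart_inj[OF A c], of "(p, v)"] by (simp add: fst_tangent_chart)
    moreover have "tangent_map A A id (p, v) = (p, v)"
      by (rule tangent_map_eq_self[OF A pv(2) smooth_at_id[OF A p] openin_chart_domain[OF A c] pv(1)]) simp
    ultimately show ?thesis by simp
  qed
  then show "smooth_on (snd (tangent_chart A c) ` (fst (tangent_chart A c) \<inter> fst (tangent_chart A d)))
      (snd (tangent_chart A d) \<circ> chart_inv (tangent_chart A c))"
    using s smooth_on_cong[OF o[unfolded e]] unfolding e by blast
qed

lemma smooth_at_tangent_map:
  assumes A: "smooth_atlas A" and B: "smooth_atlas B" and f: "smooth_at A B f p"
    and v: "v \<in> tangent_space A p"
  shows "smooth_at (vb_total (tangent_bundle A)) (vb_total (tangent_bundle B)) (tangent_map A B f) (p, v)"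
proof -
  obtain c d W where 0: "c \<in> A" "d \<in> B" "p \<in> W" "W \<subseteq> fst c" "open (snd c ` W)"
      "f ` W \<subseteq> fst d" "smooth_on (snd c ` W) (snd d \<circ> f \<circ> chart_inv c)"
    using f unfolding smooth_at_def by blast
  show ?thesis
  proof (rule smooth_atI[where c="tangent_chart A c" and d="tangent_chart B d" and W="SIGMA p:W. tangent_space A p"])
    show "open (snd (tangent_chart A c) ` (SIGMA p:W. tangent_space A p))"
      unfolding tangent_chart_image[OF A 0(1,4)] by (intro open_Times 0 open_UNIV)
    show "tangent_map A B f ` (SIGMA p:W. tangent_space A p) \<subseteq> fst (tangent_chart B d)"
    proof (rule image_subsetI)
      fix x assume "x \<in> (SIGMA p:W. tangent_space A p)"
      then obtain q w where q: "q \<in> W" "w \<in> tangent_space A q" and x: "x = (q, w)"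
        by (cases x) auto
      have sq: "smooth_at A B f q" by (rule smooth_atI[OF 0(1,2) q(1) 0(4-7)])
      obtain w' where "tangent_map A B f (q, w) = (f q, w')"
        by (simp add: tangent_map_def Let_def)
      then show "tangent_map A B f x \<in> fst (tangent_chart B d)"
        unfolding x using tangent_map_in_tangent_space[OF A B sq q(2)] q 0(6) by (auto simp: fst_tangent_chart)
    qed
    show "smooth_on (snd (tangent_chart A c) ` (SIGMA p:W. tangent_space A p))
        (snd (tangent_chart B d) \<circ> tangent_map A B f \<circ> chart_inv (tangent_chart A c))"
      by (rule smooth_on_tangent_charts[OF A B 0(1,2,4-7)])
  qed (use 0 v in \<open>auto simp: vb_total_tangent_bundle fst_tangent_chart\<close>)
qed

section \<open>Smooth functions and their derivatives along tangent vectors\<close>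

lemma smooth_functions_iff:
  "smooth_atlas A \<Longrightarrow> f \<in> smooth_functions A \<longleftrightarrow> (\<forall>p\<in>points A. smooth_at A model_atlas f p)"
  by (simp add: smooth_functions_def smooth_map_iff_smooth_at smooth_atlas_model finite_dimensional_real)

lemma smooth_function_differentiable:
  assumes A: "smooth_atlas A" and f: "f \<in> smooth_functions A" and c: "c \<in> charts_at A p"
  shows "(f \<circ> chart_inv c) differentiable (at (snd c p))"
proof -
  have "p \<in> points A" using charts_atD[OF c] by (auto simp: points_def)
  then have "smooth_at A model_atlas f p" using f smooth_functions_iff[OF A] by blast
  then have "(snd (UNIV :: real set, id) \<circ> f \<circ> chart_inv c) differentiable (at (snd c p))"
    by (rule smooth_at_differentiable[OF A smooth_atlas_model[OF finite_dimensional_real] _ c])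
      (simp add: charts_at_def model_atlas_def)
  then show ?thesis by simp
qed

text \<open>The manifold is covered by two open sets on which the extension is visibly smooth: the
  chart domain and the complement of the image of the ball. The second is open because that image is
  compact and the manifold is Hausdorff.\<close>

lemma smooth_function_extend:
  assumes M: "smooth_manifold A" and c: "c \<in> A" and q: "smooth_on UNIV q"
    and sub: "cball z r \<subseteq> snd c ` fst c" and q0: "\<And>x. x \<notin> cball z r \<Longrightarrow> q x = 0"
  shows "(\<lambda>p. if p \<in> fst c then q (snd c p) else 0) \<in> smooth_functions A"
    and "closedin (manifold_top A) (chart_inv c ` cball z r)"
proof -
  note A = smooth_manifold_imp_smooth_atlas[OF M]
  let ?f = "\<lambda>p. if p \<in> fst c then q (snd c p) else 0"
  let ?K = "chart_inv c ` cball z r"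
  have "continuous_map (top_of_set (cball z r)) (manifold_top A) (chart_inv c)"
    unfolding continuous_map_def openin_smooth_atlas(2)[OF A]
  proof (intro conjI allI impI)
    show "chart_inv c \<in> topspace (top_of_set (cball z r)) \<rightarrow> points A"
    proof
      fix x assume "x \<in> topspace (top_of_set (cball z r))"
      then obtain p where "p \<in> fst c" "x = snd c p" using sub by auto
      then show "chart_inv c x \<in> points A" using A c by (auto simp: points_def)
    qed
    fix V assume "openin (manifold_top A) V"
    then have o: "open (snd c ` (V \<inter> fst c))" using c by (simp add: openin_smooth_atlas(1)[OF A])
    have "chart_inv c x \<in> V \<longleftrightarrow> x \<in> snd c ` (V \<inter> fst c)" if x: "x \<in> cball z r" for x
    proof -
      obtain p where p: "p \<in> fst c" "x = snd c p" using x sub by blast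
      then have i: "chart_inv c x = p" using A c by simp
      have "p \<in> V" if "snd c p \<in> snd c ` (V \<inter> fst c)"
        using that p inj_onD[OF smooth_atlasD(2)[OF A c]] by blast
      then show ?thesis unfolding i unfolding p(2) using p(1) by auto
    qed
    then have "{x \<in> topspace (top_of_set (cball z r)). chart_inv c x \<in> V} = cball z r \<inter> snd c ` (V \<inter> fst c)"
      by auto
    then show "openin (top_of_set (cball z r)) {x \<in> topspace (top_of_set (cball z r)). chart_inv c x \<in> V}"
      using o by (simp add: openin_open_Int)
  qed
  moreover have "compactin (top_of_set (cball z r)) (cball z r)"
    using compact_cball_finite_dimensional[OF smooth_atlasD(1)[OF A]] by (simp add: compactin_subtopology)
  ultimately have "compactin (manifold_top A) ?K" by (rule image_compactin[rotated])
  then show K: "closedin (manifold_top A) ?K"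
    using M compactin_imp_closedin unfolding smooth_manifold_def by blast
  have K0: "?f p = 0" if "p \<notin> ?K" for p
  proof (cases "p \<in> fst c")
    case True
    then have "snd c p \<notin> cball z r" using that smooth_atlas_chart_inv[OF A c] by (metis imageI)
    then show ?thesis using q0 by simp
  qed simp
  have Kc: "?K \<subseteq> fst c"
  proof clarify
    fix x assume "x \<in> cball z r"
    then obtain p where "p \<in> fst c" "x = snd c p" using sub by blast
    then show "chart_inv c x \<in> fst c" using A c by simp
  qed
  show "?f \<in> smooth_functions A"
    unfolding smooth_functions_iff[OF A]
  proof
    fix p assume p: "p \<in> points A"
    show "smooth_at A model_atlas ?f p"
    proof (cases "p \<in> fst c")
      case True
      have o: "open (snd c ` fst c)" by (rule smooth_atlasD(3)[OF A c])
      have "(?f \<circ> chart_inv c) x = q x" if "x \<in> snd c ` fst c" for x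
        using that A c by auto
      then have "smooth_on (snd c ` fst c) (?f \<circ> chart_inv c)"
        using smooth_on_cong[OF o, of "?f \<circ> chart_inv c" q] smooth_on_subset[OF q] by blast
      then show ?thesis by (rule smooth_at_modelI[OF c True subset_refl o])
    next
      case False
      have "openin (manifold_top A) (points A - ?K)"
        using K by (simp add: closedin_def openin_smooth_atlas(2)[OF A])
      moreover have "p \<in> points A - ?K" using p False Kc by auto
      ultimately show ?thesis
        by (rule smooth_at_cong[OF A smooth_atlas_model[OF finite_dimensional_real] smooth_at_const_model[OF A p, of 0]])
          (use K0 in auto)
    qed
  qed
qed

lemma chart_cball:
  assumes A: "smooth_atlas A" and c: "c \<in> charts_at A p" and W: "openin (manifold_top A) W" "p \<in> W"
  obtains r where "r > 0" "cball (snd c p) r \<subseteq> snd c ` (fst c \<inter> W)"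
proof -
  note c' = charts_atD[OF c]
  have "open (snd c ` (fst c \<inter> W))"
    using open_chart_Int[OF A c'(1) subset_refl smooth_atlasD(3)[OF A c'(1)] W(1)] .
  moreover have "snd c p \<in> snd c ` (fst c \<inter> W)" using c' W by auto
  ultimately show thesis using that open_contains_cball by metis
qed

text \<open>The closed set \<open>K\<close> is part of the conclusion because its complement is an
  open set on which \<open>f\<close> vanishes; vanishing outside \<open>W\<close> would not by
  itself let a product with \<open>f\<close> be extended smoothly across the edge of
  \<open>W\<close>.\<close>

lemma smooth_bump_function:
  assumes M: "smooth_manifold A" and W: "openin (manifold_top A) W" "p \<in> W"
  obtains f K where "f \<in> smooth_functions A" "f p = 1" "K \<subseteq> W" "closedin (manifold_top A) K"
    "\<And>q. q \<notin> K \<Longrightarrow> f q = (0::real)"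
proof -
  note A = smooth_manifold_imp_smooth_atlas[OF M]
  have "p \<in> points A" using openin_subset[OF W(1)] W(2) by (auto simp: openin_smooth_atlas(2)[OF A])
  then obtain c where c: "c \<in> charts_at A p" using charts_at_nonempty[of p A] by auto
  note c' = charts_atD[OF c]
  obtain r where r: "r > 0" "cball (snd c p) r \<subseteq> snd c ` (fst c \<inter> W)"
    using chart_cball[OF A c W] .
  obtain h where h: "smooth_on UNIV h" "h (snd c p) = (1::real)" "\<And>z. z \<notin> cball (snd c p) r \<Longrightarrow> h z = 0"
    using smooth_bump_ball[OF r(1)] by metis
  let ?f = "\<lambda>q. if q \<in> fst c then h (snd c q) else 0"
  let ?K = "chart_inv c ` cball (snd c p) r"
  have sub: "cball (snd c p) r \<subseteq> snd c ` fst c" using r by auto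
  show thesis
  proof
    show "?f \<in> smooth_functions A" "closedin (manifold_top A) ?K"
      by (rule smooth_function_extend[OF M c'(1) h(1) sub h(3)]; assumption)+
    show "?f p = 1" using c' h by simp
    show "?K \<subseteq> W"
    proof clarify
      fix x assume "x \<in> cball (snd c p) r"
      then obtain q where "q \<in> fst c" "q \<in> W" "x = snd c q" using r by blast
      then show "chart_inv c x \<in> W" using A c' by simp
    qed
    show "?f q = 0" if "q \<notin> ?K" for q
    proof (cases "q \<in> fst c")
      case True
      then have "snd c q \<notin> cball (snd c p) r" using that smooth_atlas_chart_inv[OF A c'(1)] by (metis imageI)
      then show ?thesis using h(3) by simp
    qed simp
  qed
qed

text \<open>The test function is the inner product with \<open>v c\<close> in a chart, centred at
  \<open>p\<close> and cut off by a bump. Its derivative along the vector is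
  \<open>v c \<bullet> v c\<close>.\<close>

lemma tangent_derivative_eq_0_imp:
  assumes M: "smooth_manifold A" and p: "p \<in> points A" and v: "v \<in> tangent_space A p"
    and 0: "\<And>g. g \<in> smooth_functions A \<Longrightarrow> tangent_derivative A (p, v) g = 0"
  shows "v = (\<lambda>c. 0)"
proof -
  note A = smooth_manifold_imp_smooth_atlas[OF M]
  \<comment> \<open>The chart is the one hidden in \<open>tangent_derivative\<close>, so unfolding
    involves no change of charts.\<close>
  define c where "c = (SOME c. c \<in> charts_at A p)"
  have c: "c \<in> charts_at A p" unfolding c_def by (rule charts_at_some[OF p])
  note c' = charts_atD[OF c]
  obtain r where r: "r > 0" "cball (snd c p) r \<subseteq> snd c ` (fst c \<inter> fst c)"
    using chart_cball[OF A c openin_chart_domain[OF A c'(1)] c'(2)] .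
  obtain h where h: "smooth_on UNIV h" "h (snd c p) = (1::real)" "\<And>z. z \<notin> cball (snd c p) r \<Longrightarrow> h z = 0"
    using smooth_bump_ball[OF r(1)] by metis
  define l where "l z = (z + - snd c p) \<bullet> v c" for z
  have l: "smooth_on UNIV l"
    unfolding l_def
    by (intro smooth_on_inner smooth_on_add smooth_on_const smooth_on_bounded_linear bounded_linear_ident open_UNIV)
  define q where "q z = l z * h z" for z
  have q: "smooth_on UNIV q" unfolding q_def by (intro smooth_on_mult open_UNIV l h(1))
  let ?g = "\<lambda>q'. if q' \<in> fst c then q (snd c q') else 0"
  have g: "?g \<in> smooth_functions A"
    by (rule smooth_function_extend[OF M c'(1) q, where z="snd c p" and r=r]) (use r h in \<open>auto simp: q_def\<close>)
  have hd: "(h has_derivative frechet_derivative h (at (snd c p))) (at (snd c p))"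
    using smooth_on_differentiable[OF h(1)] by (simp add: frechet_derivative_works)
  have ld: "(l has_derivative (\<lambda>w. w \<bullet> v c)) (at (snd c p))"
    unfolding l_def by (auto intro!: derivative_eq_intros)
  \<comment> \<open>The first summand vanishes because \<open>l\<close> is 0 at the centre, and
    \<open>h\<close> is 1 there, so the cut-off does not alter the derivative of
    \<open>l\<close>.\<close>
  have "(q has_derivative (\<lambda>w. l (snd c p) * frechet_derivative h (at (snd c p)) w + (w \<bullet> v c) * h (snd c p))) (at (snd c p))"
    unfolding q_def by (rule has_derivative_mult[OF ld hd])
  then have qd: "frechet_derivative q (at (snd c p)) w = w \<bullet> v c" for w
    using frechet_derivative_at[symmetric, of q "\<lambda>w. w \<bullet> v c"] by (simp add: h(2) l_def)
  have "frechet_derivative (?g \<circ> chart_inv c) (at (snd c p)) = frechet_derivative q (at (snd c p))"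
    by (rule frechet_derivative_transform_within_open[OF smooth_function_differentiable[OF A g c] smooth_atlasD(3)[OF A c'(1)]])
      (use A c' in auto)
  then have "v c \<bullet> v c = 0"
    using 0[OF g] qd by (simp add: tangent_derivative_def c_def[symmetric])
  then have "v c = 0" by simp
  show ?thesis
  proof
    fix d
    show "v d = 0"
    proof (cases "d \<in> charts_at A p")
      case True
      then have "v d = local_deriv c d id p (v c)" using tangent_spaceD(1)[OF v c] by simp
      then show ?thesis
        using \<open>v c = 0\<close> local_deriv_linear(3)[OF A A smooth_at_id[OF A p] c] True by simp
    next
      case False
      then show ?thesis by (rule tangent_spaceD(2)[OF v])
    qed
  qed
qed

lemma tangent_derivative_locally_zero:
  assumes A: "smooth_atlas A" and p: "p \<in> points A" and f: "f \<in> smooth_functions A"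
    and N: "openin (manifold_top A) N" "p \<in> N" "\<And>q. q \<in> N \<Longrightarrow> f q = 0"
  shows "tangent_derivative A (p, v) f = 0"
proof -
  define c where "c = (SOME c. c \<in> charts_at A p)"
  have c: "c \<in> charts_at A p" unfolding c_def by (rule charts_at_some[OF p])
  have o: "open (snd c ` (fst c \<inter> N))"
    using open_chart_Int[OF A charts_atD(1)[OF c] subset_refl smooth_atlasD(3)[OF A charts_atD(1)[OF c]] N(1)] .
  have "frechet_derivative (f \<circ> chart_inv c) (at (snd c p)) = frechet_derivative (\<lambda>x. 0) (at (snd c p))"
    by (rule frechet_derivative_transform_within_open[OF smooth_function_differentiable[OF A f c] o])
      (use charts_atD[OF c] A N in auto)
  then show ?thesis by (simp add: tangent_derivative_def c_def[symmetric])
qed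

section \<open>Sections of vector bundles\<close>

lemma vector_bundleD:
  fixes E :: "('f, 'n, 'e::real_inner, 'k::real_inner) vbundle"
  assumes "vector_bundle E"
  shows "smooth_manifold (vb_base E)" "smooth_atlas (vb_base E)" "smooth_atlas (vb_total E)"
    "finite_dimensional TYPE('k)" "smooth_map (vb_total E) (vb_base E) (vb_proj E)"
    "x \<in> points (vb_base E) \<Longrightarrow> real_vector_space_on (fibre E x) (vb_add E) (vb_scale E) (vb_zero E x)"
proof -
  show "smooth_manifold (vb_base E)" "smooth_map (vb_total E) (vb_base E) (vb_proj E)"
    "x \<in> points (vb_base E) \<Longrightarrow> real_vector_space_on (fibre E x) (vb_add E) (vb_scale E) (vb_zero E x)"
    using assms by (simp_all add: vector_bundle_def)
  show "smooth_atlas (vb_base E)" and T: "smooth_atlas (vb_total E)"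
    using assms by (simp_all add: vector_bundle_def smooth_manifold_imp_smooth_atlas)
  show "finite_dimensional TYPE('k)"
    by (rule finite_dimensional_snd[OF smooth_atlasD(1)[OF T]])
qed

lemma fibreD: "e \<in> fibre E x \<Longrightarrow> e \<in> points (vb_total E)" "e \<in> fibre E x \<Longrightarrow> vb_proj E e = x"
  by (simp_all add: fibre_def)

lemma fibre_vector_space:
  assumes E: "vector_bundle E" and x: "x \<in> points (vb_base E)"
  shows "vb_zero E x \<in> fibre E x"
    "e \<in> fibre E x \<Longrightarrow> e' \<in> fibre E x \<Longrightarrow> vb_add E e e' \<in> fibre E x"
    "e \<in> fibre E x \<Longrightarrow> vb_scale E a e \<in> fibre E x"
    "e \<in> fibre E x \<Longrightarrow> vb_scale E 1 e = e"
    "e \<in> fibre E x \<Longrightarrow> vb_add E (vb_zero E x) e = e"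
proof -
  note V = vector_bundleD(6)[OF E x, unfolded real_vector_space_on_def]
  show "vb_zero E x \<in> fibre E x"
    "e \<in> fibre E x \<Longrightarrow> e' \<in> fibre E x \<Longrightarrow> vb_add E e e' \<in> fibre E x"
    "e \<in> fibre E x \<Longrightarrow> vb_scale E a e \<in> fibre E x"
    "e \<in> fibre E x \<Longrightarrow> vb_scale E 1 e = e"
    using V by simp_all
  show "e \<in> fibre E x \<Longrightarrow> vb_add E (vb_zero E x) e = e"
    using V by metis
qed

lemma trivialisation_exists:
  assumes "vector_bundle E" "x \<in> points (vb_base E)"
  obtains U \<tau> where "openin (manifold_top (vb_base E)) U" "x \<in> U" "local_trivialisation E U \<tau>"
  using assms unfolding vector_bundle_def by blast

lemma trivialisation_fibre:
  assumes "local_trivialisation E U \<tau>" "x \<in> U" "e \<in> fibre E x"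
  shows "fst (\<tau> e) = x"
    "e' \<in> fibre E x \<Longrightarrow> snd (\<tau> (vb_add E e e')) = snd (\<tau> e) + snd (\<tau> e')"
    "snd (\<tau> (vb_scale E a e)) = a *\<^sub>R snd (\<tau> e)"
  using assms unfolding local_trivialisation_def by blast+

lemma trivialisation_zero:
  assumes E: "vector_bundle E" and x: "x \<in> points (vb_base E)"
    and t: "local_trivialisation E U \<tau>" "x \<in> U"
  shows "snd (\<tau> (vb_zero E x)) = 0"
proof -
  have z: "vb_zero E x \<in> fibre E x" by (rule fibre_vector_space(1)[OF E x])
  have "snd (\<tau> (vb_add E (vb_zero E x) (vb_zero E x))) = snd (\<tau> (vb_zero E x)) + snd (\<tau> (vb_zero E x))"
    by (rule trivialisation_fibre(2)[OF t z z])
  then show ?thesis using fibre_vector_space(5)[OF E x z] by simp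
qed

lemma trivialisation_atlases:
  assumes E: "vector_bundle E" and U: "openin (manifold_top (vb_base E)) U"
  shows "openin (manifold_top (vb_total E)) (points (vb_total E) \<inter> vb_proj E -` U)"
    "points (vb_base E) \<inter> U = U"
    "smooth_atlas (restrict_atlas (vb_total E) (vb_proj E -` U))"
    "smooth_atlas (restrict_atlas (vb_base E) U)"
proof -
  have "continuous_map (manifold_top (vb_total E)) (manifold_top (vb_base E)) (vb_proj E)"
    using vector_bundleD(5)[OF E] by (simp add: smooth_map_def)
  from openin_continuous_map_preimage[OF this U]
  have "openin (manifold_top (vb_total E)) {e \<in> points (vb_total E). vb_proj E e \<in> U}"
    by (simp add: openin_smooth_atlas(2)[OF vector_bundleD(3)[OF E]])
  moreover have "{e \<in> points (vb_total E). vb_proj E e \<in> U} = points (vb_total E) \<inter> vb_proj E -` U" by auto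
  ultimately show o: "openin (manifold_top (vb_total E)) (points (vb_total E) \<inter> vb_proj E -` U)" by simp
  show e: "points (vb_base E) \<inter> U = U"
    using openin_subset[OF U] by (auto simp: openin_smooth_atlas(2)[OF vector_bundleD(2)[OF E]])
  show "smooth_atlas (restrict_atlas (vb_total E) (vb_proj E -` U))"
    by (rule smooth_atlas_restrict[OF vector_bundleD(3)[OF E] o])
  show "smooth_atlas (restrict_atlas (vb_base E) U)"
    by (rule smooth_atlas_restrict[OF vector_bundleD(2)[OF E]]) (simp add: e U)
qed

lemma smooth_at_trivialisation:
  fixes E :: "('f, 'n, 'e::real_inner, 'k::real_inner) vbundle"
  assumes E: "vector_bundle E" and U: "openin (manifold_top (vb_base E)) U" and t: "local_trivialisation E U \<tau>"
    and e: "e \<in> points (vb_total E)" "vb_proj E e \<in> U"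
  shows "smooth_at (vb_total E) model_atlas (\<lambda>e. snd (\<tau> e)) e"
proof -
  note B = trivialisation_atlases[OF E U]
  note m = smooth_atlas_model[OF vector_bundleD(4)[OF E]]
  note P = smooth_atlas_product[OF B(4) m]
  let ?R = "restrict_atlas (vb_total E) (vb_proj E -` U)"
  let ?P = "product_atlas (restrict_atlas (vb_base E) U) (model_atlas :: ('k, 'k) atlas)"
  have "smooth_map ?R ?P \<tau>"
    using t by (simp add: local_trivialisation_def diffeomorphism_def)
  moreover have "e \<in> points ?R" using e by (simp add: points_restrict_atlas)
  ultimately have 1: "smooth_at ?R ?P \<tau> e" using smooth_map_iff_smooth_at[OF B(3) P] by blast
  have 2: "smooth_at (vb_total E) ?R (\<lambda>x. x) e"
    by (rule smooth_at_restrict(1)[OF vector_bundleD(3)[OF E] B(1) e(1)]) (use e in simp)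
  have 3: "smooth_at ?P model_atlas snd (\<tau> e)"
    by (rule smooth_at_snd[OF B(4) m]) (use smooth_at_in_points(2)[OF 1] in \<open>simp add: points_product_atlas\<close>)
  have "smooth_at (vb_total E) ?P \<tau> e"
    using smooth_at_compose[OF vector_bundleD(3)[OF E] B(3) P 2 1] .
  from smooth_at_compose[OF vector_bundleD(3)[OF E] P m this 3] show ?thesis .
qed

text \<open>The inverse is taken on the points of the restricted atlas, since that is the inverse
  whose smoothness \<open>diffeomorphism\<close> asserts.\<close>

definition triv_inv :: "('f, 'n, 'e::real_inner, 'k::real_inner) vbundle \<Rightarrow> 'n set \<Rightarrow> ('f \<Rightarrow> 'n \<times> 'k) \<Rightarrow> 'n \<Rightarrow> 'k \<Rightarrow> 'f" where
  "triv_inv E U \<tau> x k = inv_into (points (restrict_atlas (vb_total E) (vb_proj E -` U))) \<tau> (x, k)"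

lemma triv_inv:
  fixes E :: "('f, 'n, 'e::real_inner, 'k::real_inner) vbundle"
  assumes E: "vector_bundle E" and U: "openin (manifold_top (vb_base E)) U" and t: "local_trivialisation E U \<tau>"
    and x: "x \<in> U"
  shows "triv_inv E U \<tau> x k \<in> fibre E x" "snd (\<tau> (triv_inv E U \<tau> x k)) = k"
    "e \<in> fibre E x \<Longrightarrow> triv_inv E U \<tau> x (snd (\<tau> e)) = e"
proof -
  let ?R = "restrict_atlas (vb_total E) (vb_proj E -` U)"
  let ?P = "product_atlas (restrict_atlas (vb_base E) U) (model_atlas :: ('k, 'k) atlas)"
  have bij: "bij_betw \<tau> (points ?R) (points ?P)"
    using t by (simp add: local_trivialisation_def diffeomorphism_def)
  have P: "points ?P = U \<times> UNIV"
    by (simp add: points_product_atlas points_model_atlas points_restrict_atlas trivialisation_atlases(2)[OF E U])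
  have xk: "(x, k) \<in> points ?P" using x P by simp
  have r: "triv_inv E U \<tau> x k \<in> points ?R" "\<tau> (triv_inv E U \<tau> x k) = (x, k)"
    unfolding triv_inv_def using bij xk
    by (simp_all add: bij_betw_def inv_into_into f_inv_into_f)
  then show "snd (\<tau> (triv_inv E U \<tau> x k)) = k" by simp
  have "triv_inv E U \<tau> x k \<in> fibre E (vb_proj E (triv_inv E U \<tau> x k))" "vb_proj E (triv_inv E U \<tau> x k) \<in> U"
    using r by (simp_all add: fibre_def points_restrict_atlas)
  with trivialisation_fibre(1)[OF t] r show "triv_inv E U \<tau> x k \<in> fibre E x" by fastforce
  assume e: "e \<in> fibre E x"
  have "\<tau> e = (x, snd (\<tau> e))" using trivialisation_fibre(1)[OF t x e] by (simp add: prod_eq_iff)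
  moreover have "e \<in> points ?R" using e x by (simp add: fibre_def points_restrict_atlas)
  ultimately show "triv_inv E U \<tau> x (snd (\<tau> e)) = e"
    unfolding triv_inv_def using bij by (metis bij_betw_inv_into_left)
qed

lemma trivialisation_inj:
  assumes "vector_bundle E" "openin (manifold_top (vb_base E)) U" "local_trivialisation E U \<tau>" "x \<in> U"
    and "e \<in> fibre E x" "e' \<in> fibre E x" "snd (\<tau> e) = snd (\<tau> e')"
  shows "e = e'"
  using triv_inv(3)[OF assms(1-4)] assms(5-7) by metis

lemma smooth_at_triv_inv:
  fixes E :: "('f, 'n, 'e::real_inner, 'k::real_inner) vbundle"
  assumes E: "vector_bundle E" and U: "openin (manifold_top (vb_base E)) U" and t: "local_trivialisation E U \<tau>"
    and x: "x \<in> U" and s: "smooth_at (vb_base E) model_atlas s x"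
  shows "smooth_at (vb_base E) (vb_total E) (\<lambda>q. triv_inv E U \<tau> q (s q)) x"
proof -
  note N = vector_bundleD(2)[OF E] and T = vector_bundleD(3)[OF E]
  note B = trivialisation_atlases[OF E U]
  note m = smooth_atlas_model[OF vector_bundleD(4)[OF E]]
  note P = smooth_atlas_product[OF B(4) m]
  let ?R = "restrict_atlas (vb_total E) (vb_proj E -` U)"
  let ?P = "product_atlas (restrict_atlas (vb_base E) U) (model_atlas :: ('k, 'k) atlas)"
  let ?inv = "inv_into (points ?R) \<tau>"
  have "smooth_map ?P ?R ?inv"
    using t by (simp add: local_trivialisation_def diffeomorphism_def)
  moreover have "(x, s x) \<in> points ?P"
    using x by (simp add: points_product_atlas points_model_atlas points_restrict_atlas B(2))
  ultimately have 1: "smooth_at ?P ?R ?inv (x, s x)" using smooth_map_iff_smooth_at[OF P B(3)] by blast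
  have xp: "x \<in> points (vb_base E)" using smooth_at_in_points(1)[OF s] .
  have "smooth_at (vb_base E) (restrict_atlas (vb_base E) U) (\<lambda>x. x) x"
    by (rule smooth_at_restrict(1)[OF N _ xp x]) (simp add: B(2) U)
  from smooth_at_Pair[OF N B(4) m this s]
  have 2: "smooth_at (vb_base E) ?P (\<lambda>q. (q, s q)) x" .
  have 3: "smooth_at (vb_base E) ?R (\<lambda>q. ?inv (q, s q)) x"
    by (rule smooth_at_compose[OF N P B(3) 2 1])
  have "triv_inv E U \<tau> x (s x) \<in> fibre E x" by (rule triv_inv(1)[OF E U t x])
  then have "smooth_at ?R (vb_total E) (\<lambda>x. x) (?inv (x, s x))"
    using x by (intro smooth_at_restrict(2)[OF T B(1)]) (auto simp: fibre_def triv_inv_def)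
  from smooth_at_compose[OF N B(3) T 3 this] show ?thesis by (simp add: triv_inv_def)
qed

text \<open>Reduces smoothness of a section to that of its fibre component \<open>s\<close>, a map
  into a vector space. \<open>V\<close> may be smaller than \<open>U\<close>, for formulas that hold
  only away from a closed set.\<close>

lemma smooth_at_sectionI:
  assumes E: "vector_bundle E" and U: "openin (manifold_top (vb_base E)) U" and t: "local_trivialisation E U \<tau>"
    and V: "openin (manifold_top (vb_base E)) V" "x \<in> V" "V \<subseteq> U"
    and w: "\<And>q. q \<in> V \<Longrightarrow> w q \<in> fibre E q" "\<And>q. q \<in> V \<Longrightarrow> snd (\<tau> (w q)) = s q"
    and s: "smooth_at (vb_base E) model_atlas s x"
  shows "smooth_at (vb_base E) (vb_total E) w x"
proof (rule smooth_at_cong[OF vector_bundleD(2,3)[OF E] smooth_at_triv_inv[OF E U t _ s] V(1,2)])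
  show "x \<in> U" using V by auto
  fix q assume q: "q \<in> V"
  then show "triv_inv E U \<tau> q (s q) = w q"
    using triv_inv(3)[OF E U t _ w(1)[OF q]] w(2)[OF q] V by auto
qed

lemma sectionsD:
  assumes E: "vector_bundle E" and u: "u \<in> sections E" and x: "x \<in> points (vb_base E)"
  shows "smooth_at (vb_base E) (vb_total E) u x" "u x \<in> fibre E x"
proof -
  show s: "smooth_at (vb_base E) (vb_total E) u x"
    using u x smooth_map_iff_smooth_at[OF vector_bundleD(2,3)[OF E]] by (simp add: sections_def)
  show "u x \<in> fibre E x"
    using u x smooth_at_in_points(2)[OF s] by (simp add: sections_def fibre_def)
qed

lemma sectionsI:
  assumes E: "vector_bundle E" and "u \<in> extensional (points (vb_base E))"
    and "\<And>x. x \<in> points (vb_base E) \<Longrightarrow> smooth_at (vb_base E) (vb_total E) u x"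
    and "\<And>x. x \<in> points (vb_base E) \<Longrightarrow> u x \<in> fibre E x"
  shows "u \<in> sections E"
  using assms smooth_map_iff_smooth_at[OF vector_bundleD(2,3)[OF E]]
  by (simp add: sections_def fibreD)

lemma smooth_at_section_trivialised:
  assumes E: "vector_bundle E" and u: "u \<in> sections E"
    and U: "openin (manifold_top (vb_base E)) U" and t: "local_trivialisation E U \<tau>" and x: "x \<in> U"
  shows "smooth_at (vb_base E) model_atlas (\<lambda>q. snd (\<tau> (u q))) x"
proof -
  have xp: "x \<in> points (vb_base E)" using trivialisation_atlases(2)[OF E U] x by auto
  note s = sectionsD[OF E u xp]
  have "smooth_at (vb_total E) model_atlas (\<lambda>e. snd (\<tau> e)) (u x)"
    by (rule smooth_at_trivialisation[OF E U t]) (use fibreD[OF s(2)] x in auto)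
  from smooth_at_compose[OF vector_bundleD(2,3)[OF E] smooth_atlas_model[OF vector_bundleD(4)[OF E]] s(1) this]
  show ?thesis .
qed

lemma sec_add_in_sections:
  assumes E: "vector_bundle E" and u: "u \<in> sections E" and v: "v \<in> sections E"
  shows "sec_add E u v \<in> sections E"
proof (rule sectionsI[OF E])
  show "sec_add E u v \<in> extensional (points (vb_base E))" by (simp add: sec_add_def)
  show fib: "sec_add E u v x \<in> fibre E x" if x: "x \<in> points (vb_base E)" for x
    using fibre_vector_space(2)[OF E x] sectionsD(2)[OF E _ x] u v x by (simp add: sec_add_def)
  fix x assume x: "x \<in> points (vb_base E)"
  obtain U \<tau> where U: "openin (manifold_top (vb_base E)) U" "x \<in> U" "local_trivialisation E U \<tau>"
    by (rule trivialisation_exists[OF E x])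
  have sub: "q \<in> points (vb_base E)" if "q \<in> U" for q
    using trivialisation_atlases(2)[OF E U(1)] that by auto
  note k = vector_bundleD(4)[OF E]
  show "smooth_at (vb_base E) (vb_total E) (sec_add E u v) x"
  proof (rule smooth_at_sectionI[OF E U(1,3) U(1,2) subset_refl])
    show "smooth_at (vb_base E) model_atlas (\<lambda>q. snd (\<tau> (u q)) + snd (\<tau> (v q))) x"
      by (rule smooth_at_model_combine[where P="\<lambda>a b. a + b", OF vector_bundleD(2)[OF E] k k
            smooth_at_section_trivialised[OF E u U(1,3,2)] smooth_at_section_trivialised[OF E v U(1,3,2)] smooth_on_add])
    fix q assume q: "q \<in> U"
    show "sec_add E u v q \<in> fibre E q" by (rule fib[OF sub[OF q]])
    show "snd (\<tau> (sec_add E u v q)) = snd (\<tau> (u q)) + snd (\<tau> (v q))"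
      using trivialisation_fibre(2)[OF U(3) q sectionsD(2)[OF E u sub[OF q]] sectionsD(2)[OF E v sub[OF q]]] sub[OF q]
      by (simp add: sec_add_def)
  qed
qed

lemma sec_mult_in_sections:
  assumes E: "vector_bundle E" and u: "u \<in> sections E" and f: "f \<in> smooth_functions (vb_base E)"
  shows "sec_mult E f u \<in> sections E"
proof (rule sectionsI[OF E])
  show "sec_mult E f u \<in> extensional (points (vb_base E))" by (simp add: sec_mult_def)
  show fib: "sec_mult E f u x \<in> fibre E x" if x: "x \<in> points (vb_base E)" for x
    using fibre_vector_space(3)[OF E x] sectionsD(2)[OF E u x] x by (simp add: sec_mult_def)
  fix x assume x: "x \<in> points (vb_base E)"
  obtain U \<tau> where U: "openin (manifold_top (vb_base E)) U" "x \<in> U" "local_trivialisation E U \<tau>"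
    by (rule trivialisation_exists[OF E x])
  have sub: "q \<in> points (vb_base E)" if "q \<in> U" for q
    using trivialisation_atlases(2)[OF E U(1)] that by auto
  show "smooth_at (vb_base E) (vb_total E) (sec_mult E f u) x"
  proof (rule smooth_at_sectionI[OF E U(1,3) U(1,2) subset_refl])
    have "smooth_at (vb_base E) model_atlas f x"
      using f x smooth_functions_iff[OF vector_bundleD(2)[OF E]] by blast
    then show "smooth_at (vb_base E) model_atlas (\<lambda>q. f q *\<^sub>R snd (\<tau> (u q))) x"
      by (rule smooth_at_model_combine[where P="\<lambda>a b. a *\<^sub>R b", OF vector_bundleD(2)[OF E]
            finite_dimensional_real vector_bundleD(4)[OF E] _ smooth_at_section_trivialised[OF E u U(1,3,2)] smooth_on_scaleR])
    fix q assume q: "q \<in> U"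
    show "sec_mult E f u q \<in> fibre E q" by (rule fib[OF sub[OF q]])
    show "snd (\<tau> (sec_mult E f u q)) = f q *\<^sub>R snd (\<tau> (u q))"
      using trivialisation_fibre(3)[OF U(3) q sectionsD(2)[OF E u sub[OF q]]] sub[OF q]
      by (simp add: sec_mult_def)
  qed
qed

text \<open>Take the section that is constant in a trivialisation, multiply it by a bump function
  and extend it by the zero section.\<close>

lemma section_through:
  assumes E: "vector_bundle E" and x: "x \<in> points (vb_base E)" and e: "e \<in> fibre E x"
  obtains u where "u \<in> sections E" "u x = e"
proof -
  let ?N = "vb_base E"
  note N = vector_bundleD(2)[OF E] and k = vector_bundleD(4)[OF E]
  obtain U \<tau> where U: "openin (manifold_top ?N) U" "x \<in> U" "local_trivialisation E U \<tau>"
    by (rule trivialisation_exists[OF E x])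
  obtain f K where f: "f \<in> smooth_functions ?N" "f x = 1" "K \<subseteq> U" "closedin (manifold_top ?N) K"
    "\<And>q. q \<notin> K \<Longrightarrow> f q = (0::real)"
    using smooth_bump_function[OF vector_bundleD(1)[OF E] U(1,2)] by metis
  have fs: "smooth_at ?N model_atlas f q" if "q \<in> points ?N" for q
    using f(1) that smooth_functions_iff[OF N] by blast
  have sub: "q \<in> points ?N" if "q \<in> U" for q
    using trivialisation_atlases(2)[OF E U(1)] that by auto
  define u where "u = (\<lambda>q\<in>points ?N. if q \<in> U then triv_inv E U \<tau> q (f q *\<^sub>R snd (\<tau> e)) else vb_zero E q)"
  have fib: "u q \<in> fibre E q" if "q \<in> points ?N" for q
    using that triv_inv(1)[OF E U(1,3)] fibre_vector_space(1)[OF E that] by (simp add: u_def)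
  \<comment> \<open>Both branches of \<open>u\<close> give the zero vector off \<open>K\<close>,
    which is what glues them smoothly.\<close>
  have zero: "u q = vb_zero E q" if q: "q \<in> points ?N" "q \<notin> K" for q
  proof (cases "q \<in> U")
    case True
    have "snd (\<tau> (u q)) = 0"
      using True q f(5) triv_inv(2)[OF E U(1,3) True] by (simp add: u_def)
    then show ?thesis
      using trivialisation_inj[OF E U(1,3) True fib[OF q(1)] fibre_vector_space(1)[OF E q(1)]]
        trivialisation_zero[OF E q(1) U(3) True] by simp
  qed (use q in \<open>simp add: u_def\<close>)
  have "u \<in> sections E"
  proof (rule sectionsI[OF E _ _ fib])
    show "u \<in> extensional (points ?N)" by (simp add: u_def)
    fix q assume q: "q \<in> points ?N"
    show "smooth_at ?N (vb_total E) u q"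
    proof (cases "q \<in> U")
      case True
      show ?thesis
      proof (rule smooth_at_sectionI[OF E U(1,3) U(1) True subset_refl])
        show "smooth_at ?N model_atlas (\<lambda>q. f q *\<^sub>R snd (\<tau> e)) q"
          by (rule smooth_at_model_combine[where P="\<lambda>a b. a *\<^sub>R b", OF N finite_dimensional_real k
                fs[OF q] smooth_at_const_model[OF N q] smooth_on_scaleR])
        fix q assume "q \<in> U"
        then show "u q \<in> fibre E q" "snd (\<tau> (u q)) = f q *\<^sub>R snd (\<tau> e)"
          using fib[OF sub] sub triv_inv(2)[OF E U(1,3)] by (blast, simp add: u_def)
      qed
    next
      case False
      obtain U' \<tau>' where U': "openin (manifold_top ?N) U'" "q \<in> U'" "local_trivialisation E U' \<tau>'"
        by (rule trivialisation_exists[OF E q])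
      have o: "openin (manifold_top ?N) (U' \<inter> (points ?N - K))"
        using f(4) U'(1) by (auto simp: closedin_def openin_smooth_atlas(2)[OF N])
      show ?thesis
      proof (rule smooth_at_sectionI[OF E U'(1,3) o])
        show "q \<in> U' \<inter> (points ?N - K)" using False f(3) q U' by auto
        show "smooth_at ?N model_atlas (\<lambda>_. 0) q" by (rule smooth_at_const_model[OF N q])
        fix q assume q: "q \<in> U' \<inter> (points ?N - K)"
        show "u q \<in> fibre E q" using fib q by auto
        show "snd (\<tau>' (u q)) = 0"
          using zero trivialisation_zero[OF E _ U'(3)] q by simp
      qed auto
    qed
  qed
  moreover have "u x = e"
    using triv_inv(3)[OF E U(1,3,2) e] x U(2) f(2) by (simp add: u_def)
  ultimately show thesis by (rule that)
qed

section \<open>Fibres of the tangent bundle and linearity of tangent maps\<close>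

lemma fibre_tangent_bundle:
  "fibre (tangent_bundle A) x = (if x \<in> points A then {x} \<times> tangent_space A x else {})"
  unfolding fibre_def points_tangent_bundle by (auto simp: tangent_bundle_def)

lemma vb_scale_tangent_bundle: "vb_scale (tangent_bundle A) a (p, v) = (p, \<lambda>c. a *\<^sub>R v c)"
  by (simp add: tangent_bundle_def)

lemma vb_add_tangent_bundle: "vb_add (tangent_bundle A) (p, v) (q, w) = (p, \<lambda>c. v c + w c)"
  by (simp add: tangent_bundle_def)

lemma vb_base_tangent_bundle: "vb_base (tangent_bundle A) = A"
  by (simp add: tangent_bundle_def)

lemma tangent_map_add:
  assumes A: "smooth_atlas A" and B: "smooth_atlas B" and f: "smooth_at A B f p"
    and "v \<in> tangent_space A p" "w \<in> tangent_space A p" "(\<lambda>c. v c + w c) \<in> tangent_space A p"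
  shows "tangent_map A B f (p, \<lambda>c. v c + w c) =
    vb_add (tangent_bundle B) (tangent_map A B f (p, v)) (tangent_map A B f (p, w))"
proof -
  obtain c where c: "c \<in> charts_at A p" using charts_at_nonempty[OF smooth_at_in_points(1)[OF f]] by blast
  show ?thesis
    unfolding assms(4-6)[THEN tangent_map_apply[OF A B f _ c]] vb_add_tangent_bundle
    using local_deriv_linear(1)[OF A B f c] by (simp add: fun_eq_iff)
qed

lemma tangent_map_scale:
  assumes A: "smooth_atlas A" and B: "smooth_atlas B" and f: "smooth_at A B f p"
    and "v \<in> tangent_space A p" "(\<lambda>c. a *\<^sub>R v c) \<in> tangent_space A p"
  shows "tangent_map A B f (p, \<lambda>c. a *\<^sub>R v c) = vb_scale (tangent_bundle B) a (tangent_map A B f (p, v))"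
proof -
  obtain c where c: "c \<in> charts_at A p" using charts_at_nonempty[OF smooth_at_in_points(1)[OF f]] by blast
  show ?thesis
    unfolding assms(4,5)[THEN tangent_map_apply[OF A B f _ c]] vb_scale_tangent_bundle
    using local_deriv_linear(2)[OF A B f c] by (simp add: fun_eq_iff)
qed

lemma zero_in_tangent_space:
  assumes A: "smooth_atlas A" and p: "p \<in> points A"
  shows "(\<lambda>c. 0) \<in> tangent_space A p"
  by (rule tangent_spaceI) (simp_all add: local_deriv_linear(3)[OF A A smooth_at_id[OF A p]])

lemma tangent_map_zero:
  assumes A: "smooth_atlas A" and B: "smooth_atlas B" and f: "smooth_at A B f p"
  shows "tangent_map A B f (p, \<lambda>c. 0) = (f p, \<lambda>c. 0)"
proof -
  note p = smooth_at_in_points(1)[OF f]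
  obtain c where c: "c \<in> charts_at A p" using charts_at_nonempty[OF p] by blast
  show ?thesis
    unfolding tangent_map_apply[OF A B f zero_in_tangent_space[OF A p] c]
    using local_deriv_linear(3)[OF A B f c] by (simp add: fun_eq_iff)
qed

section \<open>The anchor\<close>

text \<open>Continuity is applied to the component of the tangent vector in one chart
  \<open>d\<close>, where being nonzero is an open condition on the total space of the tangent
  bundle.\<close>

lemma bundle_map_nonzero_nearby:
  fixes B :: "('b, 'd::real_inner) atlas"
  assumes E: "vector_bundle E" and x: "x \<in> points (vb_base E)" and B: "smooth_atlas B"
    and \<Phi>: "smooth_map (vb_total E) (vb_total (tangent_bundle B)) \<Phi>"
    and X: "X \<in> sections E" and w: "\<Phi> (X x) = (p, w)" "w \<noteq> (\<lambda>c. 0)"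
  obtains N where "openin (manifold_top (vb_base E)) N" "x \<in> N" "\<And>q. q \<in> N \<Longrightarrow> snd (\<Phi> (X q)) \<noteq> (\<lambda>c. 0)"
proof -
  note A = vector_bundleD(2,3)[OF E] and TB = smooth_atlas_tangent_bundle[OF B]
  note s = sectionsD[OF E X x]
  have "smooth_at (vb_total E) (vb_total (tangent_bundle B)) \<Phi> (X x)"
    using \<Phi> fibreD(1)[OF s(2)] smooth_map_iff_smooth_at[OF A(2) TB] by blast
  then have c: "smooth_at (vb_base E) (vb_total (tangent_bundle B)) (\<lambda>q. \<Phi> (X q)) x"
    by (rule smooth_at_compose[OF A TB s(1)])
  have pw: "p \<in> points B" "w \<in> tangent_space B p"
    using smooth_at_in_points(2)[OF c] by (simp_all add: points_tangent_bundle w)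
  obtain d where d: "w d \<noteq> 0"
    using w(2) by (metis ext)
  \<comment> \<open>Tangent vectors are extended by 0 to all other arguments, so a nonzero value
    shows that \<open>d\<close> is a chart around \<open>p\<close>.\<close>
  then have dp: "d \<in> charts_at B p" using tangent_spaceD(2)[OF pw(2)] by blast
  note d' = charts_atD[OF dp]
  have tc: "tangent_chart B d \<in> vb_total (tangent_bundle B)"
    using d' by (simp add: vb_total_tangent_bundle)
  define V where "V = {z \<in> fst (tangent_chart B d). snd (snd (tangent_chart B d) z) \<noteq> 0}"
  have "snd (tangent_chart B d) ` V = snd (tangent_chart B d) ` fst (tangent_chart B d) \<inter> {z. snd z \<noteq> 0}"
    by (auto simp: V_def)
  moreover have "open {z :: 'd \<times> 'd. snd z \<noteq> 0}"
    by (intro open_Collect_neq continuous_intros)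
  ultimately have "open (snd (tangent_chart B d) ` V)"
    using smooth_atlasD(3)[OF TB tc] by auto
  then have V: "openin (manifold_top (vb_total (tangent_bundle B))) V"
    by (intro openin_chart[OF TB tc]) (auto simp: V_def)
  have "\<Phi> (X x) \<in> V"
    using d d' pw by (simp add: V_def w tangent_chart_def)
  then obtain N where N: "openin (manifold_top (vb_base E)) N" "x \<in> N" "(\<lambda>q. \<Phi> (X q)) ` N \<subseteq> V"
    using smooth_at_open_preimage[OF A(1) TB c V] by metis
  have "snd z \<noteq> (\<lambda>c. 0)" if "z \<in> V" for z
    using that by (auto simp: V_def tangent_chart_def)
  then show thesis using that N by blast
qed

lemma bundle_morphism_fibre:
  assumes "bundle_morphism E (tangent_bundle (vb_base E)) \<Phi> \<phi>" "x \<in> points (vb_base E)" "e \<in> fibre E x"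
  obtains w where "\<Phi> e = (\<phi> x, w)" "w \<in> tangent_space (vb_base E) (\<phi> x)" "\<phi> x \<in> points (vb_base E)"
proof -
  have "\<Phi> e \<in> fibre (tangent_bundle (vb_base E)) (\<phi> x)"
    using assms by (simp add: bundle_morphism_def)
  then show thesis
    using that unfolding fibre_tangent_bundle by (auto split: if_splits)
qed

lemma morphism_vanishes_over_moved_points:
  fixes F :: "('f, 'n, 'e::real_inner, 'k::real_inner) vbundle"
  assumes F: "vector_bundle F"
    and bij: "bij_betw \<phi> (points (vb_base F)) (points (vb_base F))"
    and \<Phi>: "bundle_morphism F (tangent_bundle (vb_base F)) \<Phi> \<phi>"
    and br: "section_lie_bracket F br"
    and leibniz: "\<And>u v f. u \<in> sections F \<Longrightarrow> v \<in> sections F \<Longrightarrow> f \<in> smooth_functions (vb_base F) \<Longrightarrow>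
      br u (sec_mult F f v) =
        sec_add F (sec_mult F f (br u v))
          (sec_mult F (field_derivative (vb_base F) (induced_map F \<Phi> \<phi> u) f) v)"
    and y: "y \<in> points (vb_base F)" "\<phi> y \<noteq> y" and e: "e \<in> fibre F y"
  shows "\<Phi> e = (\<phi> y, \<lambda>c. 0)"
proof -
  define N where "N = vb_base F"
  define x where "x = \<phi> y"
  note M = vector_bundleD(1)[OF F, folded N_def] and A = vector_bundleD(2)[OF F, folded N_def]
  obtain w where w: "\<Phi> e = (x, w)" "w \<in> tangent_space N x" "x \<in> points N"
    using bundle_morphism_fibre[OF \<Phi> y(1) e] unfolding x_def N_def by metis
  have inv: "inv_into (points N) \<phi> x = y"
    using bij y unfolding x_def N_def by (metis bij_betw_inv_into_left)
  show ?thesis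
  proof (cases "\<forall>k::'k. k = 0") \<comment> \<open>for rank 0 the Leibniz rule carries no information\<close>
    case True
    obtain U \<tau> where U: "openin (manifold_top (vb_base F)) U" "y \<in> U" "local_trivialisation F U \<tau>"
      by (rule trivialisation_exists[OF F y(1)])
    \<comment> \<open>All elements of the fibre have the same trivialised value, so \<open>e\<close>
      is 0 times itself and fibrewise linearity makes its image the zero vector.\<close>
    have e0: "e = vb_scale F 0 e"
      by (rule trivialisation_inj[OF F U(1,3,2) e fibre_vector_space(3)[OF F y(1) e]]) (use True in metis)
    have "\<Phi> (vb_scale F 0 e) = vb_scale (tangent_bundle (vb_base F)) 0 (\<Phi> e)"
      using \<Phi> y(1) e by (simp add: bundle_morphism_def)
    then have "\<Phi> e = vb_scale (tangent_bundle (vb_base F)) 0 (x, w)"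
      unfolding e0[symmetric] w(1) .
    then show ?thesis by (simp add: vb_scale_tangent_bundle x_def)
  next
    case False
    then obtain k :: 'k where k: "k \<noteq> 0" by blast
    have xF: "x \<in> points (vb_base F)" using w(3) by (simp add: N_def)
    obtain U \<tau> where U: "openin (manifold_top (vb_base F)) U" "x \<in> U" "local_trivialisation F U \<tau>"
      by (rule trivialisation_exists[OF F xF])
    obtain u where u: "u \<in> sections F" "u y = e" by (rule section_through[OF F y(1) e])
    obtain v where v: "v \<in> sections F" "v x = triv_inv F U \<tau> x k"
      by (rule section_through[OF F xF triv_inv(1)[OF F U(1,3,2)]])
    \<comment> \<open>Evaluating at \<open>x\<close> and trivialising turns identities between
      sections into identities in the vector space \<open>'k\<close>, where terms can be moved and
      cancelled.\<close>
    define t where "t s = snd (\<tau> (s x))" for s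
    have tv: "t v \<noteq> 0" using k v(2) triv_inv(2)[OF F U(1,3,2)] by (simp add: t_def)
    have fib: "s x \<in> fibre F x" if "s \<in> sections F" for s by (rule sectionsD(2)[OF F that xF])
    \<comment> \<open>Stated in terms of values at \<open>x\<close> because the Leibniz rule
      contains a section multiplied by a derivative along a field; splitting it this way avoids
      showing that this derivative is smooth.\<close>
    have t_add: "t (sec_add F r s) = t r + t s" if "r x \<in> fibre F x" "s x \<in> fibre F x" for r s
      using trivialisation_fibre(2)[OF U(3,2) that] xF by (simp add: t_def sec_add_def)
    have t_mult: "t (sec_mult F f s) = f x *\<^sub>R t s" if "s x \<in> fibre F x" for f s
      using trivialisation_fibre(3)[OF U(3,2) that] xF by (simp add: t_def sec_mult_def)
    have mult_fib: "sec_mult F f s x \<in> fibre F x" if "s \<in> sections F" for f s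
      using fibre_vector_space(3)[OF F xF fib[OF that]] xF by (simp add: sec_mult_def)
    have br_sec: "br r s \<in> sections F" if "r \<in> sections F" "s \<in> sections F" for r s
      using br that by (simp add: section_lie_bracket_def lie_bracket_on_def)
    have br_self: "t (br s s) = 0" if "s \<in> sections F" for s
    proof -
      have "br s s = sec_zero F"
        using br that by (simp add: section_lie_bracket_def lie_bracket_on_def)
      then show ?thesis using trivialisation_zero[OF F xF U(3,2)] xF by (simp add: t_def sec_zero_def)
    qed
    have br_add: "t (br (sec_add F r s) q) = t (br r q) + t (br s q)"
      "t (br q (sec_add F r s)) = t (br q r) + t (br q s)"
      if "r \<in> sections F" "s \<in> sections F" "q \<in> sections F" for q r s
    proof -
      have "br (sec_add F r s) q = sec_add F (br r q) (br s q)" "br q (sec_add F r s) = sec_add F (br q r) (br q s)"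
        using br that by (simp_all add: section_lie_bracket_def lie_bracket_on_def)
      then show "t (br (sec_add F r s) q) = t (br r q) + t (br s q)"
        "t (br q (sec_add F r s)) = t (br q r) + t (br q s)"
        using t_add fib br_sec that by simp_all
    qed
    \<comment> \<open>Polarisation: expand the vanishing bracket of \<open>r + s\<close> with
      itself.\<close>
    have anti: "t (br r s) = - t (br s r)" if rs: "r \<in> sections F" "s \<in> sections F" for r s
    proof -
      note a = sec_add_in_sections[OF F rs]
      have "0 = t (br (sec_add F r s) (sec_add F r s))" using br_self[OF a] by simp
      also have "\<dots> = t (br r s) + t (br s r)"
        using br_add(1)[OF rs a] br_add(2)[OF rs rs(1)] br_add(2)[OF rs rs(2)] br_self rs by simp
      finally show ?thesis by (simp add: eq_neg_iff_add_eq_0)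
    qed
    define D where "D s f = tangent_derivative N (\<Phi> (s y)) f" for s f
    have L: "t (br r (sec_mult F f s)) = f x *\<^sub>R t (br r s) + D r f *\<^sub>R t s"
      if "r \<in> sections F" "s \<in> sections F" "f \<in> smooth_functions N" for r s f
    proof -
      \<comment> \<open>The induced field at \<open>x\<close> evaluates the section at the preimage
        \<open>y\<close>, so the derivative term at \<open>x\<close> depends on \<open>r\<close>
        only through \<open>r y\<close>.\<close>
      have d: "field_derivative (vb_base F) (induced_map F \<Phi> \<phi> r) f x = D r f"
        using w(3) inv by (simp add: field_derivative_def induced_map_def D_def N_def)
      show ?thesis
        unfolding leibniz[OF that(1,2) that(3)[unfolded N_def]]
        by (subst t_add) (simp_all add: mult_fib t_mult fib br_sec that(1,2) d)
    qed
    have Hd: "Hausdorff_space (manifold_top N)" using M by (simp add: smooth_manifold_def)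
    \<comment> \<open>Confining the bump at \<open>y\<close> to a set disjoint from a neighbourhood
      of \<open>x\<close> makes \<open>f\<close> vanish identically around \<open>x\<close>, hence
      also its derivative there.\<close>
    obtain Ux Uy where sep: "openin (manifold_top N) Ux" "openin (manifold_top N) Uy" "x \<in> Ux" "y \<in> Uy" "disjnt Ux Uy"
      using Hd[unfolded Hausdorff_space_def openin_smooth_atlas(2)[OF A], rule_format, of x y] w(3) y
      unfolding x_def N_def by metis
    obtain f K where f: "f \<in> smooth_functions N" "f y = 1" "K \<subseteq> Uy" "\<And>q. q \<notin> K \<Longrightarrow> f q = (0::real)"
      using smooth_bump_function[OF M sep(2,4)] by metis
    have fU: "f q = 0" if "q \<in> Ux" for q
      using that sep(5) f(3,4) by (auto simp: disjnt_iff)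
    have fx: "f x = 0" by (rule fU[OF sep(3)])
    have Df: "D s f = 0" if s: "s \<in> sections F" for s
    proof -
      obtain w' where "\<Phi> (s y) = (x, w')"
        using bundle_morphism_fibre[OF \<Phi> y(1) sectionsD(2)[OF F s y(1)]] unfolding x_def by metis
      then show ?thesis
        using tangent_derivative_locally_zero[OF A w(3) f(1) sep(1,3) fU] by (simp add: D_def)
    qed
    have fu: "sec_mult F f u \<in> sections F" by (rule sec_mult_in_sections[OF F u(1) f(1)[unfolded N_def]])
    have fuy: "sec_mult F f u y = e"
      using y(1) u(2) f(2) fibre_vector_space(4)[OF F y(1) e] by (simp add: sec_mult_def)
    \<comment> \<open>\<open>f\<close> sits in the left argument, where no Leibniz rule is assumed;
      antisymmetry moves it to the right, and the resulting terms carry the factors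
      \<open>f x\<close> and \<open>D s f\<close>.\<close>
    have zero: "t (br (sec_mult F f u) s) = 0" if s: "s \<in> sections F" for s
      using anti[OF fu s] L[OF s u(1) f(1)] fx Df[OF s] by simp
    have "tangent_derivative N (x, w) g = 0" if g: "g \<in> smooth_functions N" for g
    proof -
      have gv: "sec_mult F g v \<in> sections F" by (rule sec_mult_in_sections[OF F v(1) g[unfolded N_def]])
      \<comment> \<open>Both brackets in the Leibniz rule for \<open>g\<close> have left argument
        \<open>sec_mult F f u\<close> and vanish under \<open>t\<close>. Only the derivative term
        remains, and its vector is \<open>\<Phi> e\<close> because \<open>f y = 1\<close>.\<close>
      have "0 = D (sec_mult F f u) g *\<^sub>R t v"
        using L[OF fu v(1) g] zero[OF gv] zero[OF v(1)] by simp
      then show ?thesis using tv by (simp add: D_def fuy w(1))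
    qed
    then have "w = (\<lambda>c. 0)" by (rule tangent_derivative_eq_0_imp[OF M w(3,2)])
    then show ?thesis using w(1) by (simp add: x_def)
  qed
qed

theorem theorem3p1:
  fixes F :: "('f, 'n, 'e::real_inner, 'k::real_inner) vbundle"
    and \<Phi> :: "'f \<Rightarrow> ('n, 'e) tangent"
    and \<phi> :: "'n \<Rightarrow> 'n"
    and br :: "('n \<Rightarrow> 'f) \<Rightarrow> ('n \<Rightarrow> 'f) \<Rightarrow> 'n \<Rightarrow> 'f"
  assumes "vector_bundle F"
    and "diffeomorphism (vb_base F) (vb_base F) \<phi>"
    and "bundle_morphism F (tangent_bundle (vb_base F)) \<Phi> \<phi>"
    and "section_lie_bracket F br"
    and "\<And>u v f. u \<in> sections F \<Longrightarrow> v \<in> sections F \<Longrightarrow> f \<in> smooth_functions (vb_base F) \<Longrightarrow>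
      br u (sec_mult F f v) =
        sec_add F (sec_mult F f (br u v))
          (sec_mult F (field_derivative (vb_base F) (induced_map F \<Phi> \<phi> u) f) v)"
  shows "lie_algebroid F br
    (inv_into (points (vb_total (tangent_bundle (vb_base F)))) (tangent_map (vb_base F) (vb_base F) \<phi>) \<circ> \<Phi>)"
proof -
  define N where "N = vb_base F"
  define TN where "TN = vb_total (tangent_bundle N)"
  define \<phi>i where "\<phi>i = inv_into (points N) \<phi>"
  \<comment> \<open>The anchor is given through an abstract \<open>inv_into\<close>; the tangent map
    of the inverse diffeomorphism is a concrete form of it whose smoothness is available.\<close>
  define Ti where "Ti = tangent_map N N \<phi>i"
  define \<Psi> where "\<Psi> = inv_into (points TN) (tangent_map N N \<phi>) \<circ> \<Phi>"
  note F = assms(1) and \<Phi> = assms(3)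
  note M = vector_bundleD(1)[OF F, folded N_def] and A = vector_bundleD(2)[OF F, folded N_def]
    and TF = vector_bundleD(3)[OF F]
  note TA = smooth_atlas_tangent_bundle[OF A, folded TN_def]
  have bij: "bij_betw \<phi> (points N) (points N)"
    using assms(2) by (simp add: diffeomorphism_def N_def)
  have smooth: "smooth_at N N \<phi> p" "smooth_at N N \<phi>i p" if "p \<in> points N" for p
    using assms(2) smooth_map_iff_smooth_at[OF A A] that
    by (simp_all add: diffeomorphism_def N_def \<phi>i_def)
  have \<phi>i: "\<phi>i (\<phi> p) = p" "\<phi> (\<phi>i p) = p" "\<phi> p \<in> points N" "\<phi>i p \<in> points N" if "p \<in> points N" for p
    using that bij unfolding \<phi>i_def
    by (simp_all add: bij_betw_inv_into_left bij_betw_inv_into_right)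
      (simp_all add: bij_betw_def inv_into_into, blast)
  have pTN: "points TN = (SIGMA p:points N. tangent_space N p)"
    by (simp add: TN_def points_tangent_bundle)
  have topN: "openin (manifold_top N) (points N)"
    using openin_topspace[of "manifold_top N"] by (simp add: openin_smooth_atlas(2)[OF A])
  \<comment> \<open>Used in both orders: one gives injectivity of
    \<open>tangent_map N N \<phi>\<close>, the other shows that \<open>Ti\<close> produces
    preimages.\<close>
  have T_inv: "tangent_map N N g (tangent_map N N h (p, v)) = (p, v)"
    if pv: "p \<in> points N" "v \<in> tangent_space N p" and g: "\<And>p. p \<in> points N \<Longrightarrow> smooth_at N N g p"
      and h: "\<And>p. p \<in> points N \<Longrightarrow> smooth_at N N h p" and gh: "\<And>p. p \<in> points N \<Longrightarrow> g (h p) = p" for g h p v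
  proof -
    have hp: "h p \<in> points N" using smooth_at_in_points(2)[OF h[OF pv(1)]] .
    have "tangent_map N N g (tangent_map N N h (p, v)) = tangent_map N N (g \<circ> h) (p, v)"
      by (rule tangent_map_comp[OF A A A h[OF pv(1)] g[OF hp] pv(2)])
    also have "\<dots> = (p, v)"
    proof (rule tangent_map_eq_self[OF A pv(2) _ topN pv(1)])
      show "smooth_at N N (g \<circ> h) p"
        using smooth_at_compose[OF A A A h[OF pv(1)] g[OF hp]] by (simp add: o_def)
    qed (simp add: gh)
    finally show ?thesis .
  qed
  have Ti_mem: "Ti (p, v) \<in> points TN" "fst (Ti (p, v)) = \<phi>i p" if "p \<in> points N" "v \<in> tangent_space N p" for p v
  proof -
    show "fst (Ti (p, v)) = \<phi>i p" by (simp add: Ti_def tangent_map_def Let_def)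
    then show "Ti (p, v) \<in> points TN"
      using tangent_map_in_tangent_space[OF A A smooth(2)[OF that(1)] that(2)] \<phi>i(4)[OF that(1)]
      by (cases "Ti (p, v)") (simp add: pTN Ti_def)
  qed
  have inj: "inj_on (tangent_map N N \<phi>) (points TN)"
  proof (rule inj_on_inverseI)
    fix z assume "z \<in> points TN"
    then obtain p v where "z = (p, v)" "p \<in> points N" "v \<in> tangent_space N p" by (auto simp: pTN)
    then show "Ti (tangent_map N N \<phi> z) = z"
      unfolding Ti_def using T_inv[of p v \<phi>i \<phi>] smooth \<phi>i by simp
  qed
  have inv_T: "inv_into (points TN) (tangent_map N N \<phi>) (p, v) = Ti (p, v)"
    if pv: "p \<in> points N" "v \<in> tangent_space N p" for p v
  proof (rule inv_into_f_eq[OF inj Ti_mem(1)[OF pv]])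
    show "tangent_map N N \<phi> (Ti (p, v)) = (p, v)"
      unfolding Ti_def using T_inv[OF pv, of \<phi> \<phi>i] smooth \<phi>i by simp
  qed
  have \<Phi>_fib: "\<exists>w. \<Phi> e = (\<phi> x, w) \<and> w \<in> tangent_space N (\<phi> x) \<and> \<Psi> e = Ti (\<phi> x, w)"
    if x: "x \<in> points N" and e: "e \<in> fibre F x" for x e
  proof -
    obtain w where w: "\<Phi> e = (\<phi> x, w)" "w \<in> tangent_space N (\<phi> x)" "\<phi> x \<in> points N"
      using bundle_morphism_fibre[OF \<Phi> x[unfolded N_def] e] unfolding N_def by metis
    then show ?thesis using inv_T by (simp add: \<Psi>_def)
  qed
  have proj_N: "vb_proj F e \<in> points N" if "e \<in> points (vb_total F)" for e
  proof -
    have "smooth_at (vb_total F) N (vb_proj F) e"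
      using vector_bundleD(5)[OF F, folded N_def] that by (simp add: smooth_map_iff_smooth_at[OF TF A])
    then show ?thesis by (rule smooth_at_in_points(2))
  qed
  have morphism: "bundle_morphism F (tangent_bundle N) \<Psi> id"
    unfolding bundle_morphism_def vb_base_tangent_bundle TN_def[symmetric] N_def[symmetric] id_apply
  proof (intro conjI ballI allI)
    show "smooth_map N N (\<lambda>x. x)"
      unfolding smooth_map_iff_smooth_at[OF A A] using smooth_at_id[OF A] by (simp add: id_def)
    show "smooth_map (vb_total F) TN \<Psi>"
      unfolding smooth_map_iff_smooth_at[OF TF TA]
    proof
      fix e assume e: "e \<in> points (vb_total F)"
      have ex: "\<exists>p v. p \<in> points N \<and> v \<in> tangent_space N p \<and> \<Phi> e = (p, v) \<and> \<Psi> e = Ti (p, v)"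
        if "e \<in> points (vb_total F)" for e
        using \<Phi>_fib[OF proj_N[OF that], of e] \<phi>i(3)[OF proj_N[OF that]] that by (auto simp: fibre_def)
      have "smooth_map (vb_total F) TN \<Phi>"
        using \<Phi> by (simp add: bundle_morphism_def TN_def N_def)
      then have 1: "smooth_at (vb_total F) TN \<Phi> e"
        using e smooth_map_iff_smooth_at[OF TF TA] by blast
      obtain p v where pv: "p \<in> points N" "v \<in> tangent_space N p" "\<Phi> e = (p, v)"
        using ex[OF e] by blast
      have "smooth_at TN TN Ti (\<Phi> e)"
        unfolding Ti_def TN_def pv(3) by (rule smooth_at_tangent_map[OF A A smooth(2)[OF pv(1)] pv(2)])
      \<comment> \<open>\<open>\<Psi>\<close> is known to agree with
        \<open>Ti \<circ> \<Phi>\<close> on the points of the total space, where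
        \<open>inv_into\<close> is controlled; that set is open, so smoothness carries over.\<close>
      from smooth_at_compose[OF TF TA TA 1 this]
      show "smooth_at (vb_total F) TN \<Psi> e"
      proof (rule smooth_at_cong[OF TF TA])
        show "openin (manifold_top (vb_total F)) (points (vb_total F))"
          using openin_topspace[of "manifold_top (vb_total F)"] by (simp add: openin_smooth_atlas(2)[OF TF])
        show "Ti (\<Phi> q) = \<Psi> q" if "q \<in> points (vb_total F)" for q
          using ex[OF that] by auto
      qed (rule e)
    qed
    fix x e assume x: "x \<in> points N" and e: "e \<in> fibre F x"
    have xF: "x \<in> points (vb_base F)" using x by (simp add: N_def)
    obtain w where w: "\<Phi> e = (\<phi> x, w)" "w \<in> tangent_space N (\<phi> x)" "\<Psi> e = Ti (\<phi> x, w)"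
      using \<Phi>_fib[OF x e] by blast
    note sm = smooth(2)[OF \<phi>i(3)[OF x]]
    show "\<Psi> e \<in> fibre (tangent_bundle N) x"
      using Ti_mem[OF \<phi>i(3)[OF x] w(2)] \<phi>i(1)[OF x] x
      by (simp add: w(3) fibre_def TN_def) (simp add: tangent_bundle_def)
    {
      fix e' assume e': "e' \<in> fibre F x"
      obtain w' where w': "\<Phi> e' = (\<phi> x, w')" "w' \<in> tangent_space N (\<phi> x)" "\<Psi> e' = Ti (\<phi> x, w')"
        using \<Phi>_fib[OF x e'] by blast
      have eq: "\<Phi> (vb_add F e e') = (\<phi> x, \<lambda>c. w c + w' c)"
        using \<Phi> xF e e' by (simp add: bundle_morphism_def w w' vb_add_tangent_bundle)
      \<comment> \<open>That the sum is a tangent vector is read off from its being a value of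
        \<open>\<Phi>\<close> on the fibre.\<close>
      obtain s where s: "\<Phi> (vb_add F e e') = (\<phi> x, s)" "s \<in> tangent_space N (\<phi> x)" "\<Psi> (vb_add F e e') = Ti (\<phi> x, s)"
        using \<Phi>_fib[OF x fibre_vector_space(2)[OF F xF e e']] by blast
      have "s = (\<lambda>c. w c + w' c)" using eq s by simp
      then show "\<Psi> (vb_add F e e') = vb_add (tangent_bundle N) (\<Psi> e) (\<Psi> e')"
        using tangent_map_add[OF A A sm w(2) w'(2)] s by (simp add: w(3) w'(3) Ti_def)
    }
    fix a
    have eq: "\<Phi> (vb_scale F a e) = (\<phi> x, \<lambda>c. a *\<^sub>R w c)"
      using \<Phi> xF e by (simp add: bundle_morphism_def w vb_scale_tangent_bundle)
    obtain s where s: "\<Phi> (vb_scale F a e) = (\<phi> x, s)" "s \<in> tangent_space N (\<phi> x)" "\<Psi> (vb_scale F a e) = Ti (\<phi> x, s)"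
      using \<Phi>_fib[OF x fibre_vector_space(3)[OF F xF e]] by blast
    have "s = (\<lambda>c. a *\<^sub>R w c)" using eq s by simp
    then show "\<Psi> (vb_scale F a e) = vb_scale (tangent_bundle N) a (\<Psi> e)"
      using tangent_map_scale[OF A A sm w(2)] s by (simp add: w(3) Ti_def)
  qed
  have vanish: "\<Phi> e = (\<phi> y, \<lambda>c. 0)" if "y \<in> points N" "\<phi> y \<noteq> y" "e \<in> fibre F y" for y e
    by (rule morphism_vanishes_over_moved_points[OF F bij[unfolded N_def] \<Phi> assms(4) assms(5) that[unfolded N_def]])
  \<comment> \<open>\<open>\<Psi>\<close> looks at \<open>X x\<close> and pulls the result back,
    while \<open>induced_map\<close> looks at \<open>X\<close> over the preimage of
    \<open>x\<close>.\<close>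
  have anchor: "\<Psi> (X x) = induced_map F \<Phi> \<phi> X x" if X: "X \<in> sections F" and x: "x \<in> points N" for X x
  proof -
    have xF: "x \<in> points (vb_base F)" using x by (simp add: N_def)
    have ind: "induced_map F \<Phi> \<phi> X x = \<Phi> (X (\<phi>i x))"
      using x by (simp add: induced_map_def \<phi>i_def N_def)
    have fib: "X q \<in> fibre F q" if "q \<in> points N" for q
      using sectionsD(2)[OF F X] that by (simp add: N_def)
    show ?thesis
    proof (cases "\<phi> x = x")
      case False
      have y: "\<phi>i x \<in> points N" by (rule \<phi>i(4)[OF x])
      \<comment> \<open>The preimage of a moved point is itself moved, so both sides are zero
        vectors, and both are based at \<open>x\<close>.\<close>
      have "\<phi> (\<phi>i x) \<noteq> \<phi>i x" using False \<phi>i[OF x] by metis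
      then have 1: "\<Phi> (X (\<phi>i x)) = (x, \<lambda>c. 0)"
        using vanish[OF y _ fib[OF y]] \<phi>i(2)[OF x] by simp
      have "\<Phi> (X x) = (\<phi> x, \<lambda>c. 0)" by (rule vanish[OF x False fib[OF x]])
      moreover obtain w where "\<Phi> (X x) = (\<phi> x, w)" "\<Psi> (X x) = Ti (\<phi> x, w)"
        using \<Phi>_fib[OF x fib[OF x]] by blast
      ultimately have "\<Psi> (X x) = Ti (\<phi> x, \<lambda>c. 0)" by simp
      also have "\<dots> = (x, \<lambda>c. 0)"
        unfolding Ti_def using tangent_map_zero[OF A A smooth(2)[OF \<phi>i(3)[OF x]]] \<phi>i(1)[OF x] by simp
      finally show ?thesis using 1 ind by simp
    next
      case True
      then have ix: "\<phi>i x = x" using \<phi>i(1)[OF x] by simp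
      obtain w where w: "\<Phi> (X x) = (x, w)" "w \<in> tangent_space N x" "\<Psi> (X x) = Ti (x, w)"
        using \<Phi>_fib[OF x fib[OF x]] True by auto
      have "Ti (x, w) = (x, w)"
      proof (cases "w = (\<lambda>c. 0)")
        case True
        then show ?thesis unfolding Ti_def using tangent_map_zero[OF A A smooth(2)[OF x]] ix by simp
      next
        case False
        have "smooth_map (vb_total F) (vb_total (tangent_bundle N)) \<Phi>"
          using \<Phi> by (simp add: bundle_morphism_def N_def)
        from bundle_map_nonzero_nearby[OF F xF A this X w(1) False]
        obtain V where V: "openin (manifold_top N) V" "x \<in> V" "\<And>q. q \<in> V \<Longrightarrow> snd (\<Phi> (X q)) \<noteq> (\<lambda>c. 0)"
          unfolding N_def by metis
        \<comment> \<open>A nonzero \<open>\<Phi> (X q)\<close> cannot occur over a moved point, so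
          \<open>V\<close> consists of fixed points of \<open>\<phi>\<close> and hence of its
          inverse.\<close>
        have "\<phi>i q = q" if q: "q \<in> V" for q
        proof -
          have qN: "q \<in> points N"
            using openin_subset[OF V(1)] q by (auto simp: openin_smooth_atlas(2)[OF A])
          have "\<phi> q = q"
            using vanish[OF qN _ fib[OF qN]] V(3)[OF q] by fastforce
          then show ?thesis using \<phi>i(1)[OF qN] by simp
        qed
        then show ?thesis
          unfolding Ti_def by (intro tangent_map_eq_self[OF A w(2) smooth(2)[OF x] V(1,2)])
      qed
      then show ?thesis using w ind ix by simp
    qed
  qed
  have "br X (sec_mult F f Y) = sec_add F (sec_mult F f (br X Y)) (sec_mult F (field_derivative N (\<Psi> \<circ> X) f) Y)"
    if "X \<in> sections F" "Y \<in> sections F" "f \<in> smooth_functions N" for X Y f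
  proof -
    \<comment> \<open>The fields are compared under \<open>sec_mult\<close>, which restricts to the
      base, because \<open>\<Psi> \<circ> X\<close> and the extensional \<open>induced_map\<close>
      need not agree outside it.\<close>
    have "sec_mult F (field_derivative N (\<Psi> \<circ> X) f) Y = sec_mult F (field_derivative N (induced_map F \<Phi> \<phi> X) f) Y"
      unfolding sec_mult_def field_derivative_def
      using anchor[OF that(1)] by (intro restrict_ext) (simp add: N_def)
    then show ?thesis
      using assms(5)[OF that(1,2) that(3)[unfolded N_def]] by (simp add: N_def)
  qed
  then have "lie_algebroid F br \<Psi>"
    using F assms(4) morphism by (simp add: lie_algebroid_def N_def)
  then show ?thesis by (simp add: \<Psi>_def TN_def N_def)
qed

end
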